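(* Let $v$ be an admissible weight on $\mathbb{R}^{2d}$ (in particular $v\equiv 1$ is allowed), and let $T=\sum_{\lambda}c_\lambda U_\lambda\in\mathcal{A}_v$. Then the spectral radius of $T$ in the Banach algebra $\mathcal{A}_v$ equals its spectral radius in $B(L^2(\mathbb{R}^d))$: $$r_{B(L^2(\mathbb{R}^d))}(T)=r_{\mathcal{A}_v}(T).$$
   Context: For $\lambda=(t,\omega)\in\mathbb{R}^d\times\mathbb{R}^d$ let $U_\lambda$ be the unitary time-frequency shift on $L^2(\mathbb{R}^d)$, $U_{(t,\omega)}f(x)=e^{i\langle\omega,x\rangle}f(x-t)$. A weight is a function $v:\mathbb{R}^{2d}\to[0,\infty)$ with $v(0)=1$, $v(-x)=v(x)$, and radially non-decreasing (for each $x$, $r\mapsto v(rx)$ is non-decreasing on $[0,\infty)$). Let $w(r)=\max_{\|x\|=r}v(x)$ ($\|\cdot\|$ the Euclidean norm). The weight is submultiplicative if $v(x+y)\le v(x)v(y)$ for all $x,y$; it satisfies the GRS condition if $\lim_{n\to\infty}w(nr)^{1/n}=1$ for all $r\ge0$; it is admissible if it is submultiplicative and satisfies GRS. $\mathcal{A}_v$ is the algebra of operators $T=\sum_{\lambda\in\mathbb{R}^{2d}}c_\lambda U_\lambda$ on $L^2(\mathbb{R}^d)$, where $c:\mathbb{R}^{2d}\to\mathbb{C}$ satisfies $\sum_\lambda v(\lambda)|c_\lambda|<\infty$ (so $c$ has countable support and the series converges in operator norm), with norm $\|T\|_{\mathcal{A}_v}=\sum_\lambda v(\lambda)|c_\lambda|$;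 it is a Banach algebra. For a unital Banach algebra $A$, $r_A(x)=\max\{|z|: z1-x \text{ not invertible in } A\}$. *)

theory Defs
  imports "HOL-Analysis.Analysis"
begin

text \<open>Phase space R^{2d} is modelled as (real^'d) \<times> (real^'d); the product norm
  is the Euclidean norm on R^{2d}. Functions on R^d are complex-valued functions
  on real^'d; L^2 elements are identified up to Lebesgue-a.e. equality.\<close>

type_synonym 'd phase = "(real^'d) \<times> (real^'d)"
type_synonym 'd fn = "real^'d \<Rightarrow> complex"

definition L2 :: "'d::finite fn set" where
  "L2 = {f. f \<in> borel_measurable lebesgue \<and> integrable lebesgue (\<lambda>x. (cmod (f x))^2)}"

definition l2norm :: "'d::finite fn \<Rightarrow> real" where
  "l2norm f = sqrt (integral\<^sup>L lebesgue (\<lambda>x. (cmod (f x))^2))"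

definition l2eq :: "'d::finite fn \<Rightarrow> 'd fn \<Rightarrow> bool" where
  "l2eq f g \<longleftrightarrow> (AE x in lebesgue. f x = g x)"

definition tfs :: "'d::finite phase \<Rightarrow> 'd fn \<Rightarrow> 'd fn" where
  "tfs lam f = (\<lambda>x. cis (snd lam \<bullet> x) * f (x - fst lam))"

text \<open>The operator sum_lambda c_lambda U_lambda (pointwise; the sum is absolutely
  convergent a.e. for f in L^2 and agrees a.e. with the operator-norm convergent series).\<close>
definition tf_op :: "('d::finite phase \<Rightarrow> complex) \<Rightarrow> 'd fn \<Rightarrow> 'd fn" where
  "tf_op c f = (\<lambda>x. \<Sum>\<^sub>\<infinity>lam. c lam * tfs lam f x)"

definition w_of :: "('d::finite phase \<Rightarrow> real) \<Rightarrow> real \<Rightarrow> real" where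
  "w_of v r = (SUP x\<in>sphere 0 r. v x)"

definition weight :: "('d::finite phase \<Rightarrow> real) \<Rightarrow> bool" where
  "weight v \<longleftrightarrow> (\<forall>x. 0 \<le> v x) \<and> v 0 = 1 \<and> (\<forall>x. v (- x) = v x) \<and>
     (\<forall>x. mono_on {0..} (\<lambda>r::real. v (r *\<^sub>R x)))"

definition submultiplicative :: "('d::finite phase \<Rightarrow> real) \<Rightarrow> bool" where
  "submultiplicative v \<longleftrightarrow> (\<forall>x y. v (x + y) \<le> v x * v y)"

definition GRS :: "('d::finite phase \<Rightarrow> real) \<Rightarrow> bool" where
  "GRS v \<longleftrightarrow> (\<forall>r\<ge>0. (\<lambda>n. root n (w_of v (real n * r))) \<longlonglongrightarrow> 1)"

definition admissible :: "('d::finite phase \<Rightarrow> real) \<Rightarrow> bool" where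
  "admissible v \<longleftrightarrow> weight v \<and> submultiplicative v \<and> GRS v"

definition in_Av :: "('d::finite phase \<Rightarrow> real) \<Rightarrow> ('d phase \<Rightarrow> complex) \<Rightarrow> bool" where
  "in_Av v c \<longleftrightarrow> countable {lam. c lam \<noteq> 0} \<and> (\<lambda>lam. v lam * cmod (c lam)) summable_on UNIV"

definition bounded_op :: "('d::finite fn \<Rightarrow> 'd fn) \<Rightarrow> bool" where
  "bounded_op S \<longleftrightarrow> (\<forall>f\<in>L2. S f \<in> L2) \<and>
     (\<forall>f\<in>L2. \<forall>g\<in>L2. l2eq f g \<longrightarrow> l2eq (S f) (S g)) \<and>
     (\<forall>f\<in>L2. \<forall>g\<in>L2. \<forall>a b. l2eq (S (\<lambda>x. a * f x + b * g x)) (\<lambda>x. a * S f x + b * S g x)) \<and>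
     (\<exists>K. \<forall>f\<in>L2. l2norm (S f) \<le> K * l2norm f)"

definition inverse_on_L2 :: "('d::finite fn \<Rightarrow> 'd fn) \<Rightarrow> ('d fn \<Rightarrow> 'd fn) \<Rightarrow> bool" where
  "inverse_on_L2 S T \<longleftrightarrow> (\<forall>f\<in>L2. l2eq (S (T f)) f \<and> l2eq (T (S f)) f)"

definition shift_op :: "complex \<Rightarrow> ('d::finite fn \<Rightarrow> 'd fn) \<Rightarrow> 'd fn \<Rightarrow> 'd fn" where
  "shift_op z T f = (\<lambda>x. z * f x - T f x)"

definition spectrum_B :: "('d::finite fn \<Rightarrow> 'd fn) \<Rightarrow> complex set" where
  "spectrum_B T = {z. \<not> (\<exists>S. bounded_op S \<and> inverse_on_L2 S (shift_op z T))}"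

definition spectrum_Av :: "('d::finite phase \<Rightarrow> real) \<Rightarrow> ('d fn \<Rightarrow> 'd fn) \<Rightarrow> complex set" where
  "spectrum_Av v T = {z. \<not> (\<exists>d. in_Av v d \<and> inverse_on_L2 (tf_op d) (shift_op z T))}"

text \<open>Spectral radius: max of |z| over the spectrum (written as Sup; the spectrum is
  nonempty and compact, so this is the maximum).\<close>
definition spec_radius :: "complex set \<Rightarrow> real" where
  "spec_radius S = Sup (cmod ` S)"

end

theory Submission
  imports Defs
begin

text \<open>
  Let \<open>T = \<Sum> c\<^sub>\<lambda> U\<^sub>\<lambda>\<close>. Since \<open>A\<^sub>v \<subseteq> B(L\<^sup>2)\<close>, only \<open>r\<^bsub>A\<^sub>v\<^esub>(T) \<le> r\<^bsub>B(L\<^sup>2)\<^esub>(T)\<close>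
  has content. Two facts about a finite sum \<open>X\<close> are used: every coefficient of \<open>X\<close> is bounded by the
  operator norm of \<open>X\<close> (average over conjugations by time-frequency shifts), and products of \<open>n\<close> factors
  with frequencies in a fixed finite set live on polynomially many points, because the \<open>U\<^sub>\<lambda>\<close> commute up to
  phases. Write \<open>T = F + G\<close> with \<open>F\<close> finite and \<open>G\<close> small in \<open>A\<^sub>v\<close>, and expand \<open>T\<^sup>n\<close> into words in \<open>F\<close> and
  single terms of \<open>G\<close>. With the \<open>G\<close>-letters fixed, such a word is supported in a translate of those
  polynomially many points, so its \<open>A\<^sub>v\<close>-norm is at most a polynomial times the weight on a ball of radius
  \<open>O(n)\<close> (subexponential by GRS) times its operator norm. If \<open>\<parallel>T\<^sup>n\<parallel> \<le> C s\<^sup>n\<close> and \<open>\<parallel>G\<parallel> \<le> \<epsilon>\<close>, the sum over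
  all words is at most \<open>C (s + 2 C \<epsilon>)\<^sup>n\<close> up to that subexponential factor, whence the claim as \<open>\<epsilon> \<rightarrow> 0\<close>.

  The bound \<open>\<parallel>T\<^sup>n\<parallel> \<le> C s\<^sup>n\<close> for \<open>s > r\<^bsub>B(L\<^sup>2)\<^esub>(T)\<close> comes from averaging the resolvent over the \<open>n\<close>-th roots
  of unity and its uniform continuity on annuli; neither holomorphy nor completeness is needed.
\<close>

section \<open>Power growth and the resolvent in a seminormed algebra\<close>

text \<open>The argument closes because of the order in which constants are chosen. The rate
  \<open>s\<close> and the constant \<open>C\<close> depend on the operator norms of the powers
  alone, and the finite part is cut out afterwards, with a remainder small compared with
  \<open>1 / C\<close>. The size of the finite set of frequencies is beyond control, but it affects
  only the degree of a polynomial and the radius of a ball, neither of which changes an exponential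
  rate. The two summands \<open>C * \<epsilon>\<close> in the growth rate have separate origins: one
  is the price of replacing the powers of the operator by those of its finite part, the other that
  of interrupting a run of letters from the finite part, since every new run costs a fresh factor
  \<open>C\<close>. The frequencies of the remainder may lie arbitrarily far out.
  Submultiplicativity charges the weight of each to its own coefficient, so that only the distance
  within a block is left to GRS. Spectral radii are suprema and are meaningful only for nonempty
  bounded sets, so nonemptiness of the operator spectrum has to be proved as well.\<close>

locale seminormed_complex_algebra =
  fixes N :: "'a::ring_1 \<Rightarrow> real" and sc :: "complex \<Rightarrow> 'a"
  assumes N_add: "N (x + y) \<le> N x + N y"
    and N_mult: "N (x * y) \<le> N x * N y"
    and N_one: "N 1 = 1"
    and N_sc: "N (sc a * x) = cmod a * N x"
    and sc_add: "sc (a + b) = sc a + sc b"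
    and sc_mult: "sc (a * b) = sc a * sc b"
    and sc_one: "sc 1 = 1"
    and sc_commute: "sc a * x = x * sc a"
begin

lemma sc_zero: "sc 0 = 0"
  using sc_add[of 0 0] by simp

lemma sc_minus: "sc (- a) = - sc a"
  using sc_add[of a "- a"] by (simp add: sc_zero eq_neg_iff_add_eq_0 add.commute)

lemma sc_diff: "sc (a - b) = sc a - sc b"
  using sc_add[of a "- b"] by (simp add: sc_minus)

lemma sc_power: "sc (a ^ n) = sc a ^ n"
  by (induction n) (simp_all add: sc_one sc_mult)

lemma sc_sum: "sc (\<Sum>i\<in>I. f i) = (\<Sum>i\<in>I. sc (f i))"
  by (induction I rule: infinite_finite_induct) (simp_all add: sc_zero sc_add)

lemma N_zero: "N 0 = 0"
  using N_sc[of 0 0] by simp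

lemma N_minus: "N (- x) = N x"
  using N_sc[of "- 1" x] by (simp add: sc_minus sc_one)

lemma N_diff: "N (x - y) \<le> N x + N y"
  using N_add[of x "- y"] by (simp add: N_minus)

lemma N_diff_commute: "N (x - y) = N (y - x)"
  using N_minus[of "x - y"] by simp

lemma N_nonneg: "0 \<le> N x"
  using N_diff[of x x] by (simp add: N_zero)

lemma N_of_sc: "N (sc a) = cmod a"
  using N_sc[of a 1] by (simp add: N_one)

lemma N_power: "N (x ^ n) \<le> N x ^ n"
proof (induction n)
  case (Suc n)
  have "N (x ^ Suc n) \<le> N x * N (x ^ n)" using N_mult by simp
  also have "\<dots> \<le> N x * N x ^ n" using Suc N_nonneg by (intro mult_left_mono)
  finally show ?case by simp
qed (simp add: N_one)

lemma N_sum: "N (\<Sum>i\<in>I. f i) \<le> (\<Sum>i\<in>I. N (f i))"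
proof (induction I rule: infinite_finite_induct)
  case (insert i I)
  then show ?case using N_add[of "f i" "sum f I"] by simp
qed (simp_all add: N_zero)

lemma N_mult_le: "N x \<le> a \<Longrightarrow> N y \<le> b \<Longrightarrow> N (x * y) \<le> a * b"
  by (meson N_mult N_nonneg mult_mono order_trans)

definition resolvent_at :: "'a \<Rightarrow> complex \<Rightarrow> 'a \<Rightarrow> bool" where
  "resolvent_at x z y \<longleftrightarrow> y * (sc z - x) = 1 \<and> (sc z - x) * y = 1"

lemma resolvent_identity:
  assumes "resolvent_at x z y" "resolvent_at x z' y'"
  shows "y - y' = sc (z' - z) * (y * y')"
proof -
  have "y - y' = y * ((sc z' - x) * y') - (y * (sc z - x)) * y'"
    using assms by (simp add: resolvent_at_def)
  also have "\<dots> = y * (sc z' - sc z) * y'"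
    by (simp add: algebra_simps)
  also have "\<dots> = sc (z' - z) * (y * y')"
    by (simp add: sc_commute sc_diff[symmetric] mult.assoc)
  finally show ?thesis .
qed

text \<open>By the resolvent identity, \<open>N (R z')\<close> is at most
  \<open>N (R z) + cmod (z' - z) * N (R z) * N (R z')\<close>. Near \<open>z\<close> the last term
  is absorbed on the left, so the norm at most doubles on a disc around \<open>z\<close>, and
  finitely many such discs cover \<open>K\<close>.\<close>

lemma resolvent_bounded_on_compact:
  assumes K: "compact K" and R: "\<And>z. z \<in> K \<Longrightarrow> resolvent_at x z (R z)"
  shows "\<exists>B\<ge>0. \<forall>z\<in>K. N (R z) \<le> B"
proof -
  have diff: "N (R z - R z') \<le> cmod (z' - z) * (N (R z) * N (R z'))" if "z \<in> K" "z' \<in> K" for z z'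
    using resolvent_identity[OF R R, of z z'] that N_mult[of "R z" "R z'"]
    by (simp add: N_sc mult_left_mono)
  have local: "N (R z') \<le> 2 * N (R z)"
    if "z \<in> K" "z' \<in> K" "cmod (z' - z) * (2 * (N (R z) + 1)) < 1" for z z'
  proof -
    let ?a = "N (R z)" and ?b = "N (R z')" and ?c = "cmod (z' - z)"
    have "?b \<le> ?a + N (R z' - R z)" using N_add[of "R z" "R z' - R z"] by simp
    also have "\<dots> \<le> ?a + ?c * (?a * ?b)" using diff[OF that(1,2)] by (simp add: N_diff_commute)
    finally have 1: "?b \<le> ?a + (?c * ?a) * ?b" by (simp add: mult.assoc)
    have "?c * ?a \<le> 1/2" using that(3) by (simp add: algebra_simps)
      (smt (verit) norm_ge_zero)
    then have "(?c * ?a) * ?b \<le> 1/2 * ?b" by (intro mult_right_mono) (auto simp: N_nonneg)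
    with 1 show ?thesis by linarith
  qed
  \<comment> \<open>This radius makes \<open>cmod (z' - z) * N (R z)\<close> at most 1/2; the
    \<open>+ 1\<close> keeps the denominator positive for every \<open>z\<close>.\<close>
  define r where "r z = 1 / (2 * (N (R z) + 1))" for z
  have r: "r z > 0" for z unfolding r_def by (smt (verit) N_nonneg divide_pos_pos)
  have "K \<subseteq> \<Union> ((\<lambda>z. ball z (r z)) ` K)" using r by force
  then obtain C where C: "C \<subseteq> K" "finite C" "K \<subseteq> (\<Union>z\<in>C. ball z (r z))"
    using compactE_image[OF K, of K "\<lambda>z. ball z (r z)"] by auto
  define B where "B = (\<Sum>z\<in>C. 2 * N (R z))"
  have "N (R z') \<le> B" if "z' \<in> K" for z'
  proof -
    obtain z where z: "z \<in> C" "z' \<in> ball z (r z)" using C(3) \<open>z' \<in> K\<close> by blast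
    have "cmod (z' - z) < r z" using z by (simp add: dist_norm norm_minus_commute)
    then have "cmod (z' - z) * (2 * (N (R z) + 1)) < 1"
      unfolding r_def using N_nonneg[of "R z"] by (simp add: field_simps)
    then have "N (R z') \<le> 2 * N (R z)" using local z C that by auto
    also have "\<dots> \<le> B" unfolding B_def
      by (rule member_le_sum) (use z C N_nonneg in auto)
    finally show ?thesis .
  qed
  moreover have "B \<ge> 0" unfolding B_def by (simp add: sum_nonneg N_nonneg)
  ultimately show ?thesis by blast
qed

end

section \<open>Averages over roots of unity and the growth of powers\<close>

lemma sum_unity_root_powers:
  assumes "0 < m" "m < n"
  shows "(\<Sum>k<n. (cis (2 * pi / real n) ^ k) ^ m) = 0"
proof -
  define w where "w = cis (2 * pi / real n) ^ m"
  have w: "w = cis (2 * pi * real m / real n)"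
    unfolding w_def by (simp add: Complex.DeMoivre mult.commute)
  have "w ^ n = cis (2 * pi * real m)"
    unfolding w by (simp only: Complex.DeMoivre) (use assms in simp)
  then have wn: "w ^ n = 1"
    using cis_multiple_2pi[of "real m"] by simp
  have "w \<noteq> 1"
  proof
    assume "w = 1"
    then have "cos (2 * pi * real m / real n) = 1" unfolding w
      by (metis Re_complex_of_real cis.sel(1) of_real_1)
    then obtain j :: int where "2 * pi * real m / real n = real_of_int j * 2 * pi"
      using cos_one_2pi_int by auto
    then have "real m = real_of_int j * real n" using assms by (simp add: field_simps)
    then have "int m = j * int n" by (metis of_int_eq_iff of_int_mult of_int_of_nat_eq)
    then show False using assms
      by (metis dvd_triv_right nat_dvd_not_less of_nat_dvd_iff)
  qed
  then have "(\<Sum>k<n. w ^ k) = 0"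
    using wn by (simp add: geometric_sum)
  then show ?thesis unfolding w_def by (simp add: power_mult[symmetric] mult.commute)
qed

context seminormed_complex_algebra
begin

text \<open>The average of \<open>w R(w)\<close> over \<open>w\<^sup>n = t\<^sup>n\<close> is the inverse of \<open>1 - (x/t)\<^sup>n\<close>.\<close>

lemma resolvent_average:
  fixes t :: real and n :: nat
  defines "w \<equiv> \<lambda>k. complex_of_real t * cis (2 * pi / real n) ^ k"
  assumes n: "0 < n" and R: "\<And>k. k < n \<Longrightarrow> resolvent_at x (w k) (R (w k))"
  shows "sc (1 / of_nat n) * (\<Sum>k<n. sc (w k) * R (w k)) * (sc (of_real t ^ n) - x ^ n)
    = sc (of_real t ^ n)"
proof -
  have wn: "w k ^ n = of_real t ^ n" for k
  proof -
    have "(cis (2 * pi / real n) ^ k) ^ n = (cis (2 * pi / real n) ^ n) ^ k"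
      by (simp add: power_mult[symmetric] mult.commute)
    also have "cis (2 * pi / real n) ^ n = 1"
      using n by (simp add: Complex.DeMoivre)
    finally show ?thesis unfolding w_def by (simp add: power_mult_distrib)
  qed
  \<comment> \<open>The usual factorisation of a difference of powers holds because scalars are
    central.\<close>
  have factor: "sc (w k ^ n) - x ^ n = (sc (w k) - x) * (\<Sum>j<n. sc (w k) ^ (n - Suc j) * x ^ j)" for k
    unfolding sc_power
  proof (induction n)
    case (Suc m)
    let ?a = "sc (w k)"
    have "?a ^ Suc m - x ^ Suc m = ?a * (?a ^ m - x ^ m) + (?a - x) * x ^ m"
      by (simp add: algebra_simps)
    also have "\<dots> = (?a - x) * (?a * (\<Sum>j<m. ?a ^ (m - Suc j) * x ^ j) + x ^ m)"
    proof -
      have "?a * (?a - x) = (?a - x) * ?a" by (rule sc_commute)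
      then show ?thesis unfolding Suc.IH by (simp only: distrib_left mult.assoc[symmetric])
    qed
    also have "?a * (\<Sum>j<m. ?a ^ (m - Suc j) * x ^ j) = (\<Sum>j<m. ?a ^ (Suc m - Suc j) * x ^ j)"
      unfolding sum_distrib_left
      by (intro sum.cong refl) (simp add: mult.assoc[symmetric] Suc_diff_Suc flip: power_Suc)
    finally show ?case by simp
  qed simp
  have "(sc (w k) * R (w k)) * (sc (of_real t ^ n) - x ^ n)
      = (\<Sum>j<n. sc (w k ^ (n - j)) * x ^ j)" if "k < n" for k
  proof -
    have "(sc (w k) * R (w k)) * (sc (of_real t ^ n) - x ^ n)
        = sc (w k) * ((R (w k) * (sc (w k) - x)) * (\<Sum>j<n. sc (w k) ^ (n - Suc j) * x ^ j))"
      using factor[of k] by (simp add: wn mult.assoc)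
    also have "\<dots> = (\<Sum>j<n. sc (w k) * (sc (w k) ^ (n - Suc j) * x ^ j))"
      using R[OF that] by (simp add: resolvent_at_def sum_distrib_left)
    also have "\<dots> = (\<Sum>j<n. sc (w k ^ (n - j)) * x ^ j)"
      by (intro sum.cong refl)
        (simp add: mult.assoc[symmetric] sc_power Suc_diff_Suc flip: power_Suc)
    finally show ?thesis .
  qed
  then have "(\<Sum>k<n. sc (w k) * R (w k)) * (sc (of_real t ^ n) - x ^ n)
      = (\<Sum>k<n. \<Sum>j<n. sc (w k ^ (n - j)) * x ^ j)"
    unfolding sum_distrib_right by (intro sum.cong refl) simp
  also have "\<dots> = (\<Sum>j<n. sc (\<Sum>k<n. w k ^ (n - j)) * x ^ j)"
    unfolding sc_sum sum_distrib_right by (rule sum.swap)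
  \<comment> \<open>The exponents \<open>n - j\<close> run from 1 to n, and among these only n is a
    multiple of n; the average kills all the others.\<close>
  also have "\<dots> = (\<Sum>j<n. if j = 0 then sc (of_nat n * of_real t ^ n) else 0)"
  proof (intro sum.cong refl)
    fix j assume j: "j \<in> {..<n}"
    show "sc (\<Sum>k<n. w k ^ (n - j)) * x ^ j = (if j = 0 then sc (of_nat n * of_real t ^ n) else 0)"
    proof (cases "j = 0")
      case True
      then show ?thesis by (simp add: wn)
    next
      case False
      then have "(\<Sum>k<n. w k ^ (n - j)) = of_real t ^ (n - j) * (\<Sum>k<n. (cis (2 * pi / real n) ^ k) ^ (n - j))"
        unfolding w_def by (simp add: power_mult_distrib sum_distrib_left)
      also have "\<dots> = 0" using False j by (subst sum_unity_root_powers) auto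
      finally show ?thesis using False by (simp add: sc_zero)
    qed
  qed
  also have "\<dots> = sc (of_nat n * of_real t ^ n)" using n by simp
  finally have "(\<Sum>k<n. sc (w k) * R (w k)) * (sc (of_real t ^ n) - x ^ n) = sc (of_nat n * of_real t ^ n)" .
  then have "sc (1 / of_nat n) * (\<Sum>k<n. sc (w k) * R (w k)) * (sc (of_real t ^ n) - x ^ n)
     = sc (1 / of_nat n) * sc (of_nat n * of_real t ^ n)"
    by (simp add: mult.assoc)
  also have "\<dots> = sc (of_real t ^ n)" using n by (simp flip: sc_mult)
  finally show ?thesis .
qed

text \<open>\<open>Q s\<close> is a left inverse of \<open>1 - (x/s)^n\<close>. The nodes
  \<open>w t k\<close> and \<open>w t' k\<close> have the same argument, so \<open>Q t\<close> and
  \<open>Q t'\<close> differ by at most 1/4 whatever \<open>n\<close> is, and this uniformity lets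
  the bound descend from \<open>t\<close> to \<open>t'\<close>. If \<open>(x/t)^n\<close> has norm
  at most 1/5, then \<open>Q t\<close> is within 1/4 of 1 and \<open>Q t'\<close> within 1/2, which
  bounds \<open>(x/t')^n\<close> by 3.\<close>

lemma power_bound_step:
  fixes t t' :: real
  assumes t: "0 < t'" "t' \<le> t" and n: "0 < n"
    and R: "\<And>z. t' \<le> cmod z \<Longrightarrow> cmod z \<le> t \<Longrightarrow> resolvent_at x z (R z)"
    and B: "\<And>z. t' \<le> cmod z \<Longrightarrow> cmod z \<le> t \<Longrightarrow> N (R z) \<le> B"
    and small: "(t - t') * (B + t * (B * B)) \<le> 1/4"
    and xt: "5 * N (x ^ n) \<le> t ^ n"
  shows "N (x ^ n) \<le> 3 * t' ^ n"
proof -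
  define w where "w = (\<lambda>(t::real) k. complex_of_real t * cis (2 * pi / real n) ^ k)"
  define Q where "Q s = sc (1 / of_nat n) * (\<Sum>k<n. sc (w s k) * R (w s k))" for s
  have cw: "cmod (w s k) = \<bar>s\<bar>" for s k
    unfolding w_def by (simp add: norm_mult norm_power)
  have inv: "Q s * (1 - sc (1 / of_real s ^ n) * x ^ n) = 1" if "t' \<le> s" "s \<le> t" for s
  proof -
    have s: "s > 0" using that t by simp
    have "Q s * (sc (of_real s ^ n) - x ^ n) = sc (of_real s ^ n)"
      unfolding Q_def w_def by (rule resolvent_average[OF n R]) (use cw[of s] that s in \<open>auto simp: w_def\<close>)
    then have "Q s * (sc (of_real s ^ n) - x ^ n) * sc (1 / of_real s ^ n) = sc (of_real s ^ n) * sc (1 / of_real s ^ n)"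
      by simp
    moreover have "sc (of_real s ^ n) * sc (1 / of_real s ^ n) = 1"
      using s by (simp add: sc_one flip: sc_mult)
    moreover have "(sc (of_real s ^ n) - x ^ n) * sc (1 / of_real s ^ n) = 1 - sc (1 / of_real s ^ n) * x ^ n"
      using calculation(2) by (simp add: left_diff_distrib sc_commute[of _ "x ^ n"])
    ultimately show ?thesis by (simp add: mult.assoc)
  qed
  have Bpos: "0 \<le> B" using B[of "of_real t"] N_nonneg[of "R (of_real t)"] t by simp
  have wd: "N (sc (w t k) * R (w t k) - sc (w t' k) * R (w t' k)) \<le> 1/4" for k
  proof -
    let ?z = "w t k" and ?z' = "w t' k"
    have cz: "cmod ?z = t" "cmod ?z' = t'" using cw t by auto
    have dz: "cmod (?z - ?z') = t - t'"
      unfolding w_def using t by (simp add: left_diff_distrib[symmetric] norm_mult norm_power flip: of_real_diff)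
    have RR: "resolvent_at x ?z (R ?z)" "resolvent_at x ?z' (R ?z')" "N (R ?z) \<le> B" "N (R ?z') \<le> B"
      using R B cz t by auto
    have "N (R ?z - R ?z') = cmod (?z' - ?z) * N (R ?z * R ?z')"
      using resolvent_identity[OF RR(1,2)] by (simp add: N_sc)
    also have "\<dots> \<le> (t - t') * (B * B)"
      using N_mult_le[OF RR(3,4)] dz t by (simp add: norm_minus_commute mult_left_mono)
    finally have d: "N (R ?z - R ?z') \<le> (t - t') * (B * B)" .
    have "sc ?z * R ?z - sc ?z' * R ?z' = sc (?z - ?z') * R ?z + sc ?z' * (R ?z - R ?z')"
      by (simp add: sc_diff algebra_simps)
    then have "N (sc ?z * R ?z - sc ?z' * R ?z') \<le> N (sc (?z - ?z') * R ?z) + N (sc ?z' * (R ?z - R ?z'))"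
      using N_add by metis
    also have "\<dots> \<le> (t - t') * B + t' * ((t - t') * (B * B))"
      unfolding N_sc dz cz by (intro add_mono mult_left_mono) (use RR d t in auto)
    also have "\<dots> \<le> (t - t') * B + t * ((t - t') * (B * B))"
      using t Bpos by (intro add_left_mono mult_right_mono) auto
    also have "\<dots> \<le> 1/4" using small by (simp add: algebra_simps)
    finally show ?thesis .
  qed
  have QQ: "N (Q t - Q t') \<le> 1/4"
  proof -
    have "Q t - Q t' = sc (1 / of_nat n) * (\<Sum>k<n. sc (w t k) * R (w t k) - sc (w t' k) * R (w t' k))"
      unfolding Q_def by (simp add: sum_subtractf right_diff_distrib)
    then have "N (Q t - Q t') = 1 / real n * N (\<Sum>k<n. sc (w t k) * R (w t k) - sc (w t' k) * R (w t' k))"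
      by (simp add: N_sc norm_divide)
    also have "\<dots> \<le> 1 / real n * (\<Sum>k<n. 1/4)"
      by (intro mult_left_mono order_trans[OF N_sum] sum_mono wd) auto
    also have "\<dots> = 1/4" using n by simp
    finally show ?thesis .
  qed
  define y where "y s = sc (1 / of_real s ^ n) * x ^ n" for s :: real
  have Ny: "N (y s) = N (x ^ n) / s ^ n" if "s > 0" for s
    unfolding y_def using that by (simp add: N_sc norm_divide norm_power)
  have yt: "N (y t) \<le> 1/5" using xt t by (simp add: Ny field_simps)
  have "Q t * (1 - y t) = 1" using inv[of t] t unfolding y_def by simp
  then have Qt: "Q t = 1 + Q t * y t" by (simp add: algebra_simps)
  have Qy: "N (Q t * y t) \<le> N (Q t) * (1/5)" by (rule N_mult_le) (use yt in auto)
  have "N (Q t) \<le> 1 + N (Q t * y t)" using N_add[of 1 "Q t * y t"] Qt N_one by metis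
  with Qy have "N (Q t) \<le> 5/4" by linarith
  moreover have "N (Q t - 1) = N (Q t * y t)" using Qt by (metis add_diff_cancel_left')
  ultimately have "N (Q t - 1) \<le> 1/4" using Qy by linarith
  moreover have "N (Q t' - 1) \<le> N (Q t' - Q t) + N (Q t - 1)"
    using N_add[of "Q t' - Q t" "Q t - 1"] by simp
  ultimately have Q': "N (Q t' - 1) \<le> 1/2" using QQ by (simp add: N_diff_commute)
  have "Q t' * (1 - y t') = 1" using inv[of t'] t unfolding y_def by simp
  \<comment> \<open>The unknown norm of \<open>1 - y t'\<close> returns on the right with factor 1/2
    and is absorbed.\<close>
  then have "1 - y t' = 1 - (Q t' - 1) * (1 - y t')" by (simp add: left_diff_distrib)
  then have "N (1 - y t') \<le> 1 + N ((Q t' - 1) * (1 - y t'))" using N_diff N_one by metis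
  also have "\<dots> \<le> 1 + 1/2 * N (1 - y t')" using N_mult_le[OF Q' order_refl] by simp
  finally have "N (1 - y t') \<le> 2" by simp
  moreover have "N (y t') \<le> N 1 + N (1 - y t')" using N_diff[of 1 "1 - y t'"] by simp
  ultimately have "N (y t') \<le> 3" by (simp add: N_one)
  then show ?thesis using t by (simp add: Ny field_simps)
qed

text \<open>At the radius \<open>M\<close>, which exceeds \<open>N x\<close>, the estimate is
  trivial for large \<open>n\<close>. The radius is then lowered to \<open>s\<close> in finitely
  many steps whose length is fixed by one resolvent bound on the whole annulus. Each step gives the
  constant 3 at a radius \<open>t'\<close>; enlarging the radius by \<open>\<delta>/2\<close> turns
  this, for large \<open>n\<close>, into the factor 1/5 that the next step requires.\<close>

theorem power_bound_of_resolvent: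
  assumes s: "0 < s" and inv: "\<And>z. s \<le> cmod z \<Longrightarrow> \<exists>y. resolvent_at x z y"
  shows "\<exists>C\<ge>1. \<forall>n. N (x ^ n) \<le> C * s ^ n"
proof -
  define M where "M = max s (N x) + 1"
  obtain R where R: "\<And>z. s \<le> cmod z \<Longrightarrow> resolvent_at x z (R z)" using inv by metis
  have "compact {z. s \<le> cmod z \<and> cmod z \<le> M}"
  proof -
    have "{z. s \<le> cmod z \<and> cmod z \<le> M} = cball 0 M - ball 0 s" by auto
    then show ?thesis by (simp add: compact_diff)
  qed
  from resolvent_bounded_on_compact[OF this, of x R] R
  obtain B where B: "B \<ge> 0" "\<And>z. s \<le> cmod z \<Longrightarrow> cmod z \<le> M \<Longrightarrow> N (R z) \<le> B" by auto
  have M: "M > s" "M > N x" "M > 0" "M \<ge> s + 1" unfolding M_def using s by auto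
  define L where "L = B + M * (B * B)"
  have L: "L \<ge> 0" unfolding L_def using B M by simp
  define \<delta> where "\<delta> = 1 / (4 * (L + 1))"
  have \<delta>: "\<delta> > 0" "\<delta> \<le> 1" "\<delta> * L \<le> 1/4"
    unfolding \<delta>_def using L by (auto simp: field_simps)
  have step: "N (x ^ n) \<le> 3 * t' ^ n"
    if t: "s \<le> t'" "t' \<le> t" "t \<le> M" "t - t' \<le> \<delta>" and n: "0 < n" "5 * N (x ^ n) \<le> t ^ n" for t t' n
  proof (rule power_bound_step[where t = t and R = R and B = B])
    have "(t - t') * (B + t * (B * B)) \<le> \<delta> * L"
      unfolding L_def using t B \<delta> s by (intro mult_mono add_left_mono mult_right_mono) auto
    then show "(t - t') * (B + t * (B * B)) \<le> 1/4" using \<delta> by simp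
  qed (use t n s R B in auto)
  have decay: "\<forall>\<^sub>F n in sequentially. 5 * (K * a ^ n) \<le> b ^ n" if "0 \<le> a" "a < b" "K \<ge> 0" for a b K :: real
  proof -
    have "(\<lambda>n. 5 * K * (a / b) ^ n) \<longlonglongrightarrow> 5 * K * 0"
      by (intro tendsto_mult_left LIMSEQ_realpow_zero) (use that in auto)
    then have "\<forall>\<^sub>F n in sequentially. 5 * K * (a / b) ^ n < 1"
      by (rule order_tendstoD) simp
    then show ?thesis
      by eventually_elim (use that in \<open>auto simp: power_divide field_simps\<close>)
  qed
  \<comment> \<open>The floor \<open>s + \<delta>/2\<close> leaves room to subtract
    \<open>\<delta>/2\<close> without leaving the annulus, on which alone resolvents are
    available.\<close>
  define T where "T k = max (s + \<delta>/2) (M - real k * (\<delta>/2))" for k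
  have TM: "T k \<le> M" "T k \<ge> s + \<delta>/2" for k unfolding T_def using M \<delta> by auto
  have ev: "\<forall>\<^sub>F n in sequentially. 5 * N (x ^ n) \<le> T k ^ n" for k
  proof (induction k)
    case 0
    have "T 0 = M" unfolding T_def using M \<delta> by auto
    moreover have "\<forall>\<^sub>F n in sequentially. 5 * (1 * N x ^ n) \<le> M ^ n"
      by (rule decay) (use M N_nonneg in auto)
    then have "\<forall>\<^sub>F n in sequentially. 5 * N (x ^ n) \<le> M ^ n"
      by eventually_elim (use N_power[of x] in \<open>smt (verit)\<close>)
    ultimately show ?case by simp
  next
    case (Suc k)
    define t' where "t' = T (Suc k) - \<delta>/2"
    have t': "s \<le> t'" "t' \<le> T k" "T k - t' \<le> \<delta>"
    proof -
      have "real (Suc k) * (\<delta>/2) = real k * (\<delta>/2) + \<delta>/2" by (simp add: field_simps)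
      then have "T (Suc k) \<le> T k" "T k \<le> T (Suc k) + \<delta>/2" unfolding T_def using \<delta> by linarith+
      then show "s \<le> t'" "t' \<le> T k" "T k - t' \<le> \<delta>" unfolding t'_def using TM(2)[of "Suc k"] \<delta> by linarith+
    qed
    have "\<forall>\<^sub>F n in sequentially. 5 * (3 * t' ^ n) \<le> T (Suc k) ^ n"
      by (rule decay) (use t' s \<delta> in \<open>auto simp: t'_def\<close>)
    with Suc eventually_gt_at_top[of 0] show ?case
    proof eventually_elim
      case (elim n)
      then have "N (x ^ n) \<le> 3 * t' ^ n" by (intro step[OF t'(1,2) TM(1) t'(3)])
      with elim show ?case by linarith
    qed
  qed
  obtain k :: nat where "real k > M / (\<delta>/2)" using reals_Archimedean2 by blast
  then have "M - real k * (\<delta>/2) < 0" using \<delta> by (simp add: field_simps)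
  then have "T k = s + \<delta>/2" unfolding T_def using s \<delta> by simp
  then have "\<forall>\<^sub>F n in sequentially. 5 * N (x ^ n) \<le> (s + \<delta>/2) ^ n" using ev[of k] by simp
  then obtain n0 where n0: "\<And>n. n \<ge> n0 \<Longrightarrow> 5 * N (x ^ n) \<le> (s + \<delta>/2) ^ n"
    by (auto simp: eventually_sequentially)
  have large: "N (x ^ n) \<le> 3 * s ^ n" if "n \<ge> n0" "n > 0" for n
    by (rule step[of s "s + \<delta>/2"]) (use that n0 M \<delta> in auto)
  define C where "C = 3 + (\<Sum>n\<le>n0. N (x ^ n) / s ^ n)"
  have "N (x ^ n) \<le> C * s ^ n" for n
  proof (cases "n \<le> n0")
    case True
    have "N (x ^ n) / s ^ n \<le> (\<Sum>n\<le>n0. N (x ^ n) / s ^ n)"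
      by (rule member_le_sum) (use True s N_nonneg in auto)
    then have "N (x ^ n) / s ^ n \<le> C" unfolding C_def by simp
    then show ?thesis using s by (simp add: field_simps)
  next
    case False
    then have "N (x ^ n) \<le> 3 * s ^ n" by (intro large) auto
    also have "3 \<le> C" unfolding C_def using s by (simp add: sum_nonneg N_nonneg)
    then have "3 * s ^ n \<le> C * s ^ n" using s by (intro mult_right_mono) auto
    finally show ?thesis .
  qed
  moreover have "C \<ge> 1" unfolding C_def using s by (simp add: sum_nonneg N_nonneg add_increasing2)
  ultimately show ?thesis by blast
qed

section \<open>Spectral values, perturbed powers and Neumann sums\<close>

lemma left_inverse_power: "y * x = 1 \<Longrightarrow> y ^ n * x ^ n = (1::'a)"
proof (induction n)
  case (Suc n)
  have "y ^ Suc n * x ^ Suc n = y ^ n * (y * x) * x ^ n"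
    by (simp only: power_Suc2[of y] power_Suc[of x] mult.assoc)
  then show ?case using Suc by simp
qed simp

text \<open>With resolvents everywhere, the powers of \<open>x\<close> would be bounded by
  \<open>C * s ^ n\<close> for every positive \<open>s\<close>. Taking \<open>s\<close> so small
  that \<open>N y * s\<close> is at most 1/2, where \<open>- y\<close> is a left inverse of
  \<open>x\<close>, makes the norm of \<open>1 = (- y) ^ n * x ^ n\<close> tend to 0. This takes the
  place of Liouville's theorem.\<close>

theorem exists_spectral_value: "\<exists>z. \<not> (\<exists>y. resolvent_at x z y)"
proof (rule ccontr)
  assume "\<not> ?thesis"
  then have all: "\<exists>y. resolvent_at x z y" for z by blast
  obtain y where "y * (sc 0 - x) = 1" using all[of 0] unfolding resolvent_at_def by auto
  then have y: "(- y) * x = 1" by (simp add: sc_zero)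
  define s where "s = 1 / (2 * (N y + 1))"
  have s: "s > 0" unfolding s_def by (smt (verit) N_nonneg divide_pos_pos)
  obtain C where C: "C \<ge> 1" "\<And>n. N (x ^ n) \<le> C * s ^ n" using power_bound_of_resolvent[OF s all] by blast
  have "1 \<le> C * (1/2) ^ n" for n
  proof -
    have "1 = N ((- y) ^ n * x ^ n)" using left_inverse_power[OF y] by (simp add: N_one)
    also have "\<dots> \<le> N y ^ n * (C * s ^ n)"
      by (rule N_mult_le) (use N_power[of "- y"] C in \<open>auto simp: N_minus\<close>)
    also have "\<dots> = C * (N y * s) ^ n" by (simp add: power_mult_distrib)
    also have "\<dots> \<le> C * (1/2) ^ n"
      unfolding s_def using C N_nonneg[of y] by (intro mult_left_mono power_mono) (auto simp: field_simps)
    finally show ?thesis .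
  qed
  moreover have "(\<lambda>n. C * (1/2) ^ n) \<longlonglongrightarrow> C * 0"
    by (intro tendsto_mult_left LIMSEQ_realpow_zero) auto
  ultimately have "1 \<le> C * 0" by (intro LIMSEQ_le_const[of _ _ 1]) auto
  then show False by simp
qed

text \<open>The leading power \<open>x ^ m\<close> is part of the induction: a further factor
  \<open>x\<close> lengthens it and costs \<open>s\<close> without a new constant, and only a factor
  \<open>g\<close> ends the run, at the price \<open>C * \<epsilon>\<close>.\<close>

lemma perturbed_power_bound:
  assumes x: "\<And>n. N (x ^ n) \<le> C * s ^ n" and g: "N g \<le> \<epsilon>"
  shows "N (x ^ m * (x - g) ^ n) \<le> C * s ^ m * (s + C * \<epsilon>) ^ n"
proof (induction n arbitrary: m)
  case (Suc n)
  have "x ^ m * (x - g) ^ Suc n = x ^ Suc m * (x - g) ^ n - x ^ m * (g * (x ^ 0 * (x - g) ^ n))"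
    by (simp only: power_Suc2[of x] power_Suc[of "x - g"] power_0 mult_1_left left_diff_distrib
        right_diff_distrib mult.assoc)
  then have "N (x ^ m * (x - g) ^ Suc n)
      \<le> N (x ^ Suc m * (x - g) ^ n) + N (x ^ m * (g * (x ^ 0 * (x - g) ^ n)))"
    using N_diff by metis
  also have "\<dots> \<le> C * s ^ Suc m * (s + C * \<epsilon>) ^ n + (C * s ^ m) * (\<epsilon> * (C * s ^ 0 * (s + C * \<epsilon>) ^ n))"
    by (intro add_mono Suc.IH N_mult_le x g)
  also have "\<dots> = C * s ^ m * (s + C * \<epsilon>) ^ Suc n" by (simp add: algebra_simps)
  finally show ?case .
qed (use x in auto)

text \<open>The remainder is kept explicitly, so these identities involve no limit in the
  algebra.\<close>

lemma neumann_partial_sum: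
  assumes "z \<noteq> 0"
  shows "(sc z - x) * (\<Sum>n<k. sc (1 / z ^ Suc n) * x ^ n) = 1 - sc (1 / z ^ k) * x ^ k"
    and "(\<Sum>n<k. sc (1 / z ^ Suc n) * x ^ n) * (sc z - x) = 1 - sc (1 / z ^ k) * x ^ k"
proof -
  show 1: "(sc z - x) * (\<Sum>n<k. sc (1 / z ^ Suc n) * x ^ n) = 1 - sc (1 / z ^ k) * x ^ k" for k
  proof (induction k)
    case (Suc k)
    have "sc z * (sc (1 / z ^ Suc k) * x ^ k) = sc (1 / z ^ k) * x ^ k"
      using assms by (simp add: mult.assoc[symmetric] flip: sc_mult)
    moreover have "x * (sc (1 / z ^ Suc k) * x ^ k) = sc (1 / z ^ Suc k) * x ^ Suc k"
      by (metis mult.assoc power_Suc sc_commute)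
    ultimately have "(sc z - x) * (sc (1 / z ^ Suc k) * x ^ k) = sc (1 / z ^ k) * x ^ k - sc (1 / z ^ Suc k) * x ^ Suc k"
      by (simp only: left_diff_distrib)
    with Suc show ?case by (simp add: distrib_left)
  qed (simp add: sc_one)
  have "(sc (1 / z ^ Suc n) * x ^ n) * (sc z - x) = (sc z - x) * (sc (1 / z ^ Suc n) * x ^ n)" for n
  proof -
    have "x ^ n * (sc z - x) = (sc z - x) * x ^ n"
      by (simp add: left_diff_distrib right_diff_distrib power_commutes sc_commute[of z "x ^ n"])
    then show ?thesis by (metis mult.assoc sc_commute)
  qed
  then show "(\<Sum>n<k. sc (1 / z ^ Suc n) * x ^ n) * (sc z - x) = 1 - sc (1 / z ^ k) * x ^ k"
    using 1[of k] by (simp only: sum_distrib_left sum_distrib_right)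
qed

end

section \<open>Square integrable functions and time-frequency series\<close>

text \<open>\<open>lebesgue\<close> is the completion of \<open>lborel\<close>, so invariance of
  \<open>lborel\<close> carries over. It also yields measurability with respect to the completed
  sets, since preimages of null sets are null.\<close>

lemma distr_lebesgue_translate:
  fixes t :: "'a::euclidean_space"
  shows "distr lebesgue lebesgue (\<lambda>x. x - t) = lebesgue"
    and measurable_lebesgue_translate: "(\<lambda>x. x - t) \<in> lebesgue \<rightarrow>\<^sub>M lebesgue"
proof -
  have eq: "(\<lambda>x. x - t) = (+) (- t)" by auto
  have m: "(\<lambda>x. x - t) \<in> lebesgue \<rightarrow>\<^sub>M lborel" by (intro measurable_completion) simp
  have d: "distr lebesgue lborel (\<lambda>x. x - t) = lborel"
    using lborel_distr_plus[of "- t"] unfolding eq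
    by (subst distr_completion) (auto cong: distr_cong)
  show "distr lebesgue lebesgue (\<lambda>x. x - t) = lebesgue"
    using completion.completion_distr_eq[OF m] unfolding d by simp
  show "(\<lambda>x. x - t) \<in> lebesgue \<rightarrow>\<^sub>M lebesgue"
    by (rule completion.measurable_completion2[OF m]) (simp add: d)
qed

lemma borel_measurable_lebesgue_translate:
  fixes t :: "'a::euclidean_space"
  assumes "f \<in> borel_measurable lebesgue"
  shows "(\<lambda>x. f (x - t)) \<in> borel_measurable lebesgue"
  using measurable_compose[OF measurable_lebesgue_translate assms] .

lemma AE_lebesgue_translate:
  fixes t :: "'a::euclidean_space"
  assumes "AE x in lebesgue. P x"
  shows "AE x in lebesgue. P (x - t)"
proof -
  have "AE x in distr lebesgue lebesgue (\<lambda>x. x - t). P x"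
    unfolding distr_lebesgue_translate(1) by (rule assms)
  then show ?thesis by (rule AE_distrD[OF measurable_lebesgue_translate])
qed

lemma nn_integral_lebesgue_translate:
  fixes t :: "'a::euclidean_space"
  assumes "f \<in> borel_measurable lebesgue"
  shows "(\<integral>\<^sup>+x. f (x - t) \<partial>lebesgue) = (\<integral>\<^sup>+x. f x \<partial>lebesgue)"
  using nn_integral_distr[OF measurable_lebesgue_translate[of t], of f] assms
  unfolding distr_lebesgue_translate(1) by simp

section \<open>The L2 seminorm\<close>

definition l2energy :: "'d::finite fn \<Rightarrow> ennreal" where
  "l2energy f = (\<integral>\<^sup>+x. ennreal ((cmod (f x))\<^sup>2) \<partial>lebesgue)"

lemma L2_iff: "f \<in> L2 \<longleftrightarrow> f \<in> borel_measurable lebesgue \<and> l2energy f < \<infinity>"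
  unfolding L2_def l2energy_def by (auto simp: integrable_iff_bounded)

lemma L2_measurable: "f \<in> L2 \<Longrightarrow> f \<in> borel_measurable lebesgue"
  by (simp add: L2_iff)

lemma l2norm_nonneg: "0 \<le> l2norm f"
  unfolding l2norm_def by simp

lemma l2energy_eq: "f \<in> L2 \<Longrightarrow> l2energy f = ennreal ((l2norm f)\<^sup>2)"
  unfolding L2_def l2energy_def l2norm_def
  by (auto simp: nn_integral_eq_integral)

lemma l2normI:
  assumes "f \<in> borel_measurable lebesgue" "l2energy f \<le> ennreal (b\<^sup>2)" "0 \<le> b"
  shows "f \<in> L2" "l2norm f \<le> b"
proof -
  show f: "f \<in> L2" using assms by (auto simp: L2_iff order_le_less_trans[OF _ ennreal_less_top])
  have "(l2norm f)\<^sup>2 \<le> b\<^sup>2" using assms(2) l2energy_eq[OF f] by simp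
  then show "l2norm f \<le> b" using assms(3) power2_le_imp_le by blast
qed

lemma borel_measurable_AE_cong_lebesgue:
  fixes f g :: "'a::euclidean_space \<Rightarrow> 'b::topological_space"
  assumes "f \<in> borel_measurable lebesgue" "AE x in lebesgue. f x = g x"
  shows "g \<in> borel_measurable lebesgue"
proof (rule measurableI)
  fix A :: "'b set" assume A: "A \<in> sets borel"
  have "f -` A \<inter> space lebesgue \<in> sets lebesgue" using assms(1) A by (rule measurable_sets)
  moreover have "AE x in lebesgue. x \<in> f -` A \<inter> space lebesgue \<longleftrightarrow> x \<in> g -` A \<inter> space lebesgue"
    using assms(2) by eventually_elim auto
  ultimately show "g -` A \<inter> space lebesgue \<in> sets lebesgue"
    using completion.in_sets_AE by blast
qed auto

lemma l2eq_refl [simp]: "l2eq f f"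
  by (simp add: l2eq_def)

lemma l2eq_sym: "l2eq f g \<Longrightarrow> l2eq g f"
  unfolding l2eq_def by (auto elim: eventually_mono)

lemma l2eq_trans [trans]: "l2eq f g \<Longrightarrow> l2eq g h \<Longrightarrow> l2eq f h"
  unfolding l2eq_def by (erule AE_mp, erule AE_mp) auto

lemma l2energy_cong: "l2eq f g \<Longrightarrow> l2energy f = l2energy g"
  unfolding l2eq_def l2energy_def by (intro nn_integral_cong_AE) (auto elim: eventually_mono)

lemma L2_cong: "l2eq f g \<Longrightarrow> f \<in> L2 \<Longrightarrow> g \<in> L2"
  using l2energy_cong[of f g] borel_measurable_AE_cong_lebesgue[of f g]
  by (auto simp: L2_iff l2eq_def)

lemma l2norm_cong: "l2eq f g \<Longrightarrow> f \<in> L2 \<Longrightarrow> l2norm f = l2norm g"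
  using l2energy_cong[of f g] l2energy_eq[of f] l2energy_eq[of g] L2_cong[of f g] l2norm_nonneg
  by (metis ennreal_inj power2_eq_iff_nonneg zero_le_power2)

lemma l2eq_lincomb: "l2eq f f' \<Longrightarrow> l2eq g g' \<Longrightarrow> l2eq (\<lambda>x. a * f x + b * g x) (\<lambda>x. a * f' x + b * g' x)"
  unfolding l2eq_def by (erule AE_mp, erule AE_mp) auto

lemma l2eq_add: "l2eq f f' \<Longrightarrow> l2eq g g' \<Longrightarrow> l2eq (\<lambda>x. f x + g x) (\<lambda>x. f' x + g' x)"
  using l2eq_lincomb[of f f' g g' 1 1] by simp

lemma l2eq_diff: "l2eq f f' \<Longrightarrow> l2eq g g' \<Longrightarrow> l2eq (\<lambda>x. f x - g x) (\<lambda>x. f' x - g' x)"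
  using l2eq_lincomb[of f f' g g' 1 "- 1"] by simp

lemma l2eq_scale: "l2eq f f' \<Longrightarrow> l2eq (\<lambda>x. a * f x) (\<lambda>x. a * f' x)"
  using l2eq_lincomb[of f f' f f' a 0] by simp

lemma l2energy_scale: "f \<in> borel_measurable lebesgue \<Longrightarrow> l2energy (\<lambda>x. a * f x) = ennreal ((cmod a)\<^sup>2) * l2energy f"
  unfolding l2energy_def
  by (subst nn_integral_cmult[symmetric]) (auto simp: norm_mult power_mult_distrib ennreal_mult)

lemma L2_scale: "f \<in> L2 \<Longrightarrow> (\<lambda>x. a * f x) \<in> L2"
  by (auto simp: L2_iff l2energy_scale ennreal_mult_less_top)

lemma l2norm_scale:
  assumes "f \<in> L2" shows "l2norm (\<lambda>x. a * f x) = cmod a * l2norm f"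
proof -
  have "ennreal ((l2norm (\<lambda>x. a * f x))\<^sup>2) = ennreal ((cmod a * l2norm f)\<^sup>2)"
    using l2energy_eq[OF L2_scale[OF assms, of a]] l2energy_scale[OF L2_measurable[OF assms], of a] l2energy_eq[OF assms]
    by (simp add: power_mult_distrib ennreal_mult)
  then show ?thesis using l2norm_nonneg
    by (metis ennreal_inj mult_nonneg_nonneg norm_ge_zero power2_eq_iff_nonneg zero_le_power2)
qed

text \<open>After discarding the triangle inequality, the gap is the square of
  \<open>q * cmod u - p * cmod w\<close> divided by \<open>p * q\<close>. Integrated with
  \<open>p\<close> and \<open>q\<close> close to the two L2 norms, this is Minkowski's
  inequality.\<close>

lemma norm_add_power2_le:
  fixes u w :: complex and p q :: real
  assumes "0 < p" "0 < q"
  shows "(cmod (u + w))\<^sup>2 \<le> (p + q) / p * (cmod u)\<^sup>2 + (p + q) / q * (cmod w)\<^sup>2"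
proof -
  have "(cmod (u + w))\<^sup>2 \<le> (cmod u + cmod w)\<^sup>2"
    by (intro power_mono norm_triangle_ineq) auto
  also have "\<dots> \<le> (p + q) / p * (cmod u)\<^sup>2 + (p + q) / q * (cmod w)\<^sup>2"
  proof -
    have "0 \<le> (q * cmod u - p * cmod w)\<^sup>2 / (p * q)" using assms by simp
    also have "\<dots> = (p + q) / p * (cmod u)\<^sup>2 + (p + q) / q * (cmod w)\<^sup>2 - (cmod u + cmod w)\<^sup>2"
      using assms by (simp add: field_simps power2_eq_square)
    finally show ?thesis by simp
  qed
  finally show ?thesis .
qed

lemma L2_add:
  assumes f: "f \<in> L2" and g: "g \<in> L2"
  shows "(\<lambda>x. f x + g x) \<in> L2" and l2norm_triangle: "l2norm (\<lambda>x. f x + g x) \<le> l2norm f + l2norm g"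
proof -
  have m: "f \<in> borel_measurable lebesgue" "g \<in> borel_measurable lebesgue" using f g by (auto simp: L2_iff)
  \<comment> \<open>The slack \<open>e\<close> keeps both weights positive when a norm
    vanishes.\<close>
  have *: "(\<lambda>x. f x + g x) \<in> L2 \<and> l2norm (\<lambda>x. f x + g x) \<le> (l2norm f + e) + (l2norm g + e)" if "e > 0" for e
  proof -
    define p q where "p = l2norm f + e" and "q = l2norm g + e"
    have pq: "p > 0" "q > 0" "l2norm f \<le> p" "l2norm g \<le> q"
      using that l2norm_nonneg[of f] l2norm_nonneg[of g] by (auto simp: p_def q_def)
    have "l2energy (\<lambda>x. f x + g x) \<le> (\<integral>\<^sup>+x. ennreal ((p + q) / p) * ennreal ((cmod (f x))\<^sup>2)
        + ennreal ((p + q) / q) * ennreal ((cmod (g x))\<^sup>2) \<partial>lebesgue)"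
      unfolding l2energy_def using norm_add_power2_le[OF pq(1,2)] pq
      by (intro nn_integral_mono) (simp flip: ennreal_mult ennreal_plus)
    also have "\<dots> = ennreal ((p + q) / p) * l2energy f + ennreal ((p + q) / q) * l2energy g"
      unfolding l2energy_def using m by (simp add: nn_integral_add nn_integral_cmult)
    also have "\<dots> = ennreal ((p + q) / p * (l2norm f)\<^sup>2 + (p + q) / q * (l2norm g)\<^sup>2)"
      using pq by (simp add: l2energy_eq f g flip: ennreal_mult ennreal_plus)
    also have "\<dots> \<le> ennreal ((p + q) / p * p\<^sup>2 + (p + q) / q * q\<^sup>2)"
      using pq l2norm_nonneg by (intro ennreal_leI add_mono mult_left_mono power_mono) auto
    also have "(p + q) / p * p\<^sup>2 + (p + q) / q * q\<^sup>2 = (p + q)\<^sup>2"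
      using pq by (simp add: field_simps power2_eq_square)
    finally have "l2energy (\<lambda>x. f x + g x) \<le> ennreal ((p + q)\<^sup>2)" .
    then show ?thesis using m pq l2normI[of "\<lambda>x. f x + g x" "p + q"] by (auto simp: p_def q_def)
  qed
  show "(\<lambda>x. f x + g x) \<in> L2" using *[of 1] by simp
  show "l2norm (\<lambda>x. f x + g x) \<le> l2norm f + l2norm g"
  proof (rule field_le_epsilon)
    fix e :: real assume "e > 0"
    then show "l2norm (\<lambda>x. f x + g x) \<le> l2norm f + l2norm g + e" using *[of "e/2"] by simp
  qed
qed

lemma L2_lincomb: "f \<in> L2 \<Longrightarrow> g \<in> L2 \<Longrightarrow> (\<lambda>x. a * f x + b * g x) \<in> L2"
  by (intro L2_add L2_scale)

lemma L2_zero: "(\<lambda>x. 0) \<in> L2"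
  by (simp add: L2_iff l2energy_def)

lemma l2norm_zero: "l2norm (\<lambda>x. 0) = 0"
  by (simp add: l2norm_def)

lemma l2norm_eq_0_imp:
  assumes "f \<in> L2" "l2norm f = 0" shows "l2eq f (\<lambda>x. 0)"
proof -
  have "l2energy f = 0" using l2energy_eq[OF assms(1)] assms(2) by simp
  then have "AE x in lebesgue. ennreal ((cmod (f x))\<^sup>2) = 0"
    unfolding l2energy_def using assms(1) by (subst (asm) nn_integral_0_iff_AE) (auto simp: L2_iff)
  then show ?thesis unfolding l2eq_def by eventually_elim auto
qed

lemma exists_l2norm_1: "\<exists>f\<in>L2. l2norm (f :: 'd::finite fn) = 1"
proof -
  define f :: "'d fn" where "f = indicator (cbox 0 One)"
  have "l2energy f = (\<integral>\<^sup>+x. indicator (cbox 0 One :: (real^'d) set) x \<partial>lebesgue)"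
    unfolding l2energy_def by (intro nn_integral_cong) (auto simp: f_def indicator_def)
  also have "\<dots> = emeasure lebesgue (cbox 0 One :: (real^'d) set)"
    by (intro nn_integral_indicator) auto
  also have "\<dots> = 1" by (simp add: emeasure_lborel_cbox_eq inner_sum_left sum.delta inner_Basis)
  finally have E: "l2energy f = 1" .
  have "f \<in> borel_measurable lebesgue" unfolding f_def by (intro borel_measurable_indicator) simp
  then have f: "f \<in> L2" unfolding L2_iff E by simp
  then have "ennreal ((l2norm f)\<^sup>2) = 1" using l2energy_eq E by metis
  then have "(l2norm f)\<^sup>2 = 1" by (simp add: ennreal_eq_1)
  then have "l2norm f = 1" using l2norm_nonneg[of f] by (simp add: power2_eq_1_iff)
  then show ?thesis using f by blast
qed

section \<open>Absolutely summable series of translates\<close>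

lemma nn_integral_count_space_infsum:
  fixes g :: "'i \<Rightarrow> real"
  assumes "g summable_on A" "\<And>i. i \<in> A \<Longrightarrow> 0 \<le> g i"
  shows "(\<integral>\<^sup>+i. ennreal (g i) \<partial>count_space A) = ennreal (infsum g A)"
proof -
  have "(\<lambda>i. norm (g i)) summable_on A" using assms by (subst summable_on_cong[of _ _ g]) auto
  then have "Infinite_Set_Sum.abs_summable_on g A" by (simp only: abs_summable_equivalent)
  then show ?thesis using nn_integral_conv_infsetsum[of g A] assms(2) infsetsum_infsum by metis
qed

lemma nn_integral_count_space_finite_imp_summable:
  fixes g :: "'i \<Rightarrow> real"
  assumes "(\<integral>\<^sup>+i. ennreal (g i) \<partial>count_space A) < \<infinity>" "\<And>i. i \<in> A \<Longrightarrow> 0 \<le> g i"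
  shows "g summable_on A"
proof -
  have "integrable (count_space A) g"
    using assms by (intro integrableI_nonneg) (auto simp: AE_count_space)
  then have "(\<lambda>i. norm (g i)) summable_on A"
    by (simp only: abs_summable_equivalent abs_summable_on_def)
  then show ?thesis using assms by (subst summable_on_cong[of _ _ "\<lambda>i. norm (g i)"]) auto
qed

text \<open>Cauchy-Schwarz with \<open>a\<close> split into two square roots. It bounds the square
  of a pointwise series by a series of squares, which can be integrated term by term.\<close>

lemma infsum_cauchy_schwarz:
  fixes a u :: "'i \<Rightarrow> real"
  assumes a: "a summable_on A" "\<And>i. i \<in> A \<Longrightarrow> 0 \<le> a i"
    and au: "(\<lambda>i. a i * (u i)\<^sup>2) summable_on A" and u: "\<And>i. i \<in> A \<Longrightarrow> 0 \<le> u i"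
  shows "(\<lambda>i. a i * u i) summable_on A"
    and "(\<Sum>\<^sub>\<infinity>i\<in>A. a i * u i)\<^sup>2 \<le> infsum a A * (\<Sum>\<^sub>\<infinity>i\<in>A. a i * (u i)\<^sup>2)"
proof -
  let ?P = "infsum a A" and ?Q = "\<Sum>\<^sub>\<infinity>i\<in>A. a i * (u i)\<^sup>2"
  have fin: "(\<Sum>i\<in>F. a i * u i) \<le> sqrt (?P * ?Q)" if F: "finite F" "F \<subseteq> A" for F
  proof -
    have "(\<Sum>i\<in>F. a i * u i)\<^sup>2 = (\<Sum>i\<in>F. sqrt (a i) * (sqrt (a i) * u i))\<^sup>2"
      using a(2) F by (intro arg_cong[of _ _ "\<lambda>x. x\<^sup>2"] sum.cong) (auto simp: mult.assoc[symmetric] subset_eq)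
    also have "\<dots> \<le> (\<Sum>i\<in>F. (sqrt (a i))\<^sup>2) * (\<Sum>i\<in>F. (sqrt (a i) * u i)\<^sup>2)"
      by (rule Cauchy_Schwarz_ineq_sum)
    also have "\<dots> = (\<Sum>i\<in>F. a i) * (\<Sum>i\<in>F. a i * (u i)\<^sup>2)"
      using a(2) F by (intro arg_cong2[of _ _ _ _ "(*)"] sum.cong) (auto simp: power_mult_distrib subset_eq)
    also have "\<dots> \<le> ?P * ?Q"
      using a au F by (intro mult_mono finite_sum_le_infsum infsum_nonneg sum_nonneg) (auto simp: subset_eq)
    finally show ?thesis by (rule real_le_rsqrt)
  qed
  show s: "(\<lambda>i. a i * u i) summable_on A"
    by (rule nonneg_bounded_partial_sums_imp_summable_on[of _ _ "sqrt (?P * ?Q)"])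
      (use a u fin in \<open>auto intro!: eventually_finite_subsets_at_top_weakI\<close>)
  have "(\<Sum>\<^sub>\<infinity>i\<in>A. a i * u i) \<le> sqrt (?P * ?Q)"
    using s fin by (rule infsum_le_finite_sums)
  then have "(\<Sum>\<^sub>\<infinity>i\<in>A. a i * u i)\<^sup>2 \<le> (sqrt (?P * ?Q))\<^sup>2"
    using a u by (intro power_mono infsum_nonneg) auto
  also have "\<dots> = ?P * ?Q"
    using a by (intro real_sqrt_pow2 mult_nonneg_nonneg infsum_nonneg) auto
  finally show "(\<Sum>\<^sub>\<infinity>i\<in>A. a i * u i)\<^sup>2 \<le> ?P * ?Q" .
qed

lemma summable_on_support:
  fixes g :: "'i \<Rightarrow> 'b::{comm_monoid_add,t2_space}"
  assumes "\<And>i. i \<notin> A \<Longrightarrow> g i = 0"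
  shows "g summable_on A \<longleftrightarrow> g summable_on UNIV" and "infsum g A = infsum g UNIV"
proof -
  show "g summable_on A \<longleftrightarrow> g summable_on UNIV" by (rule summable_on_cong_neutral) (use assms in auto)
  show "infsum g A = infsum g UNIV" by (rule infsum_cong_neutral) (use assms in auto)
qed

text \<open>Tonelli and translation invariance. The index type is arbitrary because composing two
  operators needs series over pairs, and restricting to the countable support makes the counting
  measure sigma-finite.\<close>

lemma translates_weighted_energy:
  fixes a :: "'i \<Rightarrow> complex" and \<tau> :: "'i \<Rightarrow> real^'d::finite"
  assumes a: "(\<lambda>i. cmod (a i)) summable_on UNIV" and f: "f \<in> L2"
  defines "A \<equiv> {i. a i \<noteq> 0}"
  defines "h \<equiv> \<lambda>x. \<integral>\<^sup>+i. ennreal (cmod (a i) * (cmod (f (x - \<tau> i)))\<^sup>2) \<partial>count_space A"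
  shows "(\<integral>\<^sup>+x. h x \<partial>lebesgue) = ennreal (\<Sum>\<^sub>\<infinity>i. cmod (a i)) * l2energy f"
    and "AE x in lebesgue. h x < \<infinity>"
    and translates_weighted_energy_measurable: "h \<in> borel_measurable lebesgue"
proof -
  have A: "countable A" unfolding A_def using summable_countable_real[OF a] by simp
  have fm: "(\<lambda>x. f (x - t)) \<in> borel_measurable lebesgue" for t
    using f by (intro borel_measurable_lebesgue_translate L2_measurable)
  have gm: "(\<lambda>x. ennreal (cmod (a i) * (cmod (f (x - \<tau> i)))\<^sup>2)) \<in> borel_measurable lebesgue" for i
    using fm[of "\<tau> i"] by measurable
  have "(\<integral>\<^sup>+x. h x \<partial>lebesgue) = (\<integral>\<^sup>+i. \<integral>\<^sup>+x. ennreal (cmod (a i) * (cmod (f (x - \<tau> i)))\<^sup>2) \<partial>lebesgue \<partial>count_space A)"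
    unfolding h_def by (rule nn_integral_count_space_nn_integral[OF A gm])
  also have "\<dots> = (\<integral>\<^sup>+i. ennreal (cmod (a i)) * l2energy f \<partial>count_space A)"
  proof (intro nn_integral_cong)
    fix i
    have "(\<integral>\<^sup>+x. ennreal (cmod (a i) * (cmod (f (x - \<tau> i)))\<^sup>2) \<partial>lebesgue)
       = (\<integral>\<^sup>+x. ennreal (cmod (a i)) * ennreal ((cmod (f (x - \<tau> i)))\<^sup>2) \<partial>lebesgue)"
      by (simp add: ennreal_mult)
    also have "\<dots> = ennreal (cmod (a i)) * (\<integral>\<^sup>+x. ennreal ((cmod (f (x - \<tau> i)))\<^sup>2) \<partial>lebesgue)"
      using fm[of "\<tau> i"] by (intro nn_integral_cmult) measurable
    also have "(\<integral>\<^sup>+x. ennreal ((cmod (f (x - \<tau> i)))\<^sup>2) \<partial>lebesgue) = l2energy f"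
      unfolding l2energy_def using f
      by (intro nn_integral_lebesgue_translate[where f = "\<lambda>x. ennreal ((cmod (f x))\<^sup>2)"]) (auto simp: L2_iff)
    finally show "(\<integral>\<^sup>+x. ennreal (cmod (a i) * (cmod (f (x - \<tau> i)))\<^sup>2) \<partial>lebesgue) = ennreal (cmod (a i)) * l2energy f" .
  qed
  also have "\<dots> = (\<integral>\<^sup>+i. ennreal (cmod (a i)) \<partial>count_space A) * l2energy f"
    by (rule nn_integral_multc) auto
  also have "(\<integral>\<^sup>+i. ennreal (cmod (a i)) \<partial>count_space A) = ennreal (\<Sum>\<^sub>\<infinity>i\<in>A. cmod (a i))"
    using a summable_on_subset_banach by (intro nn_integral_count_space_infsum) auto
  also have "(\<Sum>\<^sub>\<infinity>i\<in>A. cmod (a i)) = (\<Sum>\<^sub>\<infinity>i. cmod (a i))"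
    by (rule summable_on_support) (simp add: A_def)
  finally show I: "(\<integral>\<^sup>+x. h x \<partial>lebesgue) = ennreal (\<Sum>\<^sub>\<infinity>i. cmod (a i)) * l2energy f" .
  interpret sigma_finite_measure "count_space A" using A by (rule sigma_finite_measure_count_space_countable)
  show hm: "h \<in> borel_measurable lebesgue"
    unfolding h_def
  proof (rule borel_measurable_nn_integral)
    show "(\<lambda>(x, i). ennreal (cmod (a i) * (cmod (f (x - \<tau> i)))\<^sup>2)) \<in> borel_measurable (lebesgue \<Otimes>\<^sub>M count_space A)"
      unfolding split_beta'
      by (rule measurable_compose_countable'[where I = A and g = snd and
            f = "\<lambda>i p. ennreal (cmod (a i) * (cmod (f (fst p - \<tau> i)))\<^sup>2)"])
        (use A measurable_compose[OF measurable_fst gm] in auto)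
  qed
  show "AE x in lebesgue. h x < \<infinity>"
  proof -
    have "(\<integral>\<^sup>+x. h x \<partial>lebesgue) \<noteq> \<infinity>" unfolding I l2energy_eq[OF f] by (simp add: ennreal_mult_eq_top_iff)
    then have "AE x in lebesgue. h x \<noteq> \<infinity>" by (rule nn_integral_PInf_AE[OF hm])
    then show ?thesis by eventually_elim (simp add: less_top)
  qed
qed


lemma translates_summable:
  fixes a :: "'i \<Rightarrow> complex" and \<tau> :: "'i \<Rightarrow> real^'d::finite"
  assumes a: "(\<lambda>i. cmod (a i)) summable_on UNIV" and f: "f \<in> L2"
  shows "AE x in lebesgue. (\<lambda>i. cmod (a i) * cmod (f (x - \<tau> i))) summable_on UNIV"
  using translates_weighted_energy(2)[OF a f, of \<tau>]
proof eventually_elim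
  case (elim x)
  have "(\<lambda>i. cmod (a i) * (cmod (f (x - \<tau> i)))\<^sup>2) summable_on {i. a i \<noteq> 0}"
    using elim by (rule nn_integral_count_space_finite_imp_summable) auto
  then have "(\<lambda>i. cmod (a i) * (cmod (f (x - \<tau> i)))\<^sup>2) summable_on UNIV"
    by (subst (asm) summable_on_support) auto
  then show ?case using infsum_cauchy_schwarz(1)[OF a, of "\<lambda>i. cmod (f (x - \<tau> i))"] by simp
qed

lemma cmod_tfs: "cmod (tfs lam f x) = cmod (f (x - fst lam))"
  unfolding tfs_def by (simp add: norm_mult)

lemma tf_op_summable:
  assumes "(\<lambda>lam. cmod (c lam)) summable_on UNIV" "f \<in> L2"
  shows "AE x in lebesgue. (\<lambda>lam. c lam * tfs lam f x) summable_on UNIV"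
  using translates_summable[OF assms, of fst]
proof eventually_elim
  case (elim x)
  have "(\<lambda>lam. norm (c lam * tfs lam f x)) summable_on UNIV"
    using elim by (simp add: norm_mult cmod_tfs)
  then show ?case by (rule abs_summable_summable)
qed

lemma tfs_measurable:
  assumes "f \<in> borel_measurable lebesgue"
  shows "tfs lam f \<in> borel_measurable lebesgue"
proof -
  have "(\<lambda>x. cis (snd lam \<bullet> x)) \<in> borel_measurable lebesgue"
    by (intro measurable_completion) (simp add: borel_measurable_continuous_onI continuous_intros)
  then show ?thesis unfolding tfs_def
    by (intro borel_measurable_times borel_measurable_lebesgue_translate[OF assms])
qed

text \<open>Without summability both sides take the default value 0. The series becomes a
  parametrised integral, which gives its measurability in \<open>x\<close>.\<close>

lemma infsum_complex_eq_integral: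
  fixes g :: "'i \<Rightarrow> complex"
  shows "infsum g A = (\<integral>i. g i \<partial>count_space A)"
proof (cases "Infinite_Set_Sum.abs_summable_on g A")
  case True
  then show ?thesis using infsetsum_infsum[OF True] by (simp add: infsetsum_def)
next
  case False
  then have "\<not> g summable_on A"
    using summable_on_iff_abs_summable_on_complex abs_summable_equivalent by blast
  with False show ?thesis
    by (simp add: infsum_not_exists abs_summable_on_def not_integrable_integral_eq)
qed

lemma tf_op_measurable:
  assumes c: "countable {lam. c lam \<noteq> 0}" and f: "f \<in> borel_measurable lebesgue"
  shows "tf_op c f \<in> borel_measurable lebesgue"
proof -
  let ?A = "{lam. c lam \<noteq> 0}"
  interpret sigma_finite_measure "count_space ?A" using c by (rule sigma_finite_measure_count_space_countable)
  have "tf_op c f = (\<lambda>x. \<integral>lam. c lam * tfs lam f x \<partial>count_space ?A)"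
    unfolding tf_op_def infsum_complex_eq_integral[symmetric]
    by (intro ext summable_on_support(2)[symmetric]) auto
  also have "\<dots> \<in> borel_measurable lebesgue"
  proof (rule borel_measurable_lebesgue_integral)
    have gm: "(\<lambda>x. c lam * tfs lam f x) \<in> borel_measurable lebesgue" for lam
      using tfs_measurable[OF f, of lam] by measurable
    show "(\<lambda>(x, lam). c lam * tfs lam f x) \<in> borel_measurable (lebesgue \<Otimes>\<^sub>M count_space ?A)"
      unfolding split_beta'
      by (rule measurable_compose_countable'[where I = ?A and g = snd and
            f = "\<lambda>lam p. c lam * tfs lam f (fst p)"])
        (use c measurable_compose[OF measurable_fst gm] in auto)
  qed
  finally show ?thesis .
qed

text \<open>Pointwise Cauchy-Schwarz gives one factor \<open>S\<close>, and integrating the weighted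
  energies of the translates gives the other.\<close>

lemma tf_op_bound:
  assumes c: "(\<lambda>lam. cmod (c lam)) summable_on UNIV" and f: "f \<in> L2"
  shows "tf_op c f \<in> L2" and "l2norm (tf_op c f) \<le> (\<Sum>\<^sub>\<infinity>lam. cmod (c lam)) * l2norm f"
proof -
  let ?A = "{lam. c lam \<noteq> 0}"
  let ?h = "\<lambda>x. \<integral>\<^sup>+lam. ennreal (cmod (c lam) * (cmod (f (x - fst lam)))\<^sup>2) \<partial>count_space ?A"
  define S where "S = (\<Sum>\<^sub>\<infinity>lam. cmod (c lam))"
  have S: "S \<ge> 0" unfolding S_def by (intro infsum_nonneg) auto
  have cA: "countable ?A" using summable_countable_real[OF c] by simp
  have "AE x in lebesgue. ennreal ((cmod (tf_op c f x))\<^sup>2) \<le> ennreal S * ?h x"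
    using translates_weighted_energy(2)[OF c f, of fst]
  proof eventually_elim
    case (elim x)
    have s: "(\<lambda>lam. cmod (c lam) * (cmod (f (x - fst lam)))\<^sup>2) summable_on ?A"
      using elim by (rule nn_integral_count_space_finite_imp_summable) auto
    then have sU: "(\<lambda>lam. cmod (c lam) * (cmod (f (x - fst lam)))\<^sup>2) summable_on UNIV"
      by (subst (asm) summable_on_support) auto
    have h: "?h x = ennreal (\<Sum>\<^sub>\<infinity>lam. cmod (c lam) * (cmod (f (x - fst lam)))\<^sup>2)"
      unfolding nn_integral_count_space_infsum[OF s mult_nonneg_nonneg[OF norm_ge_zero zero_le_power2]]
      by (intro arg_cong[of _ _ ennreal] summable_on_support(2)) auto
    note cs = infsum_cauchy_schwarz[OF c _ sU, simplified]
    have "cmod (tf_op c f x) \<le> (\<Sum>\<^sub>\<infinity>lam. cmod (c lam * tfs lam f x))"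
      unfolding tf_op_def by (rule norm_infsum_bound) (use cs(1) in \<open>simp add: norm_mult cmod_tfs\<close>)
    also have "\<dots> = (\<Sum>\<^sub>\<infinity>lam. cmod (c lam) * cmod (f (x - fst lam)))"
      by (simp add: norm_mult cmod_tfs)
    finally have "(cmod (tf_op c f x))\<^sup>2 \<le> (\<Sum>\<^sub>\<infinity>lam. cmod (c lam) * cmod (f (x - fst lam)))\<^sup>2"
      by (intro power_mono) auto
    also have "\<dots> \<le> S * (\<Sum>\<^sub>\<infinity>lam. cmod (c lam) * (cmod (f (x - fst lam)))\<^sup>2)"
      using cs(2) unfolding S_def .
    finally show ?case unfolding h using S by (simp add: infsum_nonneg flip: ennreal_mult)
  qed
  then have "l2energy (tf_op c f) \<le> (\<integral>\<^sup>+x. ennreal S * ?h x \<partial>lebesgue)"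
    unfolding l2energy_def by (rule nn_integral_mono_AE)
  also have "\<dots> = ennreal S * (\<integral>\<^sup>+x. ?h x \<partial>lebesgue)"
    by (rule nn_integral_cmult) (rule translates_weighted_energy_measurable[OF c f])
  also have "\<dots> = ennreal ((S * l2norm f)\<^sup>2)"
    unfolding translates_weighted_energy(1)[OF c f] l2energy_eq[OF f] S_def[symmetric]
    using S by (simp add: power2_eq_square l2norm_nonneg algebra_simps flip: ennreal_mult)
  finally have "l2energy (tf_op c f) \<le> ennreal ((S * l2norm f)\<^sup>2)" .
  with tf_op_measurable[OF cA L2_measurable[OF f]] S l2norm_nonneg[of f]
  show "tf_op c f \<in> L2" and "l2norm (tf_op c f) \<le> S * l2norm f"
    by (auto intro: l2normI)
qed

text \<open>Each translate has its own exceptional null set; countable support allows their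
  union.\<close>

lemma tf_op_l2eq_cong:
  assumes c: "countable {lam. c lam \<noteq> 0}" and fg: "l2eq f g"
  shows "l2eq (tf_op c f) (tf_op c g)"
proof -
  have "AE x in lebesgue. \<forall>lam\<in>{lam. c lam \<noteq> 0}. f (x - fst lam) = g (x - fst lam)"
    using fg[unfolded l2eq_def] by (intro AE_ball_countable[THEN iffD2] c ballI AE_lebesgue_translate)
  then show ?thesis unfolding l2eq_def
    by eventually_elim (unfold tf_op_def tfs_def, intro infsum_cong, auto)
qed

lemma tf_op_lincomb:
  assumes c: "(\<lambda>lam. cmod (c lam)) summable_on UNIV" and f: "f \<in> L2" and g: "g \<in> L2"
  shows "l2eq (tf_op c (\<lambda>x. a * f x + b * g x)) (\<lambda>x. a * tf_op c f x + b * tf_op c g x)"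
  unfolding l2eq_def using tf_op_summable[OF c f] tf_op_summable[OF c g]
proof eventually_elim
  case (elim x)
  have "tf_op c (\<lambda>x. a * f x + b * g x) x = (\<Sum>\<^sub>\<infinity>lam. a * (c lam * tfs lam f x) + b * (c lam * tfs lam g x))"
    unfolding tf_op_def tfs_def by (intro infsum_cong) (simp add: algebra_simps)
  also have "\<dots> = (\<Sum>\<^sub>\<infinity>lam. a * (c lam * tfs lam f x)) + (\<Sum>\<^sub>\<infinity>lam. b * (c lam * tfs lam g x))"
    using elim by (intro infsum_add summable_on_cmult_right)
  also have "\<dots> = a * tf_op c f x + b * tf_op c g x"
    unfolding tf_op_def by (simp add: infsum_cmult_right')
  finally show ?case .
qed

lemma bounded_op_tf_op:
  assumes "(\<lambda>lam. cmod (c lam)) summable_on UNIV"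
  shows "bounded_op (tf_op c)"
proof -
  have "countable {lam. c lam \<noteq> 0}" using summable_countable_real[OF assms] by simp
  then show ?thesis unfolding bounded_op_def
    using tf_op_bound[OF assms] tf_op_l2eq_cong tf_op_lincomb[OF assms] by blast
qed

lemma tf_op_add:
  assumes "(\<lambda>lam. cmod (c lam)) summable_on UNIV" "(\<lambda>lam. cmod (d lam)) summable_on UNIV" "f \<in> L2"
  shows "l2eq (tf_op (\<lambda>lam. c lam + d lam) f) (\<lambda>x. tf_op c f x + tf_op d f x)"
  unfolding l2eq_def using tf_op_summable[OF assms(1,3)] tf_op_summable[OF assms(2,3)]
  by eventually_elim (simp only: tf_op_def distrib_right infsum_add)

lemma tf_op_scale: "tf_op (\<lambda>lam. a * c lam) f = (\<lambda>x. a * tf_op c f x)"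
  unfolding tf_op_def by (simp add: infsum_cmult_right' mult.assoc)

section \<open>Twisted convolution\<close>

definition delta :: "'a \<Rightarrow> 'a \<Rightarrow> complex" where
  "delta \<mu> = (\<lambda>lam. if lam = \<mu> then 1 else 0)"

lemma tf_op_delta: "tf_op (delta \<mu>) f = tfs \<mu> f"
proof
  fix x
  have "tf_op (delta \<mu>) f x = (\<Sum>\<^sub>\<infinity>lam\<in>{\<mu>}. delta \<mu> lam * tfs lam f x)"
    unfolding tf_op_def delta_def by (rule infsum_cong_neutral) auto
  then show "tf_op (delta \<mu>) f x = tfs \<mu> f x" by (simp add: delta_def)
qed

definition phase_factor :: "'d::finite phase \<Rightarrow> 'd phase \<Rightarrow> complex" where
  "phase_factor \<mu> \<nu> = cis (- (snd \<nu> \<bullet> fst \<mu>))"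

lemma norm_phase_factor [simp]: "cmod (phase_factor \<mu> \<nu>) = 1"
  by (simp add: phase_factor_def)

lemma tfs_tfs: "tfs \<mu> (tfs \<nu> f) x = phase_factor \<mu> \<nu> * tfs (\<mu> + \<nu>) f x"
proof -
  have "cis (snd \<mu> \<bullet> x) * cis (snd \<nu> \<bullet> (x - fst \<mu>)) = cis (- (snd \<nu> \<bullet> fst \<mu>)) * cis (snd (\<mu> + \<nu>) \<bullet> x)"
    by (simp add: cis_mult inner_diff_right inner_add_left algebra_simps)
  then show ?thesis unfolding tfs_def phase_factor_def by (simp add: mult.assoc[symmetric] diff_diff_eq)
qed

text \<open>Twisted convolution: the coefficient family of the product of two time-frequency series,
  the phase being the cocycle with which shifts compose.\<close>

definition tconv :: "('d::finite phase \<Rightarrow> complex) \<Rightarrow> ('d phase \<Rightarrow> complex) \<Rightarrow> 'd phase \<Rightarrow> complex" where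
  "tconv c d lam = (\<Sum>\<^sub>\<infinity>\<mu>. c \<mu> * d (lam - \<mu>) * phase_factor \<mu> (lam - \<mu>))"

lemma summable_on_Times_cmod:
  fixes c :: "'i \<Rightarrow> complex" and d :: "'j \<Rightarrow> complex"
  assumes "(\<lambda>i. cmod (c i)) summable_on UNIV" "(\<lambda>j. cmod (d j)) summable_on UNIV"
  shows "(\<lambda>(i, j). cmod (c i) * cmod (d j)) summable_on UNIV \<times> UNIV"
  using assms by (intro summable_on_SigmaI[where g = "\<lambda>i. cmod (c i) * (\<Sum>\<^sub>\<infinity>j. cmod (d j))"])
    (auto intro!: has_sum_cmult_right summable_on_cmult_left)

lemma sheared_bij: "bij_betw (\<lambda>(\<mu>, lam). (\<mu>, lam - \<mu>)) (UNIV \<times> UNIV) (UNIV \<times> (UNIV :: 'a::group_add set))"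
  by (rule bij_betwI[where g = "\<lambda>(\<mu>, \<nu>). (\<mu>, \<nu> + \<mu>)"]) auto

lemma tconv_summable_pairs:
  fixes c d :: "'a::group_add \<Rightarrow> complex"
  assumes "(\<lambda>lam. cmod (c lam)) summable_on UNIV" "(\<lambda>lam. cmod (d lam)) summable_on UNIV"
  shows "(\<lambda>(\<mu>, lam). cmod (c \<mu>) * cmod (d (lam - \<mu>))) summable_on UNIV \<times> UNIV"
  using summable_on_reindex_bij_betw[OF sheared_bij, of "\<lambda>(\<mu>, lam). cmod (c \<mu>) * cmod (d lam)"]
    summable_on_Times_cmod[OF assms]
  by (simp add: split_beta')

lemma tconv_summable:
  assumes c: "(\<lambda>lam. cmod (c lam)) summable_on UNIV" and d: "(\<lambda>lam. cmod (d lam)) summable_on UNIV"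
  shows "(\<lambda>lam. cmod (tconv c d lam)) summable_on UNIV"
    and "(\<lambda>\<mu>. cmod (c \<mu>) * cmod (d (lam - \<mu>))) summable_on UNIV"
proof -
  have swap: "(\<lambda>(lam, \<mu>). cmod (c \<mu>) * cmod (d (lam - \<mu>))) summable_on UNIV \<times> UNIV"
    using tconv_summable_pairs[OF c d] by (subst (asm) summable_on_swap) simp
  then have s: "(\<lambda>lam. \<Sum>\<^sub>\<infinity>\<mu>. cmod (c \<mu>) * cmod (d (lam - \<mu>))) summable_on UNIV"
    by (rule summable_on_Sigma_banach)
  have sl: "(\<lambda>\<mu>. cmod (c \<mu>) * cmod (d (lam - \<mu>))) summable_on UNIV" for lam
    using swap by (rule summable_on_SigmaD1) auto
  show "(\<lambda>\<mu>. cmod (c \<mu>) * cmod (d (lam - \<mu>))) summable_on UNIV" by (rule sl)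
  show "(\<lambda>lam. cmod (tconv c d lam)) summable_on UNIV"
  proof (rule summable_on_comparison_test[OF s])
    fix lam
    have "cmod (tconv c d lam) \<le> (\<Sum>\<^sub>\<infinity>\<mu>. cmod (c \<mu> * d (lam - \<mu>) * phase_factor \<mu> (lam - \<mu>)))"
      unfolding tconv_def by (rule norm_infsum_bound) (use sl in \<open>simp add: norm_mult\<close>)
    then show "cmod (tconv c d lam) \<le> (\<Sum>\<^sub>\<infinity>\<mu>. cmod (c \<mu>) * cmod (d (lam - \<mu>)))"
      by (simp add: norm_mult)
  qed auto
qed

text \<open>The double series, indexed by the first shift and the total shift, has absolutely
  summable coefficients. At almost every \<open>x\<close> it therefore converges absolutely, and the
  two summations may be exchanged there.\<close>

lemma tf_op_tconv:
  assumes c: "(\<lambda>lam. cmod (c lam)) summable_on UNIV" and d: "(\<lambda>lam. cmod (d lam)) summable_on UNIV"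
    and f: "f \<in> L2"
  shows "l2eq (tf_op c (tf_op d f)) (tf_op (tconv c d) f)"
proof -
  define a where "a = (\<lambda>(\<mu>, lam). c \<mu> * d (lam - \<mu>) * phase_factor \<mu> (lam - \<mu>))"
  have a: "(\<lambda>p. cmod (a p)) summable_on UNIV"
    using tconv_summable_pairs[OF c d] by (simp add: a_def norm_mult split_beta')
  show ?thesis unfolding l2eq_def using translates_summable[OF a f, of "\<lambda>p. fst (snd p)"]
  proof eventually_elim
    case (elim x)
    define g where "g = (\<lambda>\<mu> lam. a (\<mu>, lam) * tfs lam f x)"
    have "(\<lambda>p. norm (g (fst p) (snd p))) summable_on UNIV \<times> UNIV"
      using elim by (simp add: g_def norm_mult cmod_tfs)
    then have g: "(\<lambda>(\<mu>, lam). g \<mu> lam) summable_on UNIV \<times> UNIV"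
      unfolding split_beta' by (rule abs_summable_summable)
    have "tf_op c (tf_op d f) x = (\<Sum>\<^sub>\<infinity>\<mu>. \<Sum>\<^sub>\<infinity>\<nu>. g \<mu> (\<mu> + \<nu>))"
      unfolding tf_op_def
    proof (intro infsum_cong)
      fix \<mu>
      have "c \<mu> * tfs \<mu> (\<lambda>x. \<Sum>\<^sub>\<infinity>\<nu>. d \<nu> * tfs \<nu> f x) x = (\<Sum>\<^sub>\<infinity>\<nu>. c \<mu> * (cis (snd \<mu> \<bullet> x) * (d \<nu> * tfs \<nu> f (x - fst \<mu>))))"
        unfolding tfs_def[of \<mu>] by (simp only: infsum_cmult_right')
      also have "\<dots> = (\<Sum>\<^sub>\<infinity>\<nu>. g \<mu> (\<mu> + \<nu>))"
      proof (intro infsum_cong)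
        fix \<nu>
        have "c \<mu> * (cis (snd \<mu> \<bullet> x) * (d \<nu> * tfs \<nu> f (x - fst \<mu>))) = c \<mu> * d \<nu> * tfs \<mu> (tfs \<nu> f) x"
          by (simp add: tfs_def[of \<mu>])
        then show "c \<mu> * (cis (snd \<mu> \<bullet> x) * (d \<nu> * tfs \<nu> f (x - fst \<mu>))) = g \<mu> (\<mu> + \<nu>)"
          by (simp add: g_def a_def tfs_tfs)
      qed
      finally show "c \<mu> * tfs \<mu> (\<lambda>x. \<Sum>\<^sub>\<infinity>\<nu>. d \<nu> * tfs \<nu> f x) x = (\<Sum>\<^sub>\<infinity>\<nu>. g \<mu> (\<mu> + \<nu>))" .
    qed
    also have "\<dots> = (\<Sum>\<^sub>\<infinity>\<mu>. \<Sum>\<^sub>\<infinity>lam. g \<mu> lam)"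
      by (intro infsum_cong infsum_reindex_bij_betw) (auto simp: bij_plus_right)
    also have "\<dots> = (\<Sum>\<^sub>\<infinity>lam. \<Sum>\<^sub>\<infinity>\<mu>. g \<mu> lam)"
      by (rule infsum_swap_banach[OF g])
    also have "\<dots> = tf_op (tconv c d) f x"
      unfolding tf_op_def tconv_def g_def a_def by (simp add: infsum_cmult_left')
    finally show ?case .
  qed
qed

section \<open>The ring of bounded operators modulo almost everywhere equality\<close>

lemma bounded_opD:
  assumes "bounded_op S"
  shows "f \<in> L2 \<Longrightarrow> S f \<in> L2"
    and "f \<in> L2 \<Longrightarrow> g \<in> L2 \<Longrightarrow> l2eq f g \<Longrightarrow> l2eq (S f) (S g)"
    and "f \<in> L2 \<Longrightarrow> g \<in> L2 \<Longrightarrow> l2eq (S (\<lambda>x. a * f x + b * g x)) (\<lambda>x. a * S f x + b * S g x)"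
    and "\<exists>K\<ge>0. \<forall>f\<in>L2. l2norm (S f) \<le> K * l2norm f"
proof -
  obtain K where K: "\<forall>f\<in>L2. l2norm (S f) \<le> K * l2norm f" using assms unfolding bounded_op_def by blast
  have "l2norm (S f) \<le> max K 0 * l2norm f" if "f \<in> L2" for f
    using K that l2norm_nonneg[of f] by (meson max.cobounded1 mult_right_mono order_trans)
  then show "\<exists>K\<ge>0. \<forall>f\<in>L2. l2norm (S f) \<le> K * l2norm f" by (intro exI[of _ "max K 0"]) auto
qed (use assms[unfolded bounded_op_def] in \<open>simp_all\<close>)

lemma bounded_opI:
  assumes "\<And>f. f \<in> L2 \<Longrightarrow> S f \<in> L2"
    and "\<And>f g. f \<in> L2 \<Longrightarrow> g \<in> L2 \<Longrightarrow> l2eq f g \<Longrightarrow> l2eq (S f) (S g)"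
    and "\<And>f g a b. f \<in> L2 \<Longrightarrow> g \<in> L2 \<Longrightarrow> l2eq (S (\<lambda>x. a * f x + b * g x)) (\<lambda>x. a * S f x + b * S g x)"
    and "\<And>f. f \<in> L2 \<Longrightarrow> l2norm (S f) \<le> K * l2norm f"
  shows "bounded_op S"
  unfolding bounded_op_def by (intro conjI ballI allI impI exI[of _ K] assms)

lemma bounded_op_lincomb:
  assumes S: "bounded_op S" and T: "bounded_op T"
  shows "bounded_op (\<lambda>f x. s * S f x + t * T f x)"
proof -
  obtain K where K: "K \<ge> 0" "\<And>f. f \<in> L2 \<Longrightarrow> l2norm (S f) \<le> K * l2norm f" using bounded_opD(4)[OF S] by auto
  obtain L where L: "L \<ge> 0" "\<And>f. f \<in> L2 \<Longrightarrow> l2norm (T f) \<le> L * l2norm f" using bounded_opD(4)[OF T] by auto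
  show ?thesis
  proof (rule bounded_opI[where K = "cmod s * K + cmod t * L"])
    fix f :: "'a fn" assume f: "f \<in> L2"
    note Sf = bounded_opD(1)[OF S f] and Tf = bounded_opD(1)[OF T f]
    show "(\<lambda>x. s * S f x + t * T f x) \<in> L2" by (rule L2_lincomb[OF Sf Tf])
    have "l2norm (\<lambda>x. s * S f x + t * T f x) \<le> cmod s * l2norm (S f) + cmod t * l2norm (T f)"
      using l2norm_triangle[OF L2_scale[OF Sf, of s] L2_scale[OF Tf, of t]]
      by (simp add: l2norm_scale Sf Tf)
    also have "\<dots> \<le> cmod s * (K * l2norm f) + cmod t * (L * l2norm f)"
      using K(2)[OF f] L(2)[OF f] by (intro add_mono mult_left_mono) auto
    finally show "l2norm (\<lambda>x. s * S f x + t * T f x) \<le> (cmod s * K + cmod t * L) * l2norm f"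
      by (simp add: algebra_simps)
  next
    fix f g :: "'a fn" assume f: "f \<in> L2" "g \<in> L2" "l2eq f g"
    show "l2eq (\<lambda>x. s * S f x + t * T f x) (\<lambda>x. s * S g x + t * T g x)"
      by (intro l2eq_lincomb bounded_opD(2)[OF S f] bounded_opD(2)[OF T f])
  next
    fix f g :: "'a fn" and a b assume f: "f \<in> L2" "g \<in> L2"
    have "l2eq (\<lambda>x. s * S (\<lambda>x. a * f x + b * g x) x + t * T (\<lambda>x. a * f x + b * g x) x)
      (\<lambda>x. s * (a * S f x + b * S g x) + t * (a * T f x + b * T g x))"
      by (intro l2eq_lincomb bounded_opD(3)[OF S f] bounded_opD(3)[OF T f])
    then show "l2eq (\<lambda>x. s * S (\<lambda>x. a * f x + b * g x) x + t * T (\<lambda>x. a * f x + b * g x) x)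
      (\<lambda>x. a * (s * S f x + t * T f x) + b * (s * S g x + t * T g x))"
      by (simp add: algebra_simps)
  qed
qed

lemma bounded_op_id: "bounded_op (\<lambda>f. f)"
  by (rule bounded_opI[where K = 1]) auto

lemma bounded_op_zero: "bounded_op (\<lambda>f x. 0)"
  using bounded_op_lincomb[OF bounded_op_id bounded_op_id, of 0 0] by simp

lemma bounded_op_comp:
  assumes S: "bounded_op S" and T: "bounded_op T"
  shows "bounded_op (\<lambda>f. S (T f))"
proof -
  obtain K where K: "K \<ge> 0" "\<And>f. f \<in> L2 \<Longrightarrow> l2norm (S f) \<le> K * l2norm f" using bounded_opD(4)[OF S] by auto
  obtain L where L: "L \<ge> 0" "\<And>f. f \<in> L2 \<Longrightarrow> l2norm (T f) \<le> L * l2norm f" using bounded_opD(4)[OF T] by auto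
  show ?thesis
  proof (rule bounded_opI[where K = "K * L"])
    fix f :: "'a fn" assume f: "f \<in> L2"
    show "S (T f) \<in> L2" by (rule bounded_opD(1)[OF S bounded_opD(1)[OF T f]])
    have "l2norm (S (T f)) \<le> K * l2norm (T f)" by (rule K(2)[OF bounded_opD(1)[OF T f]])
    also have "\<dots> \<le> K * (L * l2norm f)" using f K L by (simp add: mult_left_mono)
    finally show "l2norm (S (T f)) \<le> K * L * l2norm f" by (simp add: mult.assoc)
  next
    fix f g :: "'a fn" assume f: "f \<in> L2" "g \<in> L2" "l2eq f g"
    show "l2eq (S (T f)) (S (T g))"
      by (rule bounded_opD(2)[OF S bounded_opD(1)[OF T f(1)] bounded_opD(1)[OF T f(2)] bounded_opD(2)[OF T f]])
  next
    fix f g :: "'a fn" and a b assume f: "f \<in> L2" "g \<in> L2"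
    note Tf = bounded_opD(1)[OF T f(1)] and Tg = bounded_opD(1)[OF T f(2)]
    have "l2eq (S (T (\<lambda>x. a * f x + b * g x))) (S (\<lambda>x. a * T f x + b * T g x))"
      by (rule bounded_opD(2)[OF S bounded_opD(1)[OF T L2_lincomb[OF f]] L2_lincomb[OF Tf Tg] bounded_opD(3)[OF T f]])
    also have "l2eq \<dots> (\<lambda>x. a * S (T f) x + b * S (T g) x)"
      by (rule bounded_opD(3)[OF S Tf Tg])
    finally show "l2eq (S (T (\<lambda>x. a * f x + b * g x))) (\<lambda>x. a * S (T f) x + b * S (T g) x)" .
  qed
qed

lemma bounded_op_add: "bounded_op S \<Longrightarrow> bounded_op T \<Longrightarrow> bounded_op (\<lambda>f x. S f x + T f x)"
  using bounded_op_lincomb[of S T 1 1] by simp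

lemma bounded_op_diff: "bounded_op S \<Longrightarrow> bounded_op T \<Longrightarrow> bounded_op (\<lambda>f x. S f x - T f x)"
  using bounded_op_lincomb[of S T 1 "- 1"] by simp

lemma bounded_op_scale: "bounded_op S \<Longrightarrow> bounded_op (\<lambda>f x. a * S f x)"
  using bounded_op_lincomb[of S S a 0] by simp

text \<open>Boundedness belongs to the relation, so it is reflexive exactly on bounded operators and
  the partial quotient contains only their classes.\<close>

definition op_eq :: "('d::finite fn \<Rightarrow> 'd fn) \<Rightarrow> ('d fn \<Rightarrow> 'd fn) \<Rightarrow> bool" where
  "op_eq S T \<longleftrightarrow> bounded_op S \<and> bounded_op T \<and> (\<forall>f\<in>L2. l2eq (S f) (T f))"

lemma op_eqI:
  "bounded_op S \<Longrightarrow> bounded_op T \<Longrightarrow> (\<And>f. f \<in> L2 \<Longrightarrow> l2eq (S f) (T f)) \<Longrightarrow> op_eq S T"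
  by (simp add: op_eq_def)

lemma op_eqD:
  assumes "op_eq S T"
  shows "bounded_op S" "bounded_op T" "\<And>f. f \<in> L2 \<Longrightarrow> l2eq (S f) (T f)"
  using assms by (simp_all add: op_eq_def)

lemma op_eq_refl: "bounded_op S \<Longrightarrow> op_eq S S"
  by (simp add: op_eq_def)

lemma part_equivp_op_eq: "part_equivp (op_eq :: ('d::finite fn \<Rightarrow> 'd fn) \<Rightarrow> _)"
proof (rule part_equivpI)
  show "\<exists>S. (op_eq :: ('d fn \<Rightarrow> 'd fn) \<Rightarrow> _) S S" by (rule exI[of _ "\<lambda>f. f"], rule op_eq_refl[OF bounded_op_id])
  show "symp (op_eq :: ('d fn \<Rightarrow> 'd fn) \<Rightarrow> _)" by (rule sympI, rule op_eqI) (simp_all add: op_eq_def l2eq_sym)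
  show "transp (op_eq :: ('d fn \<Rightarrow> 'd fn) \<Rightarrow> _)"
  proof (rule transpI)
    fix S T U :: "'d fn \<Rightarrow> 'd fn" assume ST: "op_eq S T" and TU: "op_eq T U"
    show "op_eq S U"
      by (rule op_eqI[OF op_eqD(1)[OF ST] op_eqD(2)[OF TU] l2eq_trans[OF op_eqD(3)[OF ST] op_eqD(3)[OF TU]]])
  qed
qed

quotient_type 'd bop = "'d::finite fn \<Rightarrow> 'd fn" / partial: op_eq
  by (rule part_equivp_op_eq)

instantiation bop :: (finite) ring_1
begin

lift_definition zero_bop :: "'a bop" is "\<lambda>f x. 0"
  by (rule op_eq_refl[OF bounded_op_zero])

lift_definition one_bop :: "'a bop" is "\<lambda>f. f"
  by (rule op_eq_refl[OF bounded_op_id])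

lift_definition plus_bop :: "'a bop \<Rightarrow> 'a bop \<Rightarrow> 'a bop" is "\<lambda>S T f x. S f x + T f x"
  by (rule op_eqI[OF bounded_op_add[OF op_eqD(1) op_eqD(1)] bounded_op_add[OF op_eqD(2) op_eqD(2)] l2eq_add[OF op_eqD(3) op_eqD(3)]])

lift_definition minus_bop :: "'a bop \<Rightarrow> 'a bop \<Rightarrow> 'a bop" is "\<lambda>S T f x. S f x - T f x"
  by (rule op_eqI[OF bounded_op_diff[OF op_eqD(1) op_eqD(1)] bounded_op_diff[OF op_eqD(2) op_eqD(2)] l2eq_diff[OF op_eqD(3) op_eqD(3)]])

lift_definition uminus_bop :: "'a bop \<Rightarrow> 'a bop" is "\<lambda>S f x. - S f x"
proof -
  fix S T :: "'a fn \<Rightarrow> 'a fn" assume ST: "op_eq S T"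
  have "op_eq (\<lambda>f x. - 1 * S f x) (\<lambda>f x. - 1 * T f x)"
    by (intro op_eqI bounded_op_scale l2eq_scale op_eqD[OF ST])
  then show "op_eq (\<lambda>f x. - S f x) (\<lambda>f x. - T f x)" by simp
qed

lift_definition times_bop :: "'a bop \<Rightarrow> 'a bop \<Rightarrow> 'a bop" is "\<lambda>S T f. S (T f)"
proof -
  fix S S' T T' :: "'a fn \<Rightarrow> 'a fn" assume S: "op_eq S S'" and T: "op_eq T T'"
  note S = op_eqD[OF S] and T = op_eqD[OF T]
  have "l2eq (S (T f)) (S' (T' f))" if f: "f \<in> L2" for f
  proof -
    have "l2eq (S (T f)) (S (T' f))"
      by (rule bounded_opD(2)[OF S(1)]) (use f T bounded_opD(1) in blast)+
    also have "l2eq (S (T' f)) (S' (T' f))" by (rule S(3)) (use f T bounded_opD(1) in blast)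
    finally show ?thesis .
  qed
  then show "op_eq (\<lambda>f. S (T f)) (\<lambda>f. S' (T' f))"
    by (intro op_eqI bounded_op_comp[OF S(1) T(1)] bounded_op_comp[OF S(2) T(2)])
qed

instance
proof
  fix a b c :: "'a bop"
  show "a * b * c = a * (b * c)"
    by transfer (rule op_eq_refl[OF bounded_op_comp[OF op_eqD(1) bounded_op_comp[OF op_eqD(1) op_eqD(1)]]])
  show "1 * a = a" "a * 1 = a"
    by (transfer, simp)+
  show "a + b + c = a + (b + c)"
    by transfer (subst add.assoc, rule op_eq_refl[OF bounded_op_add[OF op_eqD(1) bounded_op_add[OF op_eqD(1) op_eqD(1)]]])
  show "a + b = b + a"
    by transfer (subst add.commute, rule op_eq_refl[OF bounded_op_add[OF op_eqD(1) op_eqD(1)]])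
  show "0 + a = a" by transfer simp
  show "- a + a = 0" by transfer (simp add: op_eq_refl bounded_op_zero)
  show "a - b = a + - b"
    by transfer (subst diff_conv_add_uminus[symmetric], rule op_eq_refl[OF bounded_op_diff[OF op_eqD(1) op_eqD(1)]])
  show "(a + b) * c = a * c + b * c"
    by transfer (rule op_eq_refl[OF bounded_op_add[OF bounded_op_comp[OF op_eqD(1) op_eqD(1)] bounded_op_comp[OF op_eqD(1) op_eqD(1)]]])
  show "a * (b + c) = a * b + a * c"
  proof transfer
    fix S T U :: "'a fn \<Rightarrow> 'a fn"
    assume "op_eq S S" "op_eq T T" "op_eq U U"
    then have b: "bounded_op S" "bounded_op T" "bounded_op U" by (auto dest: op_eqD)
    show "op_eq (\<lambda>f. S (\<lambda>x. T f x + U f x)) (\<lambda>f x. S (T f) x + S (U f) x)"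
    proof (rule op_eqI)
      show "bounded_op (\<lambda>f. S (\<lambda>x. T f x + U f x))"
        by (rule bounded_op_comp[OF b(1) bounded_op_add[OF b(2,3)]])
      show "bounded_op (\<lambda>f x. S (T f) x + S (U f) x)"
        by (rule bounded_op_add[OF bounded_op_comp[OF b(1,2)] bounded_op_comp[OF b(1,3)]])
      fix f :: "'a fn" assume "f \<in> L2"
      then show "l2eq (S (\<lambda>x. T f x + U f x)) (\<lambda>x. S (T f) x + S (U f) x)"
        using bounded_opD(3)[OF b(1) bounded_opD(1)[OF b(2)] bounded_opD(1)[OF b(3)], of f f 1 1] by simp
    qed
  qed
  show "(0::'a bop) \<noteq> 1"
  proof (transfer, rule notI)
    assume *: "op_eq (\<lambda>(f::'a fn) x. 0) (\<lambda>f. f)"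
    obtain f :: "'a fn" where f: "f \<in> L2" "l2norm f = 1" using exists_l2norm_1 by blast
    have "l2eq (\<lambda>x. 0) f" using op_eqD(3)[OF * f(1)] .
    then have "l2norm f = 0" using l2norm_cong[OF _ L2_zero] l2norm_zero by metis
    with f show False by simp
  qed
qed

end

section \<open>The operator norm on the quotient ring\<close>

definition opnorm :: "('d::finite fn \<Rightarrow> 'd fn) \<Rightarrow> real" where
  "opnorm S = Inf {K. 0 \<le> K \<and> (\<forall>f\<in>L2. l2norm (S f) \<le> K * l2norm f)}"

lemma opnorm_le: "0 \<le> K \<Longrightarrow> (\<And>f. f \<in> L2 \<Longrightarrow> l2norm (S f) \<le> K * l2norm f) \<Longrightarrow> opnorm S \<le> K"
  unfolding opnorm_def by (rule cInf_lower) (auto intro: bdd_belowI[of _ 0])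

lemma opnorm_nonneg: "bounded_op S \<Longrightarrow> 0 \<le> opnorm S"
  unfolding opnorm_def by (rule cInf_greatest) (use bounded_opD(4)[of S] in auto)

lemma l2norm_le_opnorm:
  assumes S: "bounded_op S" and f: "f \<in> L2"
  shows "l2norm (S f) \<le> opnorm S * l2norm f"
proof (cases "l2norm f = 0")
  case True
  then show ?thesis using bounded_opD(4)[OF S] f by auto
next
  case False
  then have pos: "l2norm f > 0" using l2norm_nonneg[of f] by simp
  have "l2norm (S f) / l2norm f \<le> opnorm S"
    unfolding opnorm_def
    by (rule cInf_greatest) (use bounded_opD(4)[OF S] f pos in \<open>auto simp: field_simps\<close>)
  then show ?thesis using pos by (simp add: field_simps)
qed

lemma opnorm_cong:
  assumes "op_eq S T" shows "opnorm S = opnorm T"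
proof -
  have "l2norm (S f) = l2norm (T f)" if "f \<in> L2" for f
    using op_eqD[OF assms] that bounded_opD(1) by (intro l2norm_cong) auto
  then show ?thesis unfolding opnorm_def by simp
qed

lift_definition bop_norm :: "'d::finite bop \<Rightarrow> real" is opnorm
  by (rule opnorm_cong)

lift_definition bop_scalar :: "complex \<Rightarrow> 'd::finite bop" is "\<lambda>a f x. a * f x"
  by (rule op_eq_refl[OF bounded_op_scale[OF bounded_op_id]])

lemma opnorm_scale_le:
  assumes "bounded_op S" shows "opnorm (\<lambda>f x. a * S f x) \<le> cmod a * opnorm S"
proof (rule opnorm_le)
  fix f :: "'a fn" assume f: "f \<in> L2"
  then show "l2norm (\<lambda>x. a * S f x) \<le> cmod a * opnorm S * l2norm f"
    using l2norm_le_opnorm[OF assms f] by (simp add: l2norm_scale bounded_opD assms mult.assoc mult_left_mono)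
qed (simp add: opnorm_nonneg assms)

lemma opnorm_scale:
  assumes S: "bounded_op S" shows "opnorm (\<lambda>f x. a * S f x) = cmod a * opnorm S"
proof (cases "a = 0")
  case True
  have "opnorm (\<lambda>(f::'a fn) (x::real^'a). 0) \<le> 0" by (rule opnorm_le) (auto simp: l2norm_zero)
  then have "opnorm (\<lambda>(f::'a fn) (x::real^'a). 0) = 0" using opnorm_nonneg[OF bounded_op_zero] by (rule antisym)
  then show ?thesis using True by simp
next
  case False
  have "opnorm (\<lambda>f x. 1 / a * (a * S f x)) \<le> cmod (1 / a) * opnorm (\<lambda>f x. a * S f x)"
    by (rule opnorm_scale_le[OF bounded_op_scale[OF S]])
  then have "cmod a * opnorm S \<le> opnorm (\<lambda>f x. a * S f x)"
    using False by (simp add: norm_divide field_simps)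
  with opnorm_scale_le[OF S, of a] show ?thesis by simp
qed

global_interpretation bop: seminormed_complex_algebra "bop_norm :: 'd::finite bop \<Rightarrow> real" bop_scalar
proof
  fix x y :: "'d bop" and a b :: complex
  show "bop_norm (x + y) \<le> bop_norm x + bop_norm y"
  proof transfer
    fix S T :: "'d fn \<Rightarrow> 'd fn"
    assume "op_eq S S" "op_eq T T"
    then have b: "bounded_op S" "bounded_op T" by (auto dest: op_eqD)
    show "opnorm (\<lambda>f x. S f x + T f x) \<le> opnorm S + opnorm T"
    proof (rule opnorm_le)
      fix f :: "'d fn" assume f: "f \<in> L2"
      have "l2norm (\<lambda>x. S f x + T f x) \<le> l2norm (S f) + l2norm (T f)"
        by (rule l2norm_triangle[OF bounded_opD(1)[OF b(1) f] bounded_opD(1)[OF b(2) f]])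
      also have "\<dots> \<le> opnorm S * l2norm f + opnorm T * l2norm f"
        using f b by (intro add_mono l2norm_le_opnorm)
      finally show "l2norm (\<lambda>x. S f x + T f x) \<le> (opnorm S + opnorm T) * l2norm f" by (simp add: distrib_right)
    qed (simp add: opnorm_nonneg b)
  qed
  show "bop_norm (x * y) \<le> bop_norm x * bop_norm y"
  proof transfer
    fix S T :: "'d fn \<Rightarrow> 'd fn"
    assume "op_eq S S" "op_eq T T"
    then have b: "bounded_op S" "bounded_op T" by (auto dest: op_eqD)
    show "opnorm (\<lambda>f. S (T f)) \<le> opnorm S * opnorm T"
    proof (rule opnorm_le)
      fix f :: "'d fn" assume f: "f \<in> L2"
      have "l2norm (S (T f)) \<le> opnorm S * l2norm (T f)"
        by (rule l2norm_le_opnorm[OF b(1) bounded_opD(1)[OF b(2) f]])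
      also have "\<dots> \<le> opnorm S * (opnorm T * l2norm f)"
        using f b by (intro mult_left_mono l2norm_le_opnorm opnorm_nonneg)
      finally show "l2norm (S (T f)) \<le> opnorm S * opnorm T * l2norm f" by (simp add: mult.assoc)
    qed (simp add: opnorm_nonneg b)
  qed
  show "bop_norm (1 :: 'd bop) = 1"
  proof transfer
    obtain f :: "'d fn" where f: "f \<in> L2" "l2norm f = 1" using exists_l2norm_1 by blast
    then have "1 \<le> opnorm (\<lambda>f::'d fn. f)" using l2norm_le_opnorm[OF bounded_op_id f(1)] by simp
    moreover have "opnorm (\<lambda>f::'d fn. f) \<le> 1" by (rule opnorm_le) auto
    ultimately show "opnorm (\<lambda>f::'d fn. f) = 1" by simp
  qed
  show "bop_norm (bop_scalar a * x) = cmod a * bop_norm x"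
    by transfer (rule opnorm_scale[OF op_eqD(1)])
  note sc = bounded_op_scale[OF bounded_op_id]
  show "bop_scalar (a + b) = (bop_scalar a + bop_scalar b :: 'd bop)"
    by transfer (use op_eq_refl[OF bounded_op_add[OF sc sc]] in \<open>simp add: distrib_right\<close>)
  show "bop_scalar (a * b) = (bop_scalar a * bop_scalar b :: 'd bop)"
    by transfer (use op_eq_refl[OF sc] in \<open>simp add: mult.assoc[symmetric]\<close>)
  show "bop_scalar 1 = (1 :: 'd bop)"
    by transfer (simp add: op_eq_refl bounded_op_id)
  show "bop_scalar a * x = x * bop_scalar a"
  proof transfer
    fix S :: "'d fn \<Rightarrow> 'd fn" and a
    assume "op_eq S S"
    then have S: "bounded_op S" by (rule op_eqD)
    show "op_eq (\<lambda>f x. a * S f x) (\<lambda>f. S (\<lambda>x. a * f x))"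
    proof (rule op_eqI)
      fix f :: "'d fn" assume f: "f \<in> L2"
      have "l2eq (S (\<lambda>x. a * f x + 0 * f x)) (\<lambda>x. a * S f x + 0 * S f x)"
        by (rule bounded_opD(3)[OF S f f])
      then show "l2eq (\<lambda>x. a * S f x) (S (\<lambda>x. a * f x))" by (simp add: l2eq_sym)
    qed (rule bounded_op_scale[OF S] bounded_op_comp[OF S sc])+
  qed
qed

text \<open>On classes modulo null sets the seminorm is a norm, so an identity between operators may
  be proved up to errors tending to 0.\<close>

lemma bop_norm_eq_0_imp:
  assumes "bop_norm x = 0" shows "x = 0"
  using assms
proof transfer
  fix S :: "'a fn \<Rightarrow> 'a fn"
  assume "op_eq S S" and 0: "opnorm S = 0"
  then have S: "bounded_op S" by (auto dest: op_eqD)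
  show "op_eq S (\<lambda>f x. 0)"
  proof (rule op_eqI[OF S bounded_op_zero])
    fix f :: "'a fn" assume f: "f \<in> L2"
    then have "l2norm (S f) \<le> 0" using l2norm_le_opnorm[OF S f] 0 by simp
    then show "l2eq (S f) (\<lambda>x. 0)" using l2norm_nonneg[of "S f"] bounded_opD(1)[OF S f]
      by (intro l2norm_eq_0_imp) auto
  qed
qed

section \<open>Coefficients are bounded by the operator norm\<close>

abbreviation l1 :: "('a \<Rightarrow> complex) \<Rightarrow> bool" where
  "l1 c \<equiv> (\<lambda>lam. cmod (c lam)) summable_on UNIV"

definition tfop :: "('d::finite phase \<Rightarrow> complex) \<Rightarrow> 'd bop" where
  "tfop c = abs_bop (tf_op c)"

lemma abs_bop_eq_iff:
  "bounded_op S \<Longrightarrow> bounded_op T \<Longrightarrow> abs_bop S = abs_bop T \<longleftrightarrow> (\<forall>f\<in>L2. l2eq (S f) (T f))"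
  using Quotient3_rel[OF Quotient3_bop, of S T] by (simp add: op_eq_def)

lemma exists_abs_bop: "\<exists>S. bounded_op S \<and> x = abs_bop S"
  using Quotient3_abs_rep[OF Quotient3_bop, of x] Quotient3_rep_reflp[OF Quotient3_bop, of x] op_eqD(1) by metis

lemma l1_scale: "l1 c \<Longrightarrow> l1 (\<lambda>lam. a * c lam)"
  by (simp add: norm_mult summable_on_cmult_right)

lemma l1_add: "l1 c \<Longrightarrow> l1 d \<Longrightarrow> l1 (\<lambda>lam. c lam + d lam)"
  using summable_on_add[of "\<lambda>lam. cmod (c lam)" UNIV "\<lambda>lam. cmod (d lam)"]
  by (rule summable_on_comparison_test) (auto intro: norm_triangle_ineq)

lemma l1_finite_support:
  assumes "finite S" "\<And>lam. lam \<notin> S \<Longrightarrow> c lam = 0" shows "l1 c"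
proof -
  have "(\<lambda>lam. cmod (c lam)) summable_on S" using assms(1) by simp
  then show ?thesis using summable_on_support(1)[of S "\<lambda>lam. cmod (c lam)"] assms(2) by simp
qed

lemma l1_delta: "l1 (delta \<mu>)"
  by (rule l1_finite_support[of "{\<mu>}"]) (auto simp: delta_def)

lemma tfop_add:
  assumes "l1 c" "l1 d" shows "tfop (\<lambda>lam. c lam + d lam) = tfop c + tfop d"
  unfolding tfop_def
  by (subst plus_bop.abs_eq)
    (simp_all add: op_eq_refl bounded_op_tf_op assms abs_bop_eq_iff l1_add bounded_op_add tf_op_add)

lemma tfop_scale:
  assumes "l1 c" shows "tfop (\<lambda>lam. a * c lam) = bop_scalar a * tfop c"
  unfolding tfop_def bop_scalar.abs_eq
  by (subst times_bop.abs_eq)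
    (simp_all add: op_eq_refl bounded_op_tf_op assms tf_op_scale[abs_def] bounded_op_scale[OF bounded_op_id])

lemma tfop_tconv:
  assumes "l1 c" "l1 d" shows "tfop (tconv c d) = tfop c * tfop d"
  unfolding tfop_def
  by (subst times_bop.abs_eq)
    (simp_all add: op_eq_refl bounded_op_tf_op assms abs_bop_eq_iff tconv_summable
      bounded_op_comp[OF bounded_op_tf_op bounded_op_tf_op] tf_op_tconv l2eq_sym)

lemma bop_norm_tfop:
  assumes "l1 c" shows "bop_norm (tfop c) \<le> (\<Sum>\<^sub>\<infinity>lam. cmod (c lam))"
  unfolding tfop_def
  by (subst bop_norm.abs_eq)
    (auto simp: op_eq_refl bounded_op_tf_op assms intro!: opnorm_le tf_op_bound infsum_nonneg)

lemma tfop_delta_0: "tfop (delta 0) = 1"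
  unfolding tfop_def one_bop.abs_eq
  by (subst abs_bop_eq_iff) (auto simp: bounded_op_tf_op l1_delta bounded_op_id tf_op_delta tfs_def)

lemma infsum_delta: "(\<Sum>\<^sub>\<infinity>lam. cmod (delta \<mu> lam)) = 1"
  using summable_on_support(2)[of "{\<mu>}" "\<lambda>lam. cmod (delta \<mu> lam)"] by (simp add: delta_def)

definition U :: "'d::finite phase \<Rightarrow> 'd bop" where
  "U \<mu> = tfop (delta \<mu>)"

lemma U_zero: "U 0 = 1"
  by (simp add: U_def tfop_delta_0)

lemma bop_norm_U: "bop_norm (U \<mu>) \<le> 1"
  using bop_norm_tfop[OF l1_delta, of \<mu>] by (simp add: U_def infsum_delta)

lemma tconv_scaled_delta:
  "tconv (\<lambda>lam. a * delta \<mu> lam) X lam = a * X (lam - \<mu>) * phase_factor \<mu> (lam - \<mu>)"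
proof -
  have "tconv (\<lambda>lam. a * delta \<mu> lam) X lam
      = (\<Sum>\<^sub>\<infinity>\<nu>\<in>{\<mu>}. a * delta \<mu> \<nu> * X (lam - \<nu>) * phase_factor \<nu> (lam - \<nu>))"
    unfolding tconv_def by (rule infsum_cong_neutral) (auto simp: delta_def)
  then show ?thesis by (simp add: delta_def)
qed

lemma tfop_shift:
  assumes "l1 X"
  shows "tfop (\<lambda>lam. a * X (lam - \<mu>) * phase_factor \<mu> (lam - \<mu>)) = bop_scalar a * U \<mu> * tfop X"
proof -
  have "(\<lambda>lam. a * X (lam - \<mu>) * phase_factor \<mu> (lam - \<mu>)) = tconv (\<lambda>lam. a * delta \<mu> lam) X"
    by (simp add: tconv_scaled_delta fun_eq_iff)
  then show ?thesis
    by (simp add: tfop_tconv l1_scale l1_delta assms tfop_scale U_def)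
qed

lemma U_mult: "U \<mu> * U \<nu> = bop_scalar (phase_factor \<mu> \<nu>) * U (\<mu> + \<nu>)"
proof -
  have "U \<mu> * U \<nu> = tfop (\<lambda>lam. 1 * delta \<nu> (lam - \<mu>) * phase_factor \<mu> (lam - \<mu>))"
    by (subst tfop_shift) (simp_all add: l1_delta bop.sc_one U_def)
  also have "(\<lambda>lam. 1 * delta \<nu> (lam - \<mu>) * phase_factor \<mu> (lam - \<mu>)) = (\<lambda>lam. phase_factor \<mu> \<nu> * delta (\<mu> + \<nu>) lam)"
    by (auto simp: delta_def fun_eq_iff algebra_simps)
  finally show ?thesis by (simp add: tfop_scale l1_delta U_def)
qed

lemma U_commute:
  "U \<mu> * U \<nu> = bop_scalar (cis (snd \<mu> \<bullet> fst \<nu> - snd \<nu> \<bullet> fst \<mu>)) * (U \<nu> * U \<mu>)"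
proof -
  have "cis (snd \<mu> \<bullet> fst \<nu> - snd \<nu> \<bullet> fst \<mu>) * phase_factor \<nu> \<mu> = phase_factor \<mu> \<nu>"
    by (simp add: phase_factor_def cis_mult)
  then show ?thesis unfolding U_mult
    by (simp add: mult.assoc[symmetric] add.commute flip: bop.sc_mult)
qed

text \<open>\<open>U (- \<mu>)\<close> inverts \<open>U \<mu>\<close> only up to a phase; the scalar
  corrects it.\<close>

definition U_inv :: "'d::finite phase \<Rightarrow> 'd bop" where
  "U_inv \<mu> = bop_scalar (1 / phase_factor \<mu> (- \<mu>)) * U (- \<mu>)"

lemma U_U_inv: "U \<mu> * U_inv \<mu> = 1"
proof -
  have "U \<mu> * U_inv \<mu> = bop_scalar (1 / phase_factor \<mu> (- \<mu>)) * (U \<mu> * U (- \<mu>))"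
    unfolding U_inv_def by (metis bop.sc_commute mult.assoc)
  also have "\<dots> = 1"
    unfolding U_mult by (simp add: mult.assoc[symmetric] U_zero bop.sc_one phase_factor_def flip: bop.sc_mult)
  finally show ?thesis .
qed

lemma bop_norm_U_inv: "bop_norm (U_inv \<mu>) \<le> 1"
  unfolding U_inv_def bop.N_sc using bop_norm_U[of "- \<mu>"] by (simp add: norm_divide)

text \<open>The exponent is a symplectic pairing. The witness is \<open>lam\<close> turned by the
  symplectic matrix and scaled so that the pairing equals \<open>pi\<close>.\<close>

lemma exists_anticommuting_shift:
  fixes lam :: "'d::finite phase"
  assumes "lam \<noteq> 0"
  shows "\<exists>\<mu>. cis (snd \<mu> \<bullet> fst lam - snd lam \<bullet> fst \<mu>) = - 1"
proof -
  define r where "r = pi / (fst lam \<bullet> fst lam + snd lam \<bullet> snd lam)"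
  have "fst lam \<bullet> fst lam + snd lam \<bullet> snd lam \<noteq> 0"
    using assms by (metis add_nonneg_eq_0_iff inner_eq_zero_iff inner_ge_zero prod.collapse zero_prod_def)
  then have "r * (fst lam \<bullet> fst lam) + r * (snd lam \<bullet> snd lam) = pi"
    unfolding r_def distrib_left[symmetric] by simp
  then show ?thesis
    by (intro exI[of _ "(- r *\<^sub>R snd lam, r *\<^sub>R fst lam)"]) simp
qed

text \<open>Conjugating by a shift that anticommutes with \<open>U (lam - lam0)\<close> and averaging removes the
  term at \<open>lam\<close>, keeps the one at \<open>lam0\<close>, and does not increase the norm.\<close>

lemma coefficient_le_bop_norm_sum:
  assumes "finite A" "lam0 \<notin> A"
  shows "cmod a \<le> bop_norm (bop_scalar a * U lam0 + (\<Sum>lam\<in>A. bop_scalar (c lam) * U lam))"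
  using assms
proof (induction A arbitrary: c rule: finite_induct)
  case empty
  have "cmod a = bop_norm (bop_scalar a * (U lam0 * U_inv lam0))"
    by (simp add: U_U_inv bop.N_of_sc)
  also have "\<dots> = bop_norm ((bop_scalar a * U lam0) * U_inv lam0)" by (simp add: mult.assoc)
  also have "\<dots> \<le> bop_norm (bop_scalar a * U lam0) * 1"
    by (rule bop.N_mult_le[OF order_refl bop_norm_U_inv])
  finally show ?case by simp
next
  case (insert lam1 A)
  obtain \<mu> :: "'a phase" where \<mu>: "cis (snd \<mu> \<bullet> fst (lam1 - lam0) - snd (lam1 - lam0) \<bullet> fst \<mu>) = - 1"
    using exists_anticommuting_shift[of "lam1 - lam0"] insert by auto
  \<comment> \<open>\<open>\<kappa>\<close> is a character of phase space, so its values at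
    \<open>lam1\<close> and \<open>lam0\<close> have ratio \<open>\<kappa> (lam1 - lam0)\<close>,
    which is -1.\<close>
  define \<kappa> where "\<kappa> lam = cis (snd \<mu> \<bullet> fst lam - snd lam \<bullet> fst \<mu>)" for lam
  have \<kappa>1: "cmod (\<kappa> lam) = 1" "\<kappa> lam \<noteq> 0" for lam by (simp_all add: \<kappa>_def)
  have "\<kappa> lam1 = \<kappa> (lam1 - lam0) * \<kappa> lam0"
    by (simp add: \<kappa>_def cis_mult inner_diff_left inner_diff_right algebra_simps)
  then have \<kappa>eq: "\<kappa> lam1 = - \<kappa> lam0" using \<mu> by (simp add: \<kappa>_def)
  have conj: "U \<mu> * (bop_scalar b * U lam) * U_inv \<mu> = bop_scalar (\<kappa> lam * b) * U lam" for b lam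
  proof -
    have "U \<mu> * (bop_scalar b * U lam) * U_inv \<mu> = bop_scalar b * (U \<mu> * U lam) * U_inv \<mu>"
      by (metis bop.sc_commute mult.assoc)
    also have "\<dots> = bop_scalar (b * \<kappa> lam) * U lam * (U \<mu> * U_inv \<mu>)"
      unfolding U_commute[of \<mu> lam] \<kappa>_def by (simp add: mult.assoc bop.sc_mult)
    finally show ?thesis by (simp add: U_U_inv mult.commute)
  qed
  define Y where "Y = bop_scalar a * U lam0 + (\<Sum>lam\<in>insert lam1 A. bop_scalar (c lam) * U lam)"
  \<comment> \<open>The multiplier is 1 at \<open>lam0\<close> and 0 at \<open>lam1\<close>. The
    induction hypothesis covers all coefficient families, so its effect at other points is
    immaterial.\<close>
  define c' where "c' lam = (1 + \<kappa> lam / \<kappa> lam0) / 2 * c lam" for lam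
  have Yc: "U \<mu> * Y * U_inv \<mu> = bop_scalar (\<kappa> lam0 * a) * U lam0 + (\<Sum>lam\<in>insert lam1 A. bop_scalar (\<kappa> lam * c lam) * U lam)"
    unfolding Y_def by (simp only: distrib_left distrib_right sum_distrib_left sum_distrib_right conj)
  have avg: "bop_scalar (1/2) * (Y + bop_scalar (1 / \<kappa> lam0) * (U \<mu> * Y * U_inv \<mu>))
      = bop_scalar a * U lam0 + (\<Sum>lam\<in>A. bop_scalar (c' lam) * U lam)"
  proof -
    have 1: "bop_scalar (1/2) * (bop_scalar b * x + bop_scalar (1 / \<kappa> lam0) * (bop_scalar (\<kappa> lam * b) * x))
        = bop_scalar ((1 + \<kappa> lam / \<kappa> lam0) / 2 * b) * x" for b lam and x :: "'a bop"
      by (simp add: mult.assoc[symmetric] distrib_right[symmetric] field_simps flip: bop.sc_mult bop.sc_add)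
    have "bop_scalar (1/2) * (Y + bop_scalar (1 / \<kappa> lam0) * (U \<mu> * Y * U_inv \<mu>))
      = bop_scalar (1/2) * (bop_scalar a * U lam0 + bop_scalar (1 / \<kappa> lam0) * (bop_scalar (\<kappa> lam0 * a) * U lam0))
       + (\<Sum>lam\<in>insert lam1 A. bop_scalar (1/2) * (bop_scalar (c lam) * U lam + bop_scalar (1 / \<kappa> lam0) * (bop_scalar (\<kappa> lam * c lam) * U lam)))"
      unfolding Yc unfolding Y_def by (simp only: distrib_left sum_distrib_left sum.distrib add_ac)
    also have "\<dots> = bop_scalar a * U lam0 + (\<Sum>lam\<in>insert lam1 A. bop_scalar (c' lam) * U lam)"
      unfolding 1 c'_def using \<kappa>1(2)[of lam0] by simp
    also have "c' lam1 = 0" unfolding c'_def \<kappa>eq using \<kappa>1(2)[of lam0] by simp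
    then have "(\<Sum>lam\<in>insert lam1 A. bop_scalar (c' lam) * U lam) = (\<Sum>lam\<in>A. bop_scalar (c' lam) * U lam)"
      using insert by (simp add: bop.sc_zero)
    finally show ?thesis .
  qed
  have "cmod a \<le> bop_norm (bop_scalar a * U lam0 + (\<Sum>lam\<in>A. bop_scalar (c' lam) * U lam))"
    using insert by auto
  also have "\<dots> = 1/2 * bop_norm (Y + bop_scalar (1 / \<kappa> lam0) * (U \<mu> * Y * U_inv \<mu>))"
    unfolding avg[symmetric] by (simp add: bop.N_sc)
  also have "\<dots> \<le> 1/2 * (bop_norm Y + bop_norm (U \<mu> * Y * U_inv \<mu>))"
    using bop.N_add[of Y "bop_scalar (1 / \<kappa> lam0) * (U \<mu> * Y * U_inv \<mu>)"]
    by (simp add: bop.N_sc norm_divide \<kappa>1)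
  also have "bop_norm (U \<mu> * Y * U_inv \<mu>) \<le> 1 * bop_norm Y * 1"
    by (intro bop.N_mult_le bop_norm_U bop_norm_U_inv order_refl)
  finally show ?case unfolding Y_def by simp
qed

lemma tfop_finite_sum:
  assumes "finite S"
  shows "tfop (\<lambda>lam. if lam \<in> S then X lam else 0) = (\<Sum>lam\<in>S. bop_scalar (X lam) * U lam)"
  using assms
proof (induction S rule: finite_induct)
  case empty
  have "tfop (\<lambda>lam. 0 * delta 0 lam) = (0 :: 'a bop)"
    by (subst tfop_scale) (auto simp: l1_delta bop.sc_zero)
  then show ?case by simp
next
  case (insert \<mu> S)
  have "(\<lambda>lam. if lam \<in> insert \<mu> S then X lam else 0)
      = (\<lambda>lam. X \<mu> * delta \<mu> lam + (if lam \<in> S then X lam else 0))"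
    using insert by (auto simp: delta_def fun_eq_iff)
  moreover have "l1 (\<lambda>lam. if lam \<in> S then X lam else 0)"
    by (rule l1_finite_support[of S]) (use insert in auto)
  ultimately show ?case
    using insert by (simp add: tfop_add l1_scale l1_delta tfop_scale U_def)
qed

lemma coefficient_le_bop_norm:
  assumes S: "finite S" "\<And>lam. lam \<notin> S \<Longrightarrow> X lam = 0"
  shows "cmod (X lam0) \<le> bop_norm (tfop X)"
proof -
  have "X = (\<lambda>lam. if lam \<in> insert lam0 S then X lam else 0)" using S by auto
  then have "tfop X = (\<Sum>lam\<in>insert lam0 S. bop_scalar (X lam) * U lam)"
    using tfop_finite_sum[of "insert lam0 S" X] S by simp
  also have "\<dots> = bop_scalar (X lam0) * U lam0 + (\<Sum>lam\<in>S - {lam0}. bop_scalar (X lam) * U lam)"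
    using S by (subst sum.insert_remove) auto
  finally show ?thesis using coefficient_le_bop_norm_sum[of "S - {lam0}" lam0 "X lam0" X] S by simp
qed

section \<open>Grids, weights and decompositions\<close>

text \<open>Each multiplicity is bounded by \<open>n\<close> separately, not their sum; the box is
  larger than the set reached by words of length \<open>n\<close> but still polynomial in
  \<open>n\<close>. Extensional functions make it finite.\<close>

definition grid :: "'a::real_vector set \<Rightarrow> nat \<Rightarrow> 'a set" where
  "grid \<Lambda> n = (\<lambda>k. \<Sum>lam\<in>\<Lambda>. real (k lam) *\<^sub>R lam) ` (\<Lambda> \<rightarrow>\<^sub>E {..n})"

lemma gridI: "k \<in> \<Lambda> \<rightarrow>\<^sub>E {..n} \<Longrightarrow> (\<Sum>lam\<in>\<Lambda>. real (k lam) *\<^sub>R lam) \<in> grid \<Lambda> n"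
  unfolding grid_def by (rule imageI)

lemma finite_grid: "finite \<Lambda> \<Longrightarrow> finite (grid \<Lambda> n)"
  unfolding grid_def by (intro finite_imageI finite_PiE) auto

lemma card_grid: "finite \<Lambda> \<Longrightarrow> card (grid \<Lambda> n) \<le> (n + 1) ^ card \<Lambda>"
proof -
  assume fin: "finite \<Lambda>"
  have "card (grid \<Lambda> n) \<le> card (\<Lambda> \<rightarrow>\<^sub>E {..n})"
    unfolding grid_def by (intro card_image_le finite_PiE fin) auto
  also have "\<dots> = (n + 1) ^ card \<Lambda>" using fin by (simp add: card_PiE)
  finally show ?thesis .
qed

lemma grid_mono: "n \<le> m \<Longrightarrow> grid \<Lambda> n \<subseteq> grid \<Lambda> m"
  unfolding grid_def by (intro image_mono PiE_mono) auto

lemma zero_in_grid: "0 \<in> grid \<Lambda> n"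
  using gridI[of "\<lambda>lam\<in>\<Lambda>. 0" \<Lambda> n] by simp

lemma grid_add:
  assumes "finite \<Lambda>" "\<mu> \<in> \<Lambda>" "s \<in> grid \<Lambda> n"
  shows "\<mu> + s \<in> grid \<Lambda> (Suc n)"
proof -
  obtain k where k: "k \<in> \<Lambda> \<rightarrow>\<^sub>E {..n}" "s = (\<Sum>lam\<in>\<Lambda>. real (k lam) *\<^sub>R lam)"
    using assms(3) by (auto simp: grid_def)
  define k' where "k' = k(\<mu> := Suc (k \<mu>))"
  have 1: "k' \<in> \<Lambda> \<rightarrow>\<^sub>E {..Suc n}"
    using k(1) assms(2) unfolding k'_def by (auto simp: PiE_iff extensional_def le_Suc_eq)
  have 2: "(\<Sum>lam\<in>\<Lambda>. real (k' lam) *\<^sub>R lam) = \<mu> + s"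
  proof -
    have "(\<Sum>lam\<in>\<Lambda>. real (k' lam) *\<^sub>R lam) = (\<Sum>lam\<in>\<Lambda>. (if lam = \<mu> then \<mu> else 0) + real (k lam) *\<^sub>R lam)"
      by (intro sum.cong) (auto simp: k'_def scaleR_add_left)
    also have "\<dots> = \<mu> + s" using assms(1,2) by (simp add: sum.distrib k(2))
    finally show ?thesis .
  qed
  show ?thesis using gridI[OF 1] unfolding 2 .
qed

lemma norm_grid:
  fixes \<Lambda> :: "'a::real_normed_vector set"
  assumes "s \<in> grid \<Lambda> n"
  shows "norm s \<le> real n * (\<Sum>lam\<in>\<Lambda>. norm lam)"
proof -
  obtain k where k: "k \<in> \<Lambda> \<rightarrow>\<^sub>E {..n}" "s = (\<Sum>lam\<in>\<Lambda>. real (k lam) *\<^sub>R lam)"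
    using assms by (auto simp: grid_def)
  have "norm s \<le> (\<Sum>lam\<in>\<Lambda>. norm (real (k lam) *\<^sub>R lam))" unfolding k(2) by (rule norm_sum)
  also have "\<dots> \<le> (\<Sum>lam\<in>\<Lambda>. real n * norm lam)"
    using k(1) by (intro sum_mono) (auto simp: PiE_iff intro!: mult_right_mono)
  finally show ?thesis by (simp add: sum_distrib_left)
qed

section \<open>Weights and their radial majorant\<close>

lemma weightD:
  assumes "weight v"
  shows weight_nonneg: "0 \<le> v x" and weight_zero: "v 0 = 1" and weight_minus: "v (- x) = v x"
    and weight_mono: "0 \<le> r \<Longrightarrow> r \<le> s \<Longrightarrow> v (r *\<^sub>R x) \<le> v (s *\<^sub>R x)"
  using assms unfolding weight_def monotone_on_def by (simp_all del: split_paired_All)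

lemma weight_ge_1: "weight v \<Longrightarrow> 1 \<le> v x"
  using weight_mono[of v 0 1 x] weight_zero[of v] by simp

lemma weight_abs_le:
  assumes "weight v" "\<bar>r\<bar> \<le> s" shows "v (r *\<^sub>R x) \<le> v (s *\<^sub>R x)"
proof (cases "r \<ge> 0")
  case True
  then show ?thesis using weight_mono[OF assms(1)] assms(2) by simp
next
  case False
  then have "v ((- r) *\<^sub>R x) \<le> v (s *\<^sub>R x)" using assms by (intro weight_mono) auto
  then show ?thesis using weight_minus[OF assms(1), of "r *\<^sub>R x"] by simp
qed

lemma submultiplicative_sum:
  assumes "weight v" "submultiplicative v" "finite I"
  shows "v (\<Sum>i\<in>I. f i) \<le> (\<Prod>i\<in>I. v (f i))"
  using assms(3)
proof (induction I rule: finite_induct)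
  case (insert i I)
  have "v (f i + sum f I) \<le> v (f i) * v (sum f I)" using assms(2) unfolding submultiplicative_def by blast
  also have "\<dots> \<le> v (f i) * (\<Prod>i\<in>I. v (f i))" using insert weight_nonneg[OF assms(1)] by (intro mult_left_mono) auto
  finally show ?case using insert by simp
qed (simp add: weight_zero[OF assms(1)])

text \<open>This gives the supremum in \<open>w_of\<close> its meaning. Submultiplicativity reduces
  a vector to its coordinate components, where symmetry and radial monotonicity bound
  \<open>v\<close> without any continuity.\<close>

lemma weight_bdd_above_sphere:
  fixes v :: "'d::finite phase \<Rightarrow> real"
  assumes v: "weight v" "submultiplicative v"
  shows "bdd_above (v ` sphere 0 r)"
proof (rule bdd_aboveI2)
  fix x :: "'d phase" assume "x \<in> sphere 0 r"
  then have x: "norm x = r" by simp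
  have "v x = v (\<Sum>b\<in>Basis. (x \<bullet> b) *\<^sub>R b)" by (simp add: euclidean_representation)
  also have "\<dots> \<le> (\<Prod>b\<in>Basis. v ((x \<bullet> b) *\<^sub>R b))" by (rule submultiplicative_sum[OF v finite_Basis])
  also have "\<dots> \<le> (\<Prod>b\<in>Basis. v (r *\<^sub>R b))"
    by (intro prod_mono conjI weight_nonneg[OF v(1)] weight_abs_le[OF v(1)])
      (use x Basis_le_norm in auto)
  finally show "v x \<le> (\<Prod>b\<in>Basis. v (r *\<^sub>R b))" .
qed

text \<open>Radial monotonicity pushes \<open>x\<close> outwards to the sphere of radius
  \<open>r\<close>. The origin has no direction, so there \<open>v 0 = 1\<close> is compared with an
  arbitrary point of the sphere.\<close>

lemma weight_le_w_of:
  fixes v :: "'d::finite phase \<Rightarrow> real"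
  assumes v: "weight v" "submultiplicative v" and x: "norm x \<le> r"
  shows "v x \<le> w_of v r"
proof -
  have up: "v y \<le> w_of v r" if "norm y = r" for y
    unfolding w_of_def using that by (intro cSUP_upper weight_bdd_above_sphere[OF v]) auto
  show ?thesis
  proof (cases "x = 0")
    case True
    then have "0 \<le> r" using x by simp
    then obtain y :: "'d phase" where y: "norm y = r" using vector_choose_size by blast
    show ?thesis using weight_ge_1[OF v(1), of y] up[OF y] True weight_zero[OF v(1)] by simp
  next
    case False
    have "v (1 *\<^sub>R x) \<le> v ((r / norm x) *\<^sub>R x)"
      using x False by (intro weight_mono[OF v(1)]) (auto simp: field_simps)
    also have "\<dots> \<le> w_of v r" using False x norm_ge_zero[of x] by (intro up) (simp add: order_trans[of 0 "norm x"])
    finally show ?thesis by simp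
  qed
qed

text \<open>\<open>decomposes v \<Lambda> n X t\<close>: the coefficient family \<open>X\<close> is a sum of families \<open>Y\<close>, each supported in
  a translate \<open>g + grid \<Lambda> n\<close>, with \<open>v g\<close> times the operator norm of \<open>Y\<close> adding up to \<open>t\<close>.\<close>

inductive decomposes :: "('d::finite phase \<Rightarrow> real) \<Rightarrow> 'd phase set \<Rightarrow> nat \<Rightarrow> ('d phase \<Rightarrow> complex) \<Rightarrow> real \<Rightarrow> bool"
  for v \<Lambda> n where
  block: "decomposes v \<Lambda> n X t"
    if "\<And>lam. X lam \<noteq> 0 \<Longrightarrow> lam - g \<in> grid \<Lambda> n" "v g * bop_norm (tfop X) \<le> t"
| add: "decomposes v \<Lambda> n (\<lambda>lam. X lam + Y lam) (s + t)"
    if "decomposes v \<Lambda> n X s" "decomposes v \<Lambda> n Y t"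
| sum: "decomposes v \<Lambda> n X s"
    if "\<And>\<mu>. decomposes v \<Lambda> n (Y \<mu>) (t \<mu>)" "(t has_sum s) (UNIV :: 'd phase set)"
      "\<And>lam. ((\<lambda>\<mu>. Y \<mu> lam) has_sum X lam) UNIV"

lemma block_support:
  assumes "\<And>lam. X lam \<noteq> 0 \<Longrightarrow> lam - g \<in> grid \<Lambda> n" "lam \<notin> (+) g ` grid \<Lambda> n"
  shows "X lam = (0::complex)"
proof (rule ccontr)
  assume "X lam \<noteq> 0"
  then have "g + (lam - g) \<in> (+) g ` grid \<Lambda> n" by (intro imageI assms(1))
  with assms(2) show False by simp
qed

lemma decomposes_mono:
  assumes "decomposes v \<Lambda> n X t" "n \<le> m" shows "decomposes v \<Lambda> m X t"
  using assms(1)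
proof induction
  case (block X g t)
  then show ?case using grid_mono[OF assms(2)] by (intro decomposes.block[of X g]) auto
next
  case (add X s Y t)
  show ?case by (rule decomposes.add[OF add.IH])
next
  case (sum Y t s X)
  show ?case by (rule decomposes.sum[OF sum.IH sum.hyps(2,3)])
qed

lemma has_sum_finite_sum:
  fixes f :: "'i \<Rightarrow> 'j \<Rightarrow> 'a::{topological_comm_monoid_add}"
  assumes "finite F" "\<And>j. j \<in> F \<Longrightarrow> ((\<lambda>i. f i j) has_sum s j) A"
  shows "((\<lambda>i. \<Sum>j\<in>F. f i j) has_sum (\<Sum>j\<in>F. s j)) A"
  using assms
proof (induction F rule: finite_induct)
  case empty
  show ?case by (simp add: has_sum_0)
next
  case (insert j F)
  then have "((\<lambda>i. f i j + (\<Sum>j\<in>F. f i j)) has_sum (s j + (\<Sum>j\<in>F. s j))) A"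
    by (intro has_sum_add) simp_all
  then show ?case using insert.hyps by simp
qed

lemma weighted_summable:
  fixes Y :: "'i \<Rightarrow> 'j \<Rightarrow> complex"
  assumes v: "\<And>lam. 1 \<le> v lam"
    and b: "\<And>i F. finite F \<Longrightarrow> (\<Sum>lam\<in>F. v lam * cmod (Y i lam)) \<le> b i" "b summable_on UNIV"
  shows "(\<lambda>i. v lam * cmod (Y i lam)) summable_on UNIV" and "(\<lambda>i. cmod (Y i lam)) summable_on UNIV"
proof -
  show 1: "(\<lambda>i. v lam * cmod (Y i lam)) summable_on UNIV"
    using b(1)[of "{lam}"] v[of lam] by (intro summable_on_comparison_test[OF b(2)]) auto
  show "(\<lambda>i. cmod (Y i lam)) summable_on UNIV"
    using v[of lam] by (intro summable_on_comparison_test[OF 1]) (auto simp: mult_le_cancel_right1)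
qed

text \<open>All bounds are on finite sets \<open>F\<close>, so weighted summability of
  \<open>X\<close> comes out as a consequence, and only a finite sum is exchanged with an infinite
  one.\<close>

lemma weighted_sum_le:
  fixes Y :: "'i \<Rightarrow> 'j \<Rightarrow> complex"
  assumes v: "\<And>lam. 1 \<le> v lam"
    and b: "\<And>i F. finite F \<Longrightarrow> (\<Sum>lam\<in>F. v lam * cmod (Y i lam)) \<le> b i" "(b has_sum s) UNIV"
    and X: "\<And>lam. ((\<lambda>i. Y i lam) has_sum X lam) UNIV" and F: "finite F"
  shows "(\<Sum>lam\<in>F. v lam * cmod (X lam)) \<le> s"
proof -
  note s = weighted_summable[OF v b(1) has_sum_imp_summable[OF b(2)]]
  have "v lam * cmod (X lam) \<le> (\<Sum>\<^sub>\<infinity>i. v lam * cmod (Y i lam))" for lam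
  proof -
    have "cmod (X lam) \<le> (\<Sum>\<^sub>\<infinity>i. cmod (Y i lam))"
      using norm_infsum_bound[OF s(2)[of lam]] X[of lam] by (simp add: infsumI)
    then show ?thesis using v[of lam] by (simp add: infsum_cmult_right' mult_left_mono)
  qed
  then have "(\<Sum>lam\<in>F. v lam * cmod (X lam)) \<le> (\<Sum>lam\<in>F. \<Sum>\<^sub>\<infinity>i. v lam * cmod (Y i lam))"
    by (intro sum_mono)
  also have "\<dots> \<le> s"
    by (rule has_sum_mono[OF has_sum_finite_sum[OF F has_sum_infsum[OF s(1)]] b(2)]) (use b(1)[OF F] in auto)
  finally show ?thesis .
qed

lemma weighted_boundD:
  assumes v: "\<And>lam. 1 \<le> v lam" and B: "\<And>F. finite F \<Longrightarrow> (\<Sum>lam\<in>F. v lam * cmod (X lam)) \<le> B"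
  shows "(\<lambda>lam. v lam * cmod (X lam)) summable_on UNIV" and "l1 X" and "(\<Sum>\<^sub>\<infinity>lam. cmod (X lam)) \<le> B"
proof -
  have nn: "0 \<le> v lam * cmod (X lam)" for lam using v[of lam] by simp
  have le: "cmod (X lam) \<le> v lam * cmod (X lam)" for lam
    using v[of lam] by (simp add: mult_le_cancel_right1)
  show s: "(\<lambda>lam. v lam * cmod (X lam)) summable_on UNIV"
    by (rule nonneg_bounded_partial_sums_imp_summable_on[of _ _ B])
      (use nn B in \<open>auto intro!: eventually_finite_subsets_at_top_weakI\<close>)
  show l: "l1 X" by (rule summable_on_comparison_test[OF s]) (use le in auto)
  show "(\<Sum>\<^sub>\<infinity>lam. cmod (X lam)) \<le> B"
    by (rule infsum_le_finite_sums[OF l]) (rule order_trans[OF sum_mono[OF le] B])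
qed

text \<open>In a block every coefficient is at most the operator norm, its weight is at most
  \<open>v g\<close> times the weight on a ball, and the grid bounds the number of points. The
  resulting factor \<open>K\<close> depends on neither the block nor its translate, so the estimate
  survives finite and infinite sums.\<close>

lemma decomposes_bound:
  fixes v :: "'d::finite phase \<Rightarrow> real"
  assumes v: "weight v" "submultiplicative v" and \<Lambda>: "finite \<Lambda>"
    and X: "decomposes v \<Lambda> n X t"
  defines "K \<equiv> real ((n + 1) ^ card \<Lambda>) * w_of v (real n * (\<Sum>lam\<in>\<Lambda>. norm lam))"
  shows "0 \<le> t \<and> (\<forall>F. finite F \<longrightarrow> (\<Sum>lam\<in>F. v lam * cmod (X lam)) \<le> K * t)"
  using X
proof induction
  case (block X g t)
  let ?w = "w_of v (real n * (\<Sum>lam\<in>\<Lambda>. norm lam))" and ?S = "(+) g ` grid \<Lambda> n"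
  have S: "finite ?S" by (intro finite_imageI finite_grid \<Lambda>)
  have out: "X lam = 0" if "lam \<notin> ?S" for lam using block_support[OF block(1) that] .
  have N: "0 \<le> bop_norm (tfop X)" by (rule bop.N_nonneg)
  have t: "0 \<le> t" using block(2) weight_nonneg[OF v(1), of g] N by (meson mult_nonneg_nonneg order_trans)
  have w: "0 \<le> ?w" using weight_le_w_of[OF v, of 0 "real n * (\<Sum>lam\<in>\<Lambda>. norm lam)"] weight_zero[OF v(1)]
    by (simp add: sum_nonneg)
  have le: "v lam * cmod (X lam) \<le> ?w * t" if lam: "lam \<in> ?S" for lam
  proof -
    obtain s where s: "s \<in> grid \<Lambda> n" "lam = g + s" using lam by blast
    have "v lam \<le> v g * v s" using v(2) unfolding s(2) submultiplicative_def by blast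
    also have "\<dots> \<le> v g * ?w"
      by (intro mult_left_mono weight_le_w_of[OF v norm_grid[OF s(1)]] weight_nonneg[OF v(1)])
    finally have "v lam * cmod (X lam) \<le> (v g * ?w) * bop_norm (tfop X)"
      using w weight_nonneg[OF v(1)] by (intro mult_mono coefficient_le_bop_norm[OF S out]) auto
    also have "\<dots> = ?w * (v g * bop_norm (tfop X))" by simp
    also have "\<dots> \<le> ?w * t" using w block(2) by (rule mult_left_mono[rotated])
    finally show ?thesis .
  qed
  have "(\<Sum>lam\<in>F. v lam * cmod (X lam)) \<le> K * t" if F: "finite F" for F
  proof -
    have "(\<Sum>lam\<in>F. v lam * cmod (X lam)) = (\<Sum>lam\<in>F \<inter> ?S. v lam * cmod (X lam))"
      using F out by (intro sum.mono_neutral_right) auto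
    also have "\<dots> \<le> (\<Sum>lam\<in>F \<inter> ?S. ?w * t)" by (intro sum_mono le) auto
    also have "\<dots> = real (card (F \<inter> ?S)) * (?w * t)" by simp
    also have "\<dots> \<le> real ((n + 1) ^ card \<Lambda>) * (?w * t)"
    proof (intro mult_right_mono)
      have "card (F \<inter> ?S) \<le> card ?S" using S by (intro card_mono) auto
      also have "\<dots> \<le> card (grid \<Lambda> n)" by (intro card_image_le finite_grid \<Lambda>)
      also have "\<dots> \<le> (n + 1) ^ card \<Lambda>" by (rule card_grid[OF \<Lambda>])
      finally show "real (card (F \<inter> ?S)) \<le> real ((n + 1) ^ card \<Lambda>)" by (rule of_nat_mono)
    qed (use w t in auto)
    finally show ?thesis by (simp add: K_def mult.assoc)
  qed
  with t show ?case by blast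
next
  case (add X s Y t)
  have "(\<Sum>lam\<in>F. v lam * cmod (X lam + Y lam)) \<le> K * (s + t)" if F: "finite F" for F
  proof -
    have "(\<Sum>lam\<in>F. v lam * cmod (X lam + Y lam)) \<le> (\<Sum>lam\<in>F. v lam * cmod (X lam) + v lam * cmod (Y lam))"
      using weight_nonneg[OF v(1)]
      by (intro sum_mono) (simp add: distrib_left[symmetric] mult_left_mono norm_triangle_ineq)
    also have "\<dots> \<le> K * s + K * t" using add F by (simp add: sum.distrib add_mono)
    finally show ?thesis by (simp add: distrib_left)
  qed
  with add show ?case by auto
next
  case (sum Y t s X)
  have t: "0 \<le> t \<mu>" for \<mu> using sum.IH by blast
  have sF: "(\<Sum>lam\<in>F. v lam * cmod (Y \<mu> lam)) \<le> K * t \<mu>" if "finite F" for F \<mu> using sum.IH that by blast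
  have "(\<Sum>lam\<in>F. v lam * cmod (X lam)) \<le> K * s" if F: "finite F" for F
    by (rule weighted_sum_le[OF weight_ge_1[OF v(1)] sF has_sum_cmult_right[OF sum.hyps(2)] sum.hyps(3) F])
  moreover have "0 \<le> s" by (rule has_sum_nonneg[OF sum.hyps(2) t])
  ultimately show ?case by blast
qed

text \<open>A single term \<open>a U_\<mu>\<close> moves a block from \<open>g\<close> to
  \<open>\<mu> + g\<close>. Its weight is charged to the total by submultiplicativity, while the
  grid itself does not grow.\<close>

lemma decomposes_shift:
  fixes v :: "'d::finite phase \<Rightarrow> real"
  assumes v: "weight v" "submultiplicative v" and \<Lambda>: "finite \<Lambda>"
    and X: "decomposes v \<Lambda> n X t"
  shows "decomposes v \<Lambda> n (\<lambda>lam. a * X (lam - \<mu>) * phase_factor \<mu> (lam - \<mu>)) (cmod a * v \<mu> * t)"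
  using X
proof induction
  case (block X g t)
  have X1: "l1 X"
    by (rule l1_finite_support[of "(+) g ` grid \<Lambda> n"])
      (use block_support[OF block(1)] finite_grid[OF \<Lambda>] in auto)
  show ?case
  proof (rule decomposes.block[where g = "\<mu> + g"])
    fix lam assume "a * X (lam - \<mu>) * phase_factor \<mu> (lam - \<mu>) \<noteq> 0"
    then show "lam - (\<mu> + g) \<in> grid \<Lambda> n" using block(1)[of "lam - \<mu>"] by (simp add: diff_diff_eq)
  next
    have "bop_norm (tfop (\<lambda>lam. a * X (lam - \<mu>) * phase_factor \<mu> (lam - \<mu>))) \<le> cmod a * bop_norm (tfop X)"
    proof -
      have "bop_norm (U \<mu> * tfop X) \<le> 1 * bop_norm (tfop X)"
        by (rule bop.N_mult_le[OF bop_norm_U order_refl])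
      then show ?thesis unfolding tfop_shift[OF X1] unfolding mult.assoc bop.N_sc by (simp add: mult_left_mono)
    qed
    moreover have "v (\<mu> + g) \<le> v \<mu> * v g" using v(2) unfolding submultiplicative_def by blast
    ultimately have "v (\<mu> + g) * bop_norm (tfop (\<lambda>lam. a * X (lam - \<mu>) * phase_factor \<mu> (lam - \<mu>)))
        \<le> (v \<mu> * v g) * (cmod a * bop_norm (tfop X))"
      by (intro mult_mono bop.N_nonneg mult_nonneg_nonneg weight_nonneg[OF v(1)])
    also have "\<dots> = cmod a * v \<mu> * (v g * bop_norm (tfop X))" by simp
    also have "\<dots> \<le> cmod a * v \<mu> * t"
      by (intro mult_left_mono block(2) mult_nonneg_nonneg weight_nonneg[OF v(1)]) simp
    finally show "v (\<mu> + g) * bop_norm (tfop (\<lambda>lam. a * X (lam - \<mu>) * phase_factor \<mu> (lam - \<mu>)))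
        \<le> cmod a * v \<mu> * t" .
  qed
next
  case (add X s Y t)
  show ?case using decomposes.add[OF add.IH] by (simp add: algebra_simps)
next
  case (sum Y t s X)
  show ?case
    by (rule decomposes.sum[OF sum.IH has_sum_cmult_right[OF sum.hyps(2)]
          has_sum_cmult_left[OF has_sum_cmult_right[OF sum.hyps(3)]]])
qed

lemma decomposes_l1:
  assumes v: "weight v" "submultiplicative v" and \<Lambda>: "finite \<Lambda>" and X: "decomposes v \<Lambda> n X t"
  shows "l1 X"
  by (rule weighted_boundD(2)[OF weight_ge_1[OF v(1)] decomposes_bound[OF v \<Lambda> X, THEN conjunct2, rule_format]])

text \<open>Multiplication by the remainder is carried out term by term, each term being one shift;
  the masses add up to its weighted norm.\<close>

lemma decomposes_tconv:
  fixes v :: "'d::finite phase \<Rightarrow> real"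
  assumes v: "weight v" "submultiplicative v" and \<Lambda>: "finite \<Lambda>"
    and X: "decomposes v \<Lambda> n X t"
    and G: "(\<lambda>\<mu>. v \<mu> * cmod (G \<mu>)) summable_on UNIV" "l1 G"
  shows "decomposes v \<Lambda> n (tconv G X) ((\<Sum>\<^sub>\<infinity>\<mu>. v \<mu> * cmod (G \<mu>)) * t)"
proof (rule decomposes.sum[where Y = "\<lambda>\<mu> lam. G \<mu> * X (lam - \<mu>) * phase_factor \<mu> (lam - \<mu>)" and
      t = "\<lambda>\<mu>. cmod (G \<mu>) * v \<mu> * t"])
  show "decomposes v \<Lambda> n (\<lambda>lam. G \<mu> * X (lam - \<mu>) * phase_factor \<mu> (lam - \<mu>)) (cmod (G \<mu>) * v \<mu> * t)" for \<mu>
    by (rule decomposes_shift[OF v \<Lambda> X])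
  show "((\<lambda>\<mu>. cmod (G \<mu>) * v \<mu> * t) has_sum (\<Sum>\<^sub>\<infinity>\<mu>. v \<mu> * cmod (G \<mu>)) * t) UNIV"
    using has_sum_cmult_left[OF has_sum_infsum[OF G(1)], of t] by (simp add: mult.commute)
  fix lam
  have "(\<lambda>\<mu>. cmod (G \<mu>) * cmod (X (lam - \<mu>))) summable_on UNIV"
    by (rule tconv_summable(2)[OF G(2) decomposes_l1[OF v \<Lambda> X]])
  then have "(\<lambda>\<mu>. norm (G \<mu> * X (lam - \<mu>) * phase_factor \<mu> (lam - \<mu>))) summable_on UNIV"
    by (simp add: norm_mult)
  then show "((\<lambda>\<mu>. G \<mu> * X (lam - \<mu>) * phase_factor \<mu> (lam - \<mu>)) has_sum tconv G X lam) UNIV"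
    unfolding tconv_def by (rule has_sum_infsum[OF abs_summable_summable])
qed

section \<open>Words in a finite part and a remainder\<close>

lemma tconv_finite:
  assumes "finite \<Lambda>" "\<And>\<mu>. \<mu> \<notin> \<Lambda> \<Longrightarrow> F \<mu> = 0"
  shows "tconv F X lam = (\<Sum>\<mu>\<in>\<Lambda>. F \<mu> * X (lam - \<mu>) * phase_factor \<mu> (lam - \<mu>))"
proof -
  have "tconv F X lam = (\<Sum>\<^sub>\<infinity>\<mu>\<in>\<Lambda>. F \<mu> * X (lam - \<mu>) * phase_factor \<mu> (lam - \<mu>))"
    unfolding tconv_def by (rule infsum_cong_neutral) (use assms in auto)
  then show ?thesis using assms by simp
qed

lemma tconv_finite_add:
  assumes "finite \<Lambda>" "\<And>\<mu>. \<mu> \<notin> \<Lambda> \<Longrightarrow> F \<mu> = 0"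
  shows "tconv F (\<lambda>lam. X lam + Y lam) = (\<lambda>lam. tconv F X lam + tconv F Y lam)"
  by (rule ext) (simp add: tconv_finite[OF assms] algebra_simps sum.distrib)

lemma tconv_finite_has_sum:
  assumes "finite \<Lambda>" "\<And>\<mu>. \<mu> \<notin> \<Lambda> \<Longrightarrow> F \<mu> = 0"
    and "\<And>lam. ((\<lambda>i. Y i lam) has_sum X lam) I"
  shows "((\<lambda>i. tconv F (Y i) lam) has_sum tconv F X lam) I"
proof -
  have "((\<lambda>i. \<Sum>\<mu>\<in>\<Lambda>. F \<mu> * Y i (lam - \<mu>) * phase_factor \<mu> (lam - \<mu>))
      has_sum (\<Sum>\<mu>\<in>\<Lambda>. F \<mu> * X (lam - \<mu>) * phase_factor \<mu> (lam - \<mu>))) I"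
    by (rule has_sum_finite_sum[OF assms(1) has_sum_cmult_left[OF has_sum_cmult_right[OF assms(3)]]])
  then show ?thesis by (simp add: tconv_finite[OF assms(1,2)])
qed

lemma l1_funpow_tconv: "l1 F \<Longrightarrow> l1 X \<Longrightarrow> l1 ((tconv F ^^ m) X)"
  by (induction m) (simp_all add: tconv_summable(1))

lemma tfop_funpow_tconv: "l1 F \<Longrightarrow> l1 X \<Longrightarrow> tfop ((tconv F ^^ m) X) = tfop F ^ m * tfop X"
  by (induction m) (simp_all add: tfop_tconv l1_funpow_tconv mult.assoc)

lemma funpow_tconv_add:
  assumes "finite \<Lambda>" "\<And>\<mu>. \<mu> \<notin> \<Lambda> \<Longrightarrow> F \<mu> = 0"
  shows "(tconv F ^^ m) (\<lambda>lam. X lam + Y lam) = (\<lambda>lam. (tconv F ^^ m) X lam + (tconv F ^^ m) Y lam)"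
  by (induction m) (simp_all add: tconv_finite_add[OF assms])

lemma funpow_tconv_has_sum:
  assumes "finite \<Lambda>" "\<And>\<mu>. \<mu> \<notin> \<Lambda> \<Longrightarrow> F \<mu> = 0"
    and "\<And>lam. ((\<lambda>i. Y i lam) has_sum X lam) I"
  shows "((\<lambda>i. (tconv F ^^ m) (Y i) lam) has_sum (tconv F ^^ m) X lam) I"
proof (induction m arbitrary: lam)
  case (Suc m)
  show ?case
    unfolding funpow.simps o_apply by (rule tconv_finite_has_sum[OF assms(1,2) Suc])
qed (simp add: assms(3))

text \<open>A run of \<open>m\<close> letters from the finite part is applied as one operator, so it
  costs the operator norm of the power and not a power of the coefficient sum. Only the grid is
  enlarged, by one step per letter.\<close>

lemma decomposes_funpow_tconv:
  fixes v :: "'d::finite phase \<Rightarrow> real"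
  assumes v: "weight v" and \<Lambda>: "finite \<Lambda>" and F: "\<And>\<mu>. \<mu> \<notin> \<Lambda> \<Longrightarrow> F \<mu> = 0"
    and B: "bop_norm (tfop F ^ m) \<le> B"
    and X: "decomposes v \<Lambda> n X t"
  shows "decomposes v \<Lambda> (n + m) ((tconv F ^^ m) X) (B * t)"
  using X
proof induction
  case (block X g t)
  have X1: "l1 X"
    by (rule l1_finite_support[of "(+) g ` grid \<Lambda> n"])
      (use block_support[OF block(1)] finite_grid[OF \<Lambda>] in auto)
  have F1: "l1 F" by (rule l1_finite_support[OF \<Lambda> F])
  have B0: "0 \<le> B" using B bop.N_nonneg order_trans by blast
  show ?case
  proof (rule decomposes.block[where g = g])
    fix lam assume "(tconv F ^^ m) X lam \<noteq> 0"
    then show "lam - g \<in> grid \<Lambda> (n + m)"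
    proof (induction m arbitrary: lam)
      case 0
      then show ?case using block(1) by simp
    next
      case (Suc m)
      have "tconv F ((tconv F ^^ m) X) lam
          = (\<Sum>\<mu>\<in>\<Lambda>. F \<mu> * (tconv F ^^ m) X (lam - \<mu>) * phase_factor \<mu> (lam - \<mu>))"
        by (rule tconv_finite[OF \<Lambda> F])
      with Suc.prems have "(\<Sum>\<mu>\<in>\<Lambda>. F \<mu> * (tconv F ^^ m) X (lam - \<mu>) * phase_factor \<mu> (lam - \<mu>)) \<noteq> 0"
        by simp
      then obtain \<mu> where \<mu>: "\<mu> \<in> \<Lambda>" "F \<mu> * (tconv F ^^ m) X (lam - \<mu>) * phase_factor \<mu> (lam - \<mu>) \<noteq> 0"
        by (rule sum.not_neutral_contains_not_neutral)
      then have "lam - \<mu> - g \<in> grid \<Lambda> (n + m)" by (intro Suc.IH) simp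
      then have "\<mu> + (lam - \<mu> - g) \<in> grid \<Lambda> (Suc (n + m))" by (rule grid_add[OF \<Lambda> \<mu>(1)])
      then show ?case by simp
    qed
  next
    have "bop_norm (tfop ((tconv F ^^ m) X)) \<le> B * bop_norm (tfop X)"
      unfolding tfop_funpow_tconv[OF F1 X1] by (rule bop.N_mult_le[OF B order_refl])
    then have "v g * bop_norm (tfop ((tconv F ^^ m) X)) \<le> v g * (B * bop_norm (tfop X))"
      by (rule mult_left_mono[OF _ weight_nonneg[OF v]])
    also have "\<dots> = B * (v g * bop_norm (tfop X))" by simp
    also have "\<dots> \<le> B * t" by (rule mult_left_mono[OF block(2) B0])
    finally show "v g * bop_norm (tfop ((tconv F ^^ m) X)) \<le> B * t" .
  qed
next
  case (add X s Y t)
  show ?case using decomposes.add[OF add.IH] by (simp add: funpow_tconv_add[OF \<Lambda> F] distrib_left)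
next
  case (sum Y t s X)
  show ?case
    by (rule decomposes.sum[OF sum.IH has_sum_cmult_right[OF sum.hyps(2)] funpow_tconv_has_sum[OF \<Lambda> F sum.hyps(3)]])
qed

lemma tconv_add_left:
  assumes "l1 F" "l1 G" "l1 X"
  shows "tconv (\<lambda>\<mu>. F \<mu> + G \<mu>) X = (\<lambda>lam. tconv F X lam + tconv G X lam)"
proof
  fix lam
  have s: "(\<lambda>\<mu>. c \<mu> * X (lam - \<mu>) * phase_factor \<mu> (lam - \<mu>)) summable_on UNIV" if "l1 c" for c
  proof (rule abs_summable_summable)
    show "(\<lambda>\<mu>. norm (c \<mu> * X (lam - \<mu>) * phase_factor \<mu> (lam - \<mu>))) summable_on UNIV"
      using tconv_summable(2)[OF that assms(3), of lam] by (simp add: norm_mult)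
  qed
  show "tconv (\<lambda>\<mu>. F \<mu> + G \<mu>) X lam = tconv F X lam + tconv G X lam"
    unfolding tconv_def distrib_right by (rule infsum_add[OF s[OF assms(1)] s[OF assms(2)]])
qed

text \<open>The first factor of the remaining power is split into \<open>F\<close> and
  \<open>G\<close>. A letter \<open>F\<close> joins the pending run \<open>m\<close>; a letter
  \<open>G\<close> closes it. Thus \<open>C\<close> is paid once per run, the same bookkeeping as in
  \<open>perturbed_power_bound\<close>.\<close>

lemma decomposes_powers:
  fixes v :: "'d::finite phase \<Rightarrow> real"
  assumes v: "weight v" "submultiplicative v" and \<Lambda>: "finite \<Lambda>" and F: "\<And>\<mu>. \<mu> \<notin> \<Lambda> \<Longrightarrow> F \<mu> = 0"
    and G: "(\<lambda>\<mu>. v \<mu> * cmod (G \<mu>)) summable_on UNIV" "l1 G"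
    and FB: "\<And>m. bop_norm (tfop F ^ m) \<le> C * \<rho> ^ m"
  defines "c \<equiv> \<lambda>\<mu>. F \<mu> + G \<mu>" and "\<epsilon> \<equiv> \<Sum>\<^sub>\<infinity>\<mu>. v \<mu> * cmod (G \<mu>)"
  shows "decomposes v \<Lambda> (m + n) ((tconv F ^^ m) ((tconv c ^^ n) (delta 0))) (C * \<rho> ^ m * (\<rho> + C * \<epsilon>) ^ n)"
proof (induction n arbitrary: m)
  case 0
  have "decomposes v \<Lambda> 0 (delta 0) 1"
    by (rule decomposes.block[where g = 0])
      (auto simp: delta_def zero_in_grid weight_zero[OF v(1)] tfop_delta_0[unfolded delta_def] bop.N_one split: if_splits)
  from decomposes_funpow_tconv[OF v(1) \<Lambda> F FB this, of m] show ?case by simp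
next
  case (Suc n)
  define Z where "Z = (tconv c ^^ n) (delta 0)"
  have F1: "l1 F" by (rule l1_finite_support[OF \<Lambda> F])
  have Z: "decomposes v \<Lambda> n Z (C * (\<rho> + C * \<epsilon>) ^ n)" using Suc[of 0] unfolding Z_def by simp
  note Z1 = decomposes_l1[OF v \<Lambda> Z]
  have "(tconv c ^^ Suc n) (delta 0) = tconv c Z" by (simp add: Z_def)
  also have "\<dots> = (\<lambda>lam. tconv F Z lam + tconv G Z lam)"
    unfolding c_def by (rule tconv_add_left[OF F1 G(2) Z1])
  finally have "(tconv F ^^ m) ((tconv c ^^ Suc n) (delta 0))
      = (tconv F ^^ m) (\<lambda>lam. tconv F Z lam + tconv G Z lam)" by simp
  also have "\<dots> = (\<lambda>lam. (tconv F ^^ Suc m) Z lam + (tconv F ^^ m) (tconv G Z) lam)"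
    by (simp add: funpow_tconv_add[OF \<Lambda> F] funpow_swap1)
  finally have eq: "(tconv F ^^ m) ((tconv c ^^ Suc n) (delta 0))
      = (\<lambda>lam. (tconv F ^^ Suc m) Z lam + (tconv F ^^ m) (tconv G Z) lam)" .
  have 1: "decomposes v \<Lambda> (m + Suc n) ((tconv F ^^ Suc m) Z) (C * \<rho> ^ Suc m * (\<rho> + C * \<epsilon>) ^ n)"
    using Suc[of "Suc m"] unfolding Z_def by simp
  have "decomposes v \<Lambda> (n + m) ((tconv F ^^ m) (tconv G Z)) (C * \<rho> ^ m * (\<epsilon> * (C * (\<rho> + C * \<epsilon>) ^ n)))"
    unfolding \<epsilon>_def
    by (rule decomposes_funpow_tconv[OF v(1) \<Lambda> F FB decomposes_tconv[OF v \<Lambda> Z[unfolded \<epsilon>_def] G]])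
  \<comment> \<open>A letter from \<open>G\<close> merely translates blocks, so this term uses one
    grid step fewer than allowed.\<close>
  then have 2: "decomposes v \<Lambda> (m + Suc n) ((tconv F ^^ m) (tconv G Z)) (C * \<rho> ^ m * (\<epsilon> * (C * (\<rho> + C * \<epsilon>) ^ n)))"
    by (rule decomposes_mono) simp
  have "C * \<rho> ^ Suc m * (\<rho> + C * \<epsilon>) ^ n + C * \<rho> ^ m * (\<epsilon> * (C * (\<rho> + C * \<epsilon>) ^ n))
      = C * \<rho> ^ m * (\<rho> + C * \<epsilon>) ^ Suc n" by (simp add: algebra_simps)
  then show ?case using decomposes.add[OF 1 2] unfolding eq by simp
qed

section \<open>Inversion in the weighted algebra\<close>

lemma in_AvI:
  assumes "l1 c" "(\<lambda>lam. v lam * cmod (c lam)) summable_on UNIV" shows "in_Av v c"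
  unfolding in_Av_def using assms(2) summable_countable_real[OF assms(1)] by simp

lemma in_Av_l1:
  assumes "weight v" "in_Av v c" shows "l1 c"
proof (rule summable_on_comparison_test)
  show "(\<lambda>lam. v lam * cmod (c lam)) summable_on UNIV" using assms(2) by (simp add: in_Av_def)
  show "cmod (c lam) \<le> v lam * cmod (c lam)" for lam
    using weight_ge_1[OF assms(1), of lam] by (simp add: mult_le_cancel_right1)
qed simp

text \<open>Passing to the \<open>N\<close>-th root of \<open>q\<close> reduces the claim to a
  linear polynomial.\<close>

lemma eventually_poly_le_power:
  fixes q :: real
  assumes "1 < q"
  shows "\<forall>\<^sub>F n in sequentially. real ((n + 1) ^ N) \<le> q ^ n"
proof (cases "N = 0")
  case True
  then show ?thesis using assms by (simp add: one_le_power)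
next
  case False
  define r where "r = root N q"
  have r: "1 < r" "r ^ N = q" using False assms unfolding r_def by (auto simp: real_root_pow_pos2)
  have "(\<lambda>n. real n * (1 / r) ^ n + (1 / r) ^ n) \<longlonglongrightarrow> 0 + 0"
    by (intro tendsto_add powser_times_n_limit_0 LIMSEQ_realpow_zero) (use r in auto)
  then have "\<forall>\<^sub>F n in sequentially. real n * (1 / r) ^ n + (1 / r) ^ n < 1"
    by (intro order_tendstoD(2)[of _ "0 + 0"]) auto
  then show ?thesis
  proof eventually_elim
    case (elim n)
    then have "real n + 1 \<le> r ^ n" using r by (simp add: power_one_over field_simps)
    then have "(real n + 1) ^ N \<le> (r ^ n) ^ N" by (intro power_mono) auto
    also have "\<dots> = q ^ n" using r by (metis mult.commute power_mult)
    finally show ?case by (simp add: add.commute)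
  qed
qed

lemma eventually_w_of_le_power:
  fixes v :: "'d::finite phase \<Rightarrow> real"
  assumes v: "admissible v" and R: "0 \<le> R" and q: "1 < q"
  shows "\<forall>\<^sub>F n in sequentially. w_of v (real n * R) \<le> q ^ n"
proof -
  have v': "weight v" "submultiplicative v" "GRS v" using v by (auto simp: admissible_def)
  have "\<forall>\<^sub>F n in sequentially. root n (w_of v (real n * R)) < q"
    using v'(3) R q unfolding GRS_def by (intro order_tendstoD(2)[of _ 1]) auto
  with eventually_gt_at_top[of 0] show ?thesis
  proof eventually_elim
    case (elim n)
    have "1 \<le> w_of v (real n * R)"
      using weight_le_w_of[OF v'(1,2), of 0 "real n * R"] weight_zero[OF v'(1)] R by simp
    then have w: "0 \<le> w_of v (real n * R)" by simp
    then have "w_of v (real n * R) = root n (w_of v (real n * R)) ^ n"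
      using elim by (simp add: real_root_pow_pos2)
    also have "\<dots> \<le> q ^ n" using elim w by (intro power_mono) (auto simp: real_root_ge_zero)
    finally show ?case .
  qed
qed

lemma weighted_finite_approximation:
  fixes g :: "'a \<Rightarrow> real"
  assumes "g summable_on UNIV" "0 < e"
  shows "\<exists>\<Lambda>. finite \<Lambda> \<and> (\<Sum>\<^sub>\<infinity>x\<in>- \<Lambda>. g x) \<le> e"
proof -
  obtain \<Lambda> where \<Lambda>: "finite \<Lambda>" "dist (sum g \<Lambda>) (infsum g UNIV) \<le> e"
    using has_sum_finite_approximation[OF has_sum_infsum[OF assms(1)] assms(2)] by auto
  have "infsum g UNIV = infsum g (\<Lambda> \<union> - \<Lambda>)" by simp
  also have "\<dots> = infsum g \<Lambda> + infsum g (- \<Lambda>)"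
    by (rule infsum_Un_disjoint) (use assms \<Lambda> summable_on_subset_banach in auto)
  finally show ?thesis using \<Lambda> by (intro exI[of _ \<Lambda>]) (auto simp: dist_real_def)
qed

text \<open>The coefficients of the \<open>n\<close>-th power grow at most at the exponential rate \<open>s\<close> of its operator
  norm: the loss is polynomial, from counting grid points, and subexponential, from the weight.\<close>

lemma coefficient_power_bound:
  fixes v :: "'d::finite phase \<Rightarrow> real"
  assumes v: "admissible v" and c: "in_Av v c" and s: "0 < s" and C: "1 \<le> C"
    and T: "\<And>n. bop_norm (tfop c ^ n) \<le> C * s ^ n" and r: "s < r"
  shows "\<exists>K\<ge>0. \<forall>n F. finite F \<longrightarrow> (\<Sum>lam\<in>F. v lam * cmod ((tconv c ^^ n) (delta 0) lam)) \<le> K * r ^ n"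
proof -
  have v': "weight v" "submultiplicative v" using v by (auto simp: admissible_def)
  have cs: "(\<lambda>lam. v lam * cmod (c lam)) summable_on UNIV" using c by (simp add: in_Av_def)
  have c1: "l1 c" by (rule in_Av_l1[OF v'(1) c])
  \<comment> \<open>The rate below is \<open>s + 2 * C * \<epsilon>\<close>; this choice keeps it at
    or below the midpoint of \<open>s\<close> and \<open>r\<close>.\<close>
  define e where "e = (r - s) / (4 * C)"
  have e: "0 < e" unfolding e_def using r C by simp
  obtain \<Lambda> where \<Lambda>: "finite \<Lambda>" "(\<Sum>\<^sub>\<infinity>lam\<in>- \<Lambda>. v lam * cmod (c lam)) \<le> e"
    using weighted_finite_approximation[OF cs e] by blast
  define F where "F lam = (if lam \<in> \<Lambda> then c lam else 0)" for lam
  define G where "G lam = (if lam \<in> \<Lambda> then 0 else c lam)" for lam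
  have cFG: "(\<lambda>lam. F lam + G lam) = c" by (auto simp: F_def G_def fun_eq_iff)
  have F0: "F \<mu> = 0" if "\<mu> \<notin> \<Lambda>" for \<mu> using that by (simp add: F_def)
  have F1: "l1 F" by (rule l1_finite_support[OF \<Lambda>(1) F0])
  have G1: "l1 G" by (rule summable_on_comparison_test[OF c1]) (auto simp: G_def)
  have vnn: "0 \<le> v lam" for lam by (rule weight_nonneg[OF v'(1)])
  have Gs: "(\<lambda>lam. v lam * cmod (G lam)) summable_on UNIV"
    by (rule summable_on_comparison_test[OF cs]) (auto simp: G_def vnn)
  define \<epsilon> where "\<epsilon> = (\<Sum>\<^sub>\<infinity>lam. v lam * cmod (G lam))"
  have "\<epsilon> = (\<Sum>\<^sub>\<infinity>lam\<in>- \<Lambda>. v lam * cmod (c lam))"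
    unfolding \<epsilon>_def by (rule infsum_cong_neutral) (auto simp: G_def)
  then have \<epsilon>: "\<epsilon> \<le> e" "0 \<le> \<epsilon>" using \<Lambda>(2) vnn by (auto simp: \<epsilon>_def intro!: infsum_nonneg)
  have NG: "bop_norm (tfop G) \<le> \<epsilon>"
  proof -
    have "(\<Sum>\<^sub>\<infinity>lam. cmod (G lam)) \<le> \<epsilon>"
      unfolding \<epsilon>_def using weight_ge_1[OF v'(1)]
      by (intro infsum_mono G1 Gs) (simp add: mult_le_cancel_right1)
    then show ?thesis using bop_norm_tfop[OF G1] by linarith
  qed
  have TF: "tfop F = tfop c - tfop G" using tfop_add[OF F1 G1] unfolding cFG by simp
  have FB: "bop_norm (tfop F ^ m) \<le> C * (s + C * \<epsilon>) ^ m" for m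
    using bop.perturbed_power_bound[OF T NG, of 0 m] unfolding TF by simp
  define \<sigma> where "\<sigma> = s + C * \<epsilon> + C * \<epsilon>"
  have "C * \<epsilon> \<le> (r - s) / 4" using \<epsilon> C unfolding e_def by (simp add: field_simps)
  moreover have "0 \<le> C * \<epsilon>" using C \<epsilon> by simp
  ultimately have \<sigma>: "0 < \<sigma>" "\<sigma> < r" unfolding \<sigma>_def using s r by (simp_all add: field_simps)
  define R where "R = (\<Sum>lam\<in>\<Lambda>. norm lam)"
  define K where "K n = real ((n + 1) ^ card \<Lambda>) * w_of v (real n * R)" for n
  have R: "0 \<le> R" unfolding R_def by (simp add: sum_nonneg)
  have bound: "(\<Sum>lam\<in>A. v lam * cmod ((tconv c ^^ n) (delta 0) lam)) \<le> K n * (C * \<sigma> ^ n)"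
    if A: "finite A" for A n
  proof -
    have "decomposes v \<Lambda> n ((tconv c ^^ n) (delta 0)) (C * \<sigma> ^ n)"
      using decomposes_powers[OF v' \<Lambda>(1) F0 Gs G1 FB, of 0 n] unfolding cFG \<sigma>_def \<epsilon>_def by simp
    from decomposes_bound[OF v' \<Lambda>(1) this] A show ?thesis unfolding K_def R_def by blast
  qed
  \<comment> \<open>The gap between \<open>\<sigma>\<close> and \<open>r\<close> is shared equally:
    one factor \<open>q ^ n\<close> absorbs the grid count, the other the weight.\<close>
  define q where "q = sqrt (r / \<sigma>)"
  have q: "1 < q" "q * q = r / \<sigma>" using \<sigma> unfolding q_def by auto
  have "\<forall>\<^sub>F n in sequentially. K n * (C * \<sigma> ^ n) \<le> C * r ^ n"
    using eventually_poly_le_power[OF q(1), of "card \<Lambda>"] eventually_w_of_le_power[OF v R q(1)]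
  proof eventually_elim
    case (elim n)
    have w: "0 \<le> w_of v (real n * R)"
      using weight_le_w_of[OF v', of 0 "real n * R"] weight_zero[OF v'(1)] R by simp
    have "K n \<le> q ^ n * q ^ n" unfolding K_def by (intro mult_mono elim w) (use q in auto)
    also have "\<dots> = (r / \<sigma>) ^ n" by (simp add: q(2)[symmetric] power_mult_distrib)
    finally have "K n * (C * \<sigma> ^ n) \<le> (r / \<sigma>) ^ n * (C * \<sigma> ^ n)"
      using C \<sigma> by (intro mult_right_mono) auto
    then show ?case using \<sigma> by (simp add: power_divide mult.commute[of C])
  qed
  then obtain n0 where n0: "\<And>n. n \<ge> n0 \<Longrightarrow> K n * (C * \<sigma> ^ n) \<le> C * r ^ n"
    by (auto simp: eventually_sequentially)
  have r0: "0 < r" using s r by simp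
  define M where "M = C + (\<Sum>n\<le>n0. \<bar>K n * (C * \<sigma> ^ n) / r ^ n\<bar>)"
  have "K n * (C * \<sigma> ^ n) \<le> M * r ^ n" for n
  proof (cases "n \<le> n0")
    case True
    have "\<bar>K n * (C * \<sigma> ^ n) / r ^ n\<bar> \<le> (\<Sum>n\<le>n0. \<bar>K n * (C * \<sigma> ^ n) / r ^ n\<bar>)"
      by (rule member_le_sum) (use True in auto)
    then have "K n * (C * \<sigma> ^ n) / r ^ n \<le> M" unfolding M_def using C by linarith
    then show ?thesis using r0 by (simp add: field_simps)
  next
    case False
    then have "K n * (C * \<sigma> ^ n) \<le> C * r ^ n" by (intro n0) simp
    also have "\<dots> \<le> M * r ^ n"
      using r0 unfolding M_def by (intro mult_right_mono) (auto simp: sum_nonneg)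
    finally show ?thesis .
  qed
  moreover have "0 \<le> M" unfolding M_def using C by (simp add: sum_nonneg)
  ultimately show ?thesis using bound by (meson order_trans)
qed

lemma tfop_partial_sum:
  assumes "\<And>n. l1 (a n)"
  shows "l1 (\<lambda>lam. \<Sum>n<k. a n lam) \<and> tfop (\<lambda>lam. \<Sum>n<(k::nat). a n lam) = (\<Sum>n<k. tfop (a n))"
proof (induction k)
  case 0
  have "tfop (\<lambda>lam. 0 * delta 0 lam) = (0 :: 'a bop)"
    by (subst tfop_scale) (auto simp: l1_delta bop.sc_zero)
  then show ?case by simp
next
  case (Suc k)
  then show ?case using tfop_add[of "\<lambda>lam. \<Sum>n<k. a n lam" "a k"] l1_add[of "\<lambda>lam. \<Sum>n<k. a n lam" "a k"] assms
    by simp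
qed

text \<open>The hypothesis makes the Neumann series converge geometrically in the weighted norm,
  with ratio \<open>r / cmod z\<close>. It is summed coefficientwise, which keeps the sum in the
  weighted algebra; that it is the inverse is then checked in operator norm through the
  tails.\<close>

lemma resolvent_in_Av:
  fixes v :: "'d::finite phase \<Rightarrow> real"
  assumes v: "weight v" and c: "l1 c" and r: "0 < r" "r < cmod z" and K: "0 \<le> K"
    and b: "\<And>n F. finite F \<Longrightarrow> (\<Sum>lam\<in>F. v lam * cmod ((tconv c ^^ n) (delta 0) lam)) \<le> K * r ^ n"
  shows "\<exists>d. in_Av v d \<and> bop.resolvent_at (tfop c) z (tfop d)"
proof -
  have z: "z \<noteq> 0" "0 < cmod z" using r by auto
  note v1 = weight_ge_1[OF v]
  define a where "a n lam = 1 / z ^ Suc n * (tconv c ^^ n) (delta 0) lam" for n lam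
  define p where "p = r / cmod z"
  define B where "B n = K / cmod z * p ^ n" for n
  have p: "0 < p" "p < 1" using r z by (auto simp: p_def)
  have aB: "(\<Sum>lam\<in>F. v lam * cmod (a n lam)) \<le> B n" if "finite F" for n F
  proof -
    have "(\<Sum>lam\<in>F. v lam * cmod (a n lam)) = 1 / cmod z ^ Suc n * (\<Sum>lam\<in>F. v lam * cmod ((tconv c ^^ n) (delta 0) lam))"
      unfolding a_def sum_distrib_left by (intro sum.cong) (auto simp: norm_mult norm_divide norm_power)
    also have "\<dots> \<le> 1 / cmod z ^ Suc n * (K * r ^ n)" using z by (intro mult_left_mono b that) auto
    also have "\<dots> = B n" unfolding B_def p_def by (simp add: power_divide)
    finally show ?thesis .
  qed
  have Bk: "((\<lambda>n. B (n + k)) has_sum K / cmod z * p ^ k / (1 - p)) UNIV" for k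
  proof -
    have "(\<lambda>n. K / cmod z * p ^ k * p ^ n) sums (K / cmod z * p ^ k * (1 / (1 - p)))"
      by (intro sums_mult geometric_sums) (use p in auto)
    then have "(\<lambda>n. B (n + k)) sums (K / cmod z * p ^ k / (1 - p))"
      by (simp add: B_def power_add mult_ac)
    moreover have "0 \<le> B n" for n using K z p by (simp add: B_def)
    ultimately show ?thesis by (intro sums_nonneg_imp_has_sum)
  qed
  \<comment> \<open>\<open>d k\<close> is the tail of the Neumann series from index
    \<open>k\<close>, and \<open>d 0\<close> is the candidate inverse.\<close>
  define d where "d k lam = (\<Sum>\<^sub>\<infinity>n. a (n + k) lam)" for k :: nat and lam
  have as: "(\<lambda>n. a (n + k) lam) summable_on UNIV" for k lam
    by (rule abs_summable_summable, rule weighted_summable(2)[OF v1 aB has_sum_imp_summable[OF Bk]])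
  have dB: "(\<Sum>lam\<in>F. v lam * cmod (d k lam)) \<le> K / cmod z * p ^ k / (1 - p)" if "finite F" for k F
    by (rule weighted_sum_le[OF v1 aB Bk _ that]) (use has_sum_infsum[OF as] in \<open>auto simp: d_def\<close>)
  note dW = weighted_boundD[OF v1 dB] and aW = weighted_boundD[OF v1 aB]
  define T where "T = tfop c"
  have ta: "tfop (a n) = bop_scalar (1 / z ^ Suc n) * T ^ n" for n
    unfolding a_def T_def
    by (subst tfop_scale) (simp_all add: l1_funpow_tconv c l1_delta tfop_funpow_tconv tfop_delta_0)
  define P where "P k = (\<Sum>n<k. bop_scalar (1 / z ^ Suc n) * T ^ n)" for k
  have split: "tfop (d 0) = P k + tfop (d k)" for k
  proof -
    have "d 0 lam = (\<Sum>n<k. a n lam) + d k lam" for lam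
    proof -
      have "d 0 lam = infsum (\<lambda>n. a n lam) ({..<k} \<union> {k..})"
      proof -
        have "{..<k} \<union> {k..} = UNIV" by auto
        then show ?thesis by (simp add: d_def)
      qed
      also have "\<dots> = (\<Sum>n<k. a n lam) + infsum (\<lambda>n. a n lam) {k..}"
        using as[of 0 lam] by (subst infsum_Un_disjoint) (auto intro: summable_on_subset_banach)
      also have "infsum (\<lambda>n. a n lam) {k..} = d k lam"
        unfolding d_def
        by (rule infsum_reindex_bij_betw[symmetric]) (auto intro!: bij_betwI[of _ _ _ "\<lambda>n. n - k"])
      finally show ?thesis .
    qed
    then have "tfop (d 0) = tfop (\<lambda>lam. (\<Sum>n<k. a n lam) + d k lam)" by presburger
    then show ?thesis
      using tfop_partial_sum[of a k] aW(2) dW(2) by (simp add: tfop_add P_def ta)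
  qed
  define \<eta> where "\<eta> k = K / cmod z * p ^ k / (1 - p)" for k
  have NE: "bop_norm (tfop (d k)) \<le> \<eta> k" for k
    using bop_norm_tfop[OF dW(2)] dW(3) unfolding \<eta>_def by (rule order_trans)
  have NT: "bop_norm (bop_scalar (1 / z ^ k) * T ^ k) \<le> K * p ^ k" for k
  proof -
    have "bop_norm (T ^ k) \<le> K * r ^ k"
      using bop_norm_tfop[OF weighted_boundD(2)[OF v1 b]] weighted_boundD(3)[OF v1 b]
      by (simp add: tfop_funpow_tconv c l1_delta tfop_delta_0 T_def) (meson order_trans)
    then show ?thesis using z by (simp add: bop.N_sc norm_divide norm_power p_def power_divide divide_right_mono)
  qed
  let ?A = "bop_scalar z - T"
  have lim: "(\<lambda>k. \<eta> k * bop_norm ?A + K * p ^ k) \<longlonglongrightarrow> 0"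
  proof -
    have "(\<lambda>k. K / cmod z / (1 - p) * bop_norm ?A * p ^ k + K * p ^ k) \<longlonglongrightarrow>
        K / cmod z / (1 - p) * bop_norm ?A * 0 + K * 0"
      by (intro tendsto_intros LIMSEQ_realpow_zero) (use p in auto)
    then show ?thesis by (simp add: \<eta>_def mult_ac)
  qed
  \<comment> \<open>The error bound holds for every \<open>k\<close> and tends to 0, so the norm of
    \<open>x - 1\<close> vanishes.\<close>
  have zero: "x = 1" if "\<And>k. bop_norm (x - 1) \<le> \<eta> k * bop_norm ?A + K * p ^ k" for x :: "'d bop"
  proof -
    have "bop_norm (x - 1) \<le> 0"
      by (rule LIMSEQ_le_const[OF lim]) (use that in auto)
    then have "bop_norm (x - 1) = 0" using bop.N_nonneg by (rule antisym)
    from bop_norm_eq_0_imp[OF this] show ?thesis by simp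
  qed
  have "tfop (d 0) * ?A = 1"
  proof (rule zero)
    fix k
    have "tfop (d 0) * ?A - 1 = tfop (d k) * ?A - bop_scalar (1 / z ^ k) * T ^ k"
      unfolding split[of k] distrib_right P_def bop.neumann_partial_sum(2)[OF z(1)] by simp
    also have "bop_norm \<dots> \<le> \<eta> k * bop_norm ?A + K * p ^ k"
      by (rule order_trans[OF bop.N_diff add_mono[OF bop.N_mult_le[OF NE order_refl] NT]])
    finally show "bop_norm (tfop (d 0) * ?A - 1) \<le> \<eta> k * bop_norm ?A + K * p ^ k" .
  qed
  moreover have "?A * tfop (d 0) = 1"
  proof (rule zero)
    fix k
    have "?A * tfop (d 0) - 1 = ?A * tfop (d k) - bop_scalar (1 / z ^ k) * T ^ k"
      unfolding split[of k] distrib_left P_def bop.neumann_partial_sum(1)[OF z(1)] by simp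
    also have "bop_norm \<dots> \<le> bop_norm ?A * \<eta> k + K * p ^ k"
      by (rule order_trans[OF bop.N_diff add_mono[OF bop.N_mult_le[OF order_refl NE] NT]])
    finally show "bop_norm (?A * tfop (d 0) - 1) \<le> \<eta> k * bop_norm ?A + K * p ^ k"
      by (simp add: mult.commute)
  qed
  ultimately have "bop.resolvent_at (tfop c) z (tfop (d 0))"
    unfolding bop.resolvent_at_def T_def by blast
  moreover have "in_Av v (d 0)" by (rule in_AvI[OF dW(2) dW(1)])
  ultimately show ?thesis by blast
qed

section \<open>Spectra expressed by resolvents in the quotient ring\<close>

lemma inverse_on_L2_iff:
  assumes c: "l1 c" and S: "bounded_op S"
  shows "inverse_on_L2 S (shift_op z (tf_op c)) \<longleftrightarrow> bop.resolvent_at (tfop c) z (abs_bop S)"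
proof -
  have sh: "shift_op z (tf_op c) = (\<lambda>f x. z * f x - tf_op c f x)" by (simp add: shift_op_def fun_eq_iff)
  have bc: "bounded_op (tf_op c)" by (rule bounded_op_tf_op[OF c])
  have bz: "bounded_op (\<lambda>(f::'a fn) x. z * f x)" by (rule bounded_op_scale[OF bounded_op_id])
  have bs: "bounded_op (shift_op z (tf_op c))" unfolding sh by (rule bounded_op_diff[OF bz bc])
  have "bop_scalar z - tfop c = abs_bop (shift_op z (tf_op c))"
    unfolding sh tfop_def bop_scalar.abs_eq by (rule minus_bop.abs_eq[OF op_eq_refl[OF bz] op_eq_refl[OF bc]])
  then show ?thesis
    unfolding bop.resolvent_at_def inverse_on_L2_def
    by (simp add: times_bop.abs_eq[OF op_eq_refl[OF S] op_eq_refl[OF bs]]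
        times_bop.abs_eq[OF op_eq_refl[OF bs] op_eq_refl[OF S]] one_bop.abs_eq
        abs_bop_eq_iff[OF bounded_op_comp[OF S bs] bounded_op_id]
        abs_bop_eq_iff[OF bounded_op_comp[OF bs S] bounded_op_id]) blast
qed

lemma spectrum_B_iff:
  assumes "l1 c"
  shows "z \<in> spectrum_B (tf_op c) \<longleftrightarrow> \<not> (\<exists>y. bop.resolvent_at (tfop c) z y)"
proof -
  have "(\<exists>S. bounded_op S \<and> inverse_on_L2 S (shift_op z (tf_op c))) \<longleftrightarrow> (\<exists>y. bop.resolvent_at (tfop c) z y)"
  proof
    assume "\<exists>y. bop.resolvent_at (tfop c) z y"
    then obtain y where y: "bop.resolvent_at (tfop c) z y" by blast
    obtain S where "bounded_op S" "y = abs_bop S" using exists_abs_bop[of y] by blast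
    with y show "\<exists>S. bounded_op S \<and> inverse_on_L2 S (shift_op z (tf_op c))"
      using inverse_on_L2_iff[OF assms, of S z] by blast
  qed (use inverse_on_L2_iff[OF assms] in blast)
  then show ?thesis unfolding spectrum_B_def by blast
qed

lemma spectrum_Av_iff:
  assumes "weight v" "l1 c"
  shows "z \<in> spectrum_Av v (tf_op c) \<longleftrightarrow> \<not> (\<exists>d. in_Av v d \<and> bop.resolvent_at (tfop c) z (tfop d))"
proof -
  have "inverse_on_L2 (tf_op d) (shift_op z (tf_op c)) \<longleftrightarrow> bop.resolvent_at (tfop c) z (tfop d)" if "in_Av v d" for d
    unfolding tfop_def[of d]
    by (rule inverse_on_L2_iff[OF assms(2) bounded_op_tf_op[OF in_Av_l1[OF assms(1) that]]])
  then show ?thesis unfolding spectrum_Av_def by blast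
qed

theorem theorem1:
  fixes v :: "('d::finite) phase \<Rightarrow> real" and c :: "'d phase \<Rightarrow> complex"
  assumes "admissible v" and "in_Av v c"
  shows "spec_radius (spectrum_B (tf_op c)) = spec_radius (spectrum_Av v (tf_op c))"
proof -
  have v: "weight v" using assms(1) by (simp add: admissible_def)
  have c: "l1 c" by (rule in_Av_l1[OF v assms(2)])
  let ?B = "spectrum_B (tf_op c)" and ?A = "spectrum_Av v (tf_op c)" and ?T = "tfop c"
  have BA: "?B \<subseteq> ?A"
    using spectrum_B_iff[OF c] spectrum_Av_iff[OF v c] by blast
  \<comment> \<open>An intermediate \<open>r\<close> is inserted because the coefficient bound loses
    a little on \<open>s\<close> and the Neumann series needs a ratio below 1.\<close>
  have out: "z \<notin> ?A" if s: "0 < s" "s < cmod z" and C: "1 \<le> C" "\<And>n. bop_norm (?T ^ n) \<le> C * s ^ n" for z s C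
  proof -
    obtain r where r: "s < r" "r < cmod z" using s dense by blast
    obtain K where K: "0 \<le> K"
      "\<And>n F. finite F \<Longrightarrow> (\<Sum>lam\<in>F. v lam * cmod ((tconv c ^^ n) (delta 0) lam)) \<le> K * r ^ n"
      using coefficient_power_bound[OF assms s(1) C r(1)] by blast
    have "\<exists>d. in_Av v d \<and> bop.resolvent_at ?T z (tfop d)"
      by (rule resolvent_in_Av[OF v c _ r(2) K]) (use s r in auto)
    then show ?thesis using spectrum_Av_iff[OF v c] by blast
  qed
  have bdd: "bdd_above (cmod ` ?A)"
  proof (rule bdd_aboveI2)
    fix z assume z: "z \<in> ?A"
    \<comment> \<open>Submultiplicativity alone gives a power bound with \<open>C = 1\<close>; the
      \<open>+ 1\<close> ensures a positive rate. Together with \<open>out\<close> it shows that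
      even the spectrum in the weighted algebra is controlled by the operator norm.\<close>
    have le: "bop_norm (?T ^ n) \<le> 1 * (bop_norm ?T + 1) ^ n" for n
    proof -
      have "bop_norm (?T ^ n) \<le> bop_norm ?T ^ n" by (rule bop.N_power)
      also have "\<dots> \<le> (bop_norm ?T + 1) ^ n" by (rule power_mono) (simp_all add: bop.N_nonneg)
      finally show ?thesis by simp
    qed
    show "cmod z \<le> bop_norm ?T + 1"
    proof (rule ccontr)
      assume "\<not> ?thesis"
      then have "z \<notin> ?A" using bop.N_nonneg[of ?T] by (intro out[OF _ _ _ le]) auto
      with z show False by contradiction
    qed
  qed
  obtain z0 where z0: "z0 \<in> ?B" using bop.exists_spectral_value[of ?T] spectrum_B_iff[OF c] by blast
  have bddB: "bdd_above (cmod ` ?B)" by (rule bdd_above_mono[OF bdd image_mono[OF BA]])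
  have upB: "cmod z \<le> spec_radius ?B" if "z \<in> ?B" for z
    unfolding spec_radius_def by (rule cSUP_upper[OF that bddB])
  have "spec_radius ?A \<le> spec_radius ?B"
    unfolding spec_radius_def[of ?A]
  proof (rule cSUP_least)
    show "?A \<noteq> {}" using z0 BA by blast
    fix z assume z: "z \<in> ?A"
    show "cmod z \<le> spec_radius ?B"
    proof (rule ccontr)
      assume "\<not> ?thesis"
      \<comment> \<open>All points of modulus at least \<open>s\<close> lie outside the operator
        spectrum, while \<open>z\<close> stays strictly beyond \<open>s\<close>, as
        \<open>out\<close> demands.\<close>
      then obtain s where s: "spec_radius ?B < s" "s < cmod z" using dense not_le by blast
      have s0: "0 < s" using upB[OF z0] s norm_ge_zero[of z0] by linarith
      have "\<exists>y. bop.resolvent_at ?T w y" if "s \<le> cmod w" for w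
        using upB[of w] spectrum_B_iff[OF c, of w] s that by force
      from bop.power_bound_of_resolvent[OF s0 this] obtain C where
        "1 \<le> C" "\<And>n. bop_norm (?T ^ n) \<le> C * s ^ n" by blast
      with out[OF s0 s(2)] z show False by blast
    qed
  qed
  moreover have "spec_radius ?B \<le> spec_radius ?A"
    unfolding spec_radius_def by (rule cSUP_subset_mono[OF _ bdd BA]) (use z0 in auto)
  ultimately show ?thesis by simp
qed

end
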